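(* Let $G$ be a chordal graph and suppose that $\operatorname{char}(K)=0$. Then $\Delta(G)^e=\Delta(G)^s$.
   Context: Graphs are finite and simple; a graph is chordal if every cycle of length at least $4$ has a chord. $\Delta(G)$ is the clique complex of $G$ (faces are the cliques of $G$), viewed on vertex set $[n]$. $K$ is a field; $\Delta^e$ denotes the (generic) exterior algebraic shifting of a simplicial complex $\Delta$ over $K$ and $\Delta^s$ its (generic) symmetric algebraic shifting, as in Herzog–Hibi, Monomial Ideals, Chapter 11. *)

theory Defs
  imports
    "HOL-Library.Poly_Mapping"
    "HOL-Algebra.Ideal"
    "Jordan_Normal_Form.Matrix"
begin

text \<open>
  The vertex set \<open>[n]\<close> is rendered as \<open>{..<n}\<close>, so that vertices, variables \<open>x\<^sub>0, \<dots>, x\<^bsub>n-1\<^esub>\<close>,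
  generators \<open>e\<^sub>0, \<dots>, e\<^bsub>n-1\<^esub>\<close> and the rows and columns of matrices share their indices.
  Conventions follow Herzog--Hibi, \<^emph>\<open>Monomial Ideals\<close>, Chapters 4, 5 and 11.
\<close>


section \<open>Graphs, chordality, clique complexes\<close>

definition simple_graph :: "nat \<Rightarrow> nat set set \<Rightarrow> bool" where
  "simple_graph n E \<longleftrightarrow> (\<forall>e\<in>E. e \<subseteq> {..<n} \<and> card e = 2)"

definition is_cycle :: "nat set set \<Rightarrow> nat list \<Rightarrow> bool" where
  "is_cycle E vs \<longleftrightarrow> length vs \<ge> 3 \<and> distinct vs \<and>
     (\<forall>i<length vs. {vs ! i, vs ! (Suc i mod length vs)} \<in> E)"

definition has_chord :: "nat set set \<Rightarrow> nat list \<Rightarrow> bool" where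
  "has_chord E vs \<longleftrightarrow> (\<exists>i<length vs. \<exists>j<length vs.
     i \<noteq> j \<and> j \<noteq> Suc i mod length vs \<and> i \<noteq> Suc j mod length vs \<and> {vs ! i, vs ! j} \<in> E)"

definition chordal :: "nat set set \<Rightarrow> bool" where
  "chordal E \<longleftrightarrow> (\<forall>vs. is_cycle E vs \<and> length vs \<ge> 4 \<longrightarrow> has_chord E vs)"

definition simplicial_complex :: "nat \<Rightarrow> nat set set \<Rightarrow> bool" where
  "simplicial_complex n \<Delta> \<longleftrightarrow> \<Delta> \<subseteq> Pow {..<n} \<and> (\<forall>F\<in>\<Delta>. \<forall>F'\<subseteq>F. F' \<in> \<Delta>)"

definition clique_complex :: "nat \<Rightarrow> nat set set \<Rightarrow> nat set set" where
  "clique_complex n E = {F. F \<subseteq> {..<n} \<and> (\<forall>x\<in>F. \<forall>y\<in>F. x \<noteq> y \<longrightarrow> {x, y} \<in> E)}"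


section \<open>Polynomial rings\<close>

text \<open>A monomial is its exponent vector, a polynomial maps monomials to coefficients; the type
  is the polynomial ring in all variables of type \<open>'v\<close>, and \<open>polys V\<close> is \<open>K[x\<^sub>v | v \<in> V]\<close>.\<close>

type_synonym 'v mon = "'v \<Rightarrow>\<^sub>0 nat"
type_synonym ('v, 'k) mpoly = "'v mon \<Rightarrow>\<^sub>0 'k"

definition polys :: "'v set \<Rightarrow> ('v, 'k::field) mpoly set" where
  "polys V = {p. \<forall>m\<in>Poly_Mapping.keys p. Poly_Mapping.keys m \<subseteq> V}"

definition poly_ring :: "'v set \<Rightarrow> ('v, 'k::field) mpoly ring" where
  "poly_ring V = \<lparr>carrier = polys V, monoid.mult = (*), one = 1, zero = 0, add = (+)\<rparr>"

definition eval_mpoly :: "('k::field \<Rightarrow> 'r::comm_ring_1) \<Rightarrow> ('v \<Rightarrow> 'r) \<Rightarrow> ('v, 'k) mpoly \<Rightarrow> 'r" where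
  "eval_mpoly c f p = (\<Sum>m\<in>Poly_Mapping.keys p. c (Poly_Mapping.lookup p m) *
     (\<Prod>v\<in>Poly_Mapping.keys m. f v ^ Poly_Mapping.lookup m v))"

abbreviation monomial :: "'v mon \<Rightarrow> ('v, 'k::field) mpoly" where
  "monomial m \<equiv> Poly_Mapping.single m 1"

definition sqfree :: "nat set \<Rightarrow> nat mon" where
  "sqfree F = (\<Sum>i\<in>F. Poly_Mapping.single i 1)"

text \<open>The automorphism \<open>x\<^sub>j \<mapsto> \<Sum>\<^sub>i a\<^sub>i\<^sub>j x\<^sub>i\<close> of \<open>K[x\<^sub>0, \<dots>, x\<^bsub>n-1\<^esub>]\<close>.\<close>

definition poly_act :: "nat \<Rightarrow> 'k::field mat \<Rightarrow> (nat, 'k) mpoly \<Rightarrow> (nat, 'k) mpoly" where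
  "poly_act n A = eval_mpoly (Poly_Mapping.single 0)
     (\<lambda>j. \<Sum>i<n. Poly_Mapping.single (Poly_Mapping.single i 1) (A $$ (i, j)))"


section \<open>Exterior algebras\<close>

text \<open>An element \<open>\<Sum>\<^sub>F a\<^sub>F e\<^sub>F\<close> is the map \<open>F \<mapsto> a\<^sub>F\<close>, where \<open>e\<^sub>F = e\<^bsub>i\<^sub>1\<^esub> \<and> \<dots> \<and> e\<^bsub>i\<^sub>d\<^esub>\<close> for
  \<open>F = {i\<^sub>1 < \<dots> < i\<^sub>d}\<close>.\<close>

type_synonym 'k ext = "nat set \<Rightarrow>\<^sub>0 'k"

definition ext_sign :: "nat set \<Rightarrow> nat set \<Rightarrow> 'k::field" where
  "ext_sign F G = (-1) ^ card {(i, j). i \<in> F \<and> j \<in> G \<and> j < i}"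

definition wedge :: "'k::field ext \<Rightarrow> 'k ext \<Rightarrow> 'k ext" where
  "wedge a b = (\<Sum>F\<in>Poly_Mapping.keys a. \<Sum>G\<in>Poly_Mapping.keys b.
     if F \<inter> G = {}
     then Poly_Mapping.single (F \<union> G)
            (ext_sign F G * (Poly_Mapping.lookup a F * Poly_Mapping.lookup b G))
     else 0)"

definition ext_ring :: "nat \<Rightarrow> 'k::field ext ring" where
  "ext_ring n = \<lparr>carrier = {a. \<forall>F\<in>Poly_Mapping.keys a. F \<subseteq> {..<n}}, monoid.mult = wedge,
     one = Poly_Mapping.single {} 1, zero = 0, add = (+)\<rparr>"

abbreviation ext_monomial :: "nat set \<Rightarrow> 'k::field ext" where
  "ext_monomial F \<equiv> Poly_Mapping.single F 1"

text \<open>The automorphism \<open>e\<^sub>j \<mapsto> \<Sum>\<^sub>i a\<^sub>i\<^sub>j e\<^sub>i\<close> of the exterior algebra.\<close>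

definition ext_act :: "nat \<Rightarrow> 'k::field mat \<Rightarrow> 'k ext \<Rightarrow> 'k ext" where
  "ext_act n A a = (\<Sum>F\<in>Poly_Mapping.keys a.
     wedge (Poly_Mapping.single {} (Poly_Mapping.lookup a F))
       (foldr (\<lambda>j b. wedge (\<Sum>i<n. Poly_Mapping.single {i} (A $$ (i, j))) b)
          (sorted_list_of_set F) (Poly_Mapping.single {} 1)))"


section \<open>Generic initial ideals\<close>

definition mon_deg :: "nat mon \<Rightarrow> nat" where
  "mon_deg m = (\<Sum>i\<in>Poly_Mapping.keys m. Poly_Mapping.lookup m i)"

text \<open>The degree reverse lexicographic order induced by \<open>x\<^sub>0 > x\<^sub>1 > \<dots>\<close>; on the exterior algebra
  the order of the monomials \<open>e\<^sub>F\<close> is that of the squarefree monomials \<open>x\<^sub>F\<close>.\<close>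

definition revlex_less :: "nat mon \<Rightarrow> nat mon \<Rightarrow> bool" where
  "revlex_less a b \<longleftrightarrow> mon_deg a < mon_deg b \<or>
     mon_deg a = mon_deg b \<and> (\<exists>k. Poly_Mapping.lookup a k > Poly_Mapping.lookup b k \<and>
       (\<forall>j>k. Poly_Mapping.lookup a j = Poly_Mapping.lookup b j))"

definition ext_less :: "nat set \<Rightarrow> nat set \<Rightarrow> bool" where
  "ext_less F G \<longleftrightarrow> revlex_less (sqfree F) (sqfree G)"

definition leading :: "('m \<Rightarrow> 'm \<Rightarrow> bool) \<Rightarrow> ('m \<Rightarrow>\<^sub>0 'k::zero) \<Rightarrow> 'm" where
  "leading lt f = (THE m. m \<in> Poly_Mapping.keys f \<and>
     (\<forall>m'\<in>Poly_Mapping.keys f. m' \<noteq> m \<longrightarrow> lt m' m))"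

definition initial_ideal :: "nat \<Rightarrow> (nat, 'k::field) mpoly set \<Rightarrow> (nat, 'k) mpoly set" where
  "initial_ideal n I = Idl\<^bsub>poly_ring {..<n}\<^esub> {monomial (leading revlex_less f) | f. f \<in> I \<and> f \<noteq> 0}"

definition ext_initial_ideal :: "nat \<Rightarrow> 'k::field ext set \<Rightarrow> 'k ext set" where
  "ext_initial_ideal n J = Idl\<^bsub>ext_ring n\<^esub> {ext_monomial (leading ext_less f) | f. f \<in> J \<and> f \<noteq> 0}"

definition GL :: "nat \<Rightarrow> 'k::field mat set" where
  "GL n = {A \<in> carrier_mat n n. invertible_mat A}"

text \<open>The Zariski topology on \<open>GL n\<close> is the one induced from the affine space of \<open>n \<times> n\<close> matrices,
  whose coordinates are the matrix entries.\<close>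

definition zariski_open :: "nat \<Rightarrow> 'k::field mat set \<Rightarrow> bool" where
  "zariski_open n U \<longleftrightarrow> (\<exists>P \<subseteq> polys ({..<n} \<times> {..<n}).
     U = {A \<in> GL n. \<exists>p\<in>P. eval_mpoly (\<lambda>c. c) (\<lambda>ij. A $$ ij) p \<noteq> 0})"

text \<open>The value that \<open>f\<close> takes on some nonempty Zariski open subset of \<open>GL n\<close>. It is unique over an
  infinite field, where any two such subsets meet.\<close>

definition generic_value :: "nat \<Rightarrow> ('k::field mat \<Rightarrow> 'a) \<Rightarrow> 'a" where
  "generic_value n f = (THE v. \<exists>U. zariski_open n U \<and> U \<noteq> {} \<and> (\<forall>A\<in>U. f A = v))"

definition gin :: "nat \<Rightarrow> (nat, 'k::field) mpoly set \<Rightarrow> (nat, 'k) mpoly set" where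
  "gin n I = generic_value n (\<lambda>A. initial_ideal n (poly_act n A ` I))"

definition ext_gin :: "nat \<Rightarrow> 'k::field ext set \<Rightarrow> 'k ext set" where
  "ext_gin n J = generic_value n (\<lambda>A. ext_initial_ideal n (ext_act n A ` J))"


section \<open>Exterior and symmetric shifting\<close>

definition stanley_reisner :: "nat \<Rightarrow> nat set set \<Rightarrow> (nat, 'k::field) mpoly set" where
  "stanley_reisner n \<Delta> = Idl\<^bsub>poly_ring {..<n}\<^esub> {monomial (sqfree F) | F. F \<subseteq> {..<n} \<and> F \<notin> \<Delta>}"

definition ext_face_ideal :: "nat \<Rightarrow> nat set set \<Rightarrow> 'k::field ext set" where
  "ext_face_ideal n \<Delta> = Idl\<^bsub>ext_ring n\<^esub> {ext_monomial F | F. F \<subseteq> {..<n} \<and> F \<notin> \<Delta>}"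

definition exterior_shift :: "'k::field itself \<Rightarrow> nat \<Rightarrow> nat set set \<Rightarrow> nat set set" where
  "exterior_shift _ n \<Delta> = (THE \<Gamma>. simplicial_complex n \<Gamma> \<and>
     (ext_face_ideal n \<Gamma> :: 'k ext set) = ext_gin n (ext_face_ideal n \<Delta>))"

text \<open>The set \<open>G(I)\<close> of minimal monomial generators of a monomial ideal.\<close>

definition min_gens :: "(nat, 'k::field) mpoly set \<Rightarrow> nat mon set" where
  "min_gens I = {m. monomial m \<in> I \<and>
     (\<forall>m'. monomial m' \<in> I \<and> (\<forall>i. Poly_Mapping.lookup m' i \<le> Poly_Mapping.lookup m i) \<longrightarrow> m' = m)}"

text \<open>For \<open>u = x\<^bsub>i\<^sub>1\<^esub> x\<^bsub>i\<^sub>2\<^esub> \<dots> x\<^bsub>i\<^sub>d\<^esub>\<close> with \<open>i\<^sub>1 \<le> \<dots> \<le> i\<^sub>d\<close>,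
  \<open>u\<^sup>\<sigma> = x\<^bsub>i\<^sub>1\<^esub> x\<^bsub>i\<^sub>2+1\<^esub> \<dots> x\<^bsub>i\<^sub>d+(d-1)\<^esub>\<close>.\<close>

definition mon_indices :: "nat mon \<Rightarrow> nat list" where
  "mon_indices m = concat (map (\<lambda>i. replicate (Poly_Mapping.lookup m i) i)
     (sorted_list_of_set (Poly_Mapping.keys m)))"

definition sigma :: "nat mon \<Rightarrow> nat mon" where
  "sigma m = (\<Sum>k<length (mon_indices m). Poly_Mapping.single (mon_indices m ! k + k) 1)"

text \<open>The ideal \<open>I\<^sup>\<sigma>\<close>, formed in \<open>K[x\<^sub>0, \<dots>, x\<^bsub>n-1\<^esub>]\<close>: for the generic initial ideal \<open>I\<close> of a
  Stanley--Reisner ideal the generators \<open>u\<^sup>\<sigma>\<close> lie there.\<close>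

definition sigma_ideal :: "nat \<Rightarrow> (nat, 'k::field) mpoly set \<Rightarrow> (nat, 'k) mpoly set" where
  "sigma_ideal n I = Idl\<^bsub>poly_ring {..<n}\<^esub> {monomial (sigma u) | u. u \<in> min_gens I}"

definition symmetric_shift :: "'k::field itself \<Rightarrow> nat \<Rightarrow> nat set set \<Rightarrow> nat set set" where
  "symmetric_shift _ n \<Delta> = (THE \<Gamma>. simplicial_complex n \<Gamma> \<and>
     (stanley_reisner n \<Gamma> :: (nat, 'k) mpoly set) = sigma_ideal n (gin n (stanley_reisner n \<Delta>)))"


section \<open>The ambient structures are rings\<close>

text \<open>\<open>Idl\<^bsub>R\<^esub>\<close> is the intersection of the ideals containing a set, and ideals presuppose a ring.\<close>

lemma polys_closed:
  assumes "p \<in> polys V" "q \<in> polys V"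
  shows "p + q \<in> polys V" "p * q \<in> polys V" "- p \<in> polys V"
proof -
  show "p + q \<in> polys V"
    using assms Poly_Mapping.keys_add[of p q] by (fastforce simp: polys_def)
  show "- p \<in> polys V"
    using assms by (simp add: polys_def in_keys_iff)
  show "p * q \<in> polys V"
    unfolding polys_def
  proof (intro CollectI ballI)
    fix m assume "m \<in> Poly_Mapping.keys (p * q)"
    then obtain a b where "m = a + b" "a \<in> Poly_Mapping.keys p" "b \<in> Poly_Mapping.keys q"
      using keys_mult[of p q] by blast
    then show "Poly_Mapping.keys m \<subseteq> V"
      using assms Poly_Mapping.keys_add[of a b] by (fastforce simp: polys_def)
  qed
qed

lemma ring_poly_ring: "ring (poly_ring V :: ('v, 'k::field) mpoly ring)"
proof (intro ringI abelian_groupI monoidI)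
  fix x :: "('v, 'k) mpoly" assume "x \<in> carrier (poly_ring V)"
  then show "\<exists>y\<in>carrier (poly_ring V). y \<oplus>\<^bsub>poly_ring V\<^esub> x = \<zero>\<^bsub>poly_ring V\<^esub>"
    by (intro bexI[of _ "- x"]) (auto simp: poly_ring_def polys_closed)
qed (auto simp: poly_ring_def polys_closed algebra_simps, auto simp: polys_def)

definition ext_term :: "nat set \<Rightarrow> nat set \<Rightarrow> 'k::field \<Rightarrow> 'k ext" where
  "ext_term F G c = (if F \<inter> G = {} then Poly_Mapping.single (F \<union> G) (ext_sign F G * c) else 0)"

lemma ext_term_0 [simp]: "ext_term F G 0 = 0"
  by (simp add: ext_term_def)

lemma ext_term_add: "ext_term F G (c + d) = ext_term F G c + ext_term F G d"
  by (simp add: ext_term_def distrib_left single_add)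

lemma wedge_superset:
  assumes "finite A" "Poly_Mapping.keys a \<subseteq> A" "finite B" "Poly_Mapping.keys b \<subseteq> B"
  shows "wedge a b =
    (\<Sum>F\<in>A. \<Sum>G\<in>B. ext_term F G (Poly_Mapping.lookup a F * Poly_Mapping.lookup b G))"
proof -
  have "wedge a b = (\<Sum>F\<in>Poly_Mapping.keys a. \<Sum>G\<in>Poly_Mapping.keys b.
      ext_term F G (Poly_Mapping.lookup a F * Poly_Mapping.lookup b G))"
    by (simp add: wedge_def ext_term_def)
  also have "\<dots> = (\<Sum>F\<in>Poly_Mapping.keys a. \<Sum>G\<in>B.
      ext_term F G (Poly_Mapping.lookup a F * Poly_Mapping.lookup b G))"
    by (intro sum.cong refl sum.mono_neutral_left) (use assms in \<open>auto simp: in_keys_iff\<close>)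
  also have "\<dots> = (\<Sum>F\<in>A. \<Sum>G\<in>B. ext_term F G (Poly_Mapping.lookup a F * Poly_Mapping.lookup b G))"
    by (intro sum.mono_neutral_left) (use assms in \<open>auto simp: in_keys_iff\<close>)
  finally show ?thesis .
qed

lemma wedge_add_left: "wedge (a + a') b = wedge a b + wedge a' b"
proof -
  let ?A = "Poly_Mapping.keys a \<union> Poly_Mapping.keys a'"
  have "Poly_Mapping.keys (a + a') \<subseteq> ?A"
    by (rule Poly_Mapping.keys_add)
  then show ?thesis
    by (simp add: wedge_superset[where A = ?A and B = "Poly_Mapping.keys b"]
        lookup_add distrib_right ext_term_add sum.distrib)
qed

lemma wedge_add_right: "wedge b (a + a') = wedge b a + wedge b a'"
proof -
  let ?A = "Poly_Mapping.keys a \<union> Poly_Mapping.keys a'"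
  have "Poly_Mapping.keys (a + a') \<subseteq> ?A"
    by (rule Poly_Mapping.keys_add)
  then show ?thesis
    by (simp add: wedge_superset[where B = ?A and A = "Poly_Mapping.keys b"]
        lookup_add distrib_left ext_term_add sum.distrib)
qed

lemma wedge_0 [simp]: "wedge 0 b = 0" "wedge b 0 = 0"
  by (simp_all add: wedge_def)

lemma wedge_single:
  "wedge (Poly_Mapping.single F c) (Poly_Mapping.single G d) = ext_term F G (c * d)"
  by (simp add: wedge_superset[where A = "{F}" and B = "{G}"])

lemma ext_induct [consumes 1, case_names zero add]:
  assumes "a \<in> carrier (ext_ring n)"
    and "P 0"
    and "\<And>F c b. F \<subseteq> {..<n} \<Longrightarrow> b \<in> carrier (ext_ring n) \<Longrightarrow> P b \<Longrightarrow> P (Poly_Mapping.single F c + b)"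
  shows "P a"
proof -
  have eq: "a = (\<Sum>F\<in>Poly_Mapping.keys a. Poly_Mapping.single F (Poly_Mapping.lookup a F))"
    by (rule poly_mapping_eqI)
       (simp add: lookup_sum lookup_single when_def in_keys_iff)
  have *: "(\<Sum>F\<in>A. Poly_Mapping.single F (g F)) \<in> carrier (ext_ring n) \<and>
      P (\<Sum>F\<in>A. Poly_Mapping.single F (g F))" if "finite A" "\<forall>F\<in>A. F \<subseteq> {..<n}" for A g
    using that
  proof (induction A)
    case empty
    then show ?case using assms(2) by (simp add: ext_ring_def)
  next
    case (insert F A)
    then show ?case
      using assms(3)[of F "\<Sum>F\<in>A. Poly_Mapping.single F (g F)" "g F"]
        Poly_Mapping.keys_add[of "Poly_Mapping.single F (g F)" "\<Sum>F\<in>A. Poly_Mapping.single F (g F)"]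
      by (fastforce simp: ext_ring_def split: if_splits)
  qed
  have "\<forall>F\<in>Poly_Mapping.keys a. F \<subseteq> {..<n}"
    using assms(1) by (simp add: ext_ring_def)
  then show ?thesis
    using *[OF finite_keys] eq by metis
qed

lemma ext_sign_union_left:
  assumes "finite F" "finite G" "finite H" "F \<inter> G = {}"
  shows "ext_sign (F \<union> G) H = (ext_sign F H * ext_sign G H :: 'k::field)"
proof -
  have "{(i, j). i \<in> F \<union> G \<and> j \<in> H \<and> j < i} =
      {(i, j). i \<in> F \<and> j \<in> H \<and> j < i} \<union> {(i, j). i \<in> G \<and> j \<in> H \<and> j < i}"
    by auto
  moreover have "finite {(i, j). i \<in> F \<and> j \<in> H \<and> j < i}" "finite {(i, j). i \<in> G \<and> j \<in> H \<and> j < i}"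
    by (rule finite_subset[of _ "F \<times> H"] finite_subset[of _ "G \<times> H"]; use assms in auto)+
  moreover have "{(i, j). i \<in> F \<and> j \<in> H \<and> j < i} \<inter> {(i, j). i \<in> G \<and> j \<in> H \<and> j < i} = {}"
    using assms by auto
  ultimately show ?thesis
    by (simp add: ext_sign_def card_Un_disjoint power_add)
qed

lemma ext_sign_union_right:
  assumes "finite F" "finite G" "finite H" "F \<inter> G = {}"
  shows "ext_sign H (F \<union> G) = (ext_sign H F * ext_sign H G :: 'k::field)"
proof -
  have "{(i, j). i \<in> H \<and> j \<in> F \<union> G \<and> j < i} =
      {(i, j). i \<in> H \<and> j \<in> F \<and> j < i} \<union> {(i, j). i \<in> H \<and> j \<in> G \<and> j < i}"
    by auto
  moreover have "finite {(i, j). i \<in> H \<and> j \<in> F \<and> j < i}" "finite {(i, j). i \<in> H \<and> j \<in> G \<and> j < i}"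
    by (rule finite_subset[of _ "H \<times> F"] finite_subset[of _ "H \<times> G"]; use assms in auto)+
  moreover have "{(i, j). i \<in> H \<and> j \<in> F \<and> j < i} \<inter> {(i, j). i \<in> H \<and> j \<in> G \<and> j < i} = {}"
    using assms by auto
  ultimately show ?thesis
    by (simp add: ext_sign_def card_Un_disjoint power_add)
qed

lemma wedge_assoc_single:
  assumes "finite F" "finite G" "finite H"
  shows "wedge (wedge (Poly_Mapping.single F c) (Poly_Mapping.single G d)) (Poly_Mapping.single H e) =
    wedge (Poly_Mapping.single F c) (wedge (Poly_Mapping.single G d) (Poly_Mapping.single H e))"
proof (cases "F \<inter> G = {} \<and> F \<inter> H = {} \<and> G \<inter> H = {}")
  case True
  then show ?thesis
    using assms
    by (simp add: wedge_single ext_term_def ext_sign_union_left ext_sign_union_right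
        Int_Un_distrib Int_Un_distrib2 Un_assoc mult_ac)
next
  case False
  then show ?thesis
    by (auto simp: wedge_single ext_term_def)
qed

lemma wedge_assoc:
  assumes "a \<in> carrier (ext_ring n)" "b \<in> carrier (ext_ring n)" "c \<in> carrier (ext_ring n)"
  shows "wedge (wedge a b) c = wedge a (wedge b c)"
  using assms(1)
proof (induction rule: ext_induct)
  case (add F x a)
  have "wedge (wedge (Poly_Mapping.single F x) b) c = wedge (Poly_Mapping.single F x) (wedge b c)"
    using assms(2)
  proof (induction rule: ext_induct)
    case (add G y b)
    have "wedge (wedge (Poly_Mapping.single F x) (Poly_Mapping.single G y)) c =
        wedge (Poly_Mapping.single F x) (wedge (Poly_Mapping.single G y) c)"
      using assms(3)
    proof (induction rule: ext_induct)
      case (add H z c)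
      moreover have "finite F" "finite G" "finite H"
        using \<open>F \<subseteq> {..<n}\<close> \<open>G \<subseteq> {..<n}\<close> add(1) finite_subset by blast+
      ultimately show ?case
        by (simp add: wedge_add_right wedge_assoc_single)
    qed simp
    with add show ?case
      by (simp add: wedge_add_left wedge_add_right)
  qed simp
  with add show ?case
    by (simp add: wedge_add_left)
qed simp

lemma ext_add_closed:
  assumes "a \<in> carrier (ext_ring n)" "b \<in> carrier (ext_ring n)"
  shows "a + b \<in> carrier (ext_ring n)"
  using assms Poly_Mapping.keys_add[of a b] by (fastforce simp: ext_ring_def)

lemma wedge_closed:
  assumes "a \<in> carrier (ext_ring n)" "b \<in> carrier (ext_ring n)"
  shows "wedge a b \<in> carrier (ext_ring n)"
  using assms(1)
proof (induction rule: ext_induct)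
  case (add F x a)
  have "wedge (Poly_Mapping.single F x) b \<in> carrier (ext_ring n)"
    using assms(2)
  proof (induction rule: ext_induct)
    case (add G y b)
    then have "ext_term F G (x * y) \<in> carrier (ext_ring n)"
      using \<open>F \<subseteq> {..<n}\<close> by (simp add: ext_term_def ext_ring_def)
    with add show ?case
      by (simp add: wedge_add_right wedge_single ext_add_closed)
  qed (simp add: ext_ring_def)
  with add show ?case
    by (simp add: wedge_add_left ext_add_closed)
qed (simp add: ext_ring_def)

lemma wedge_one:
  assumes "a \<in> carrier (ext_ring n)"
  shows "wedge (Poly_Mapping.single {} 1) a = a" "wedge a (Poly_Mapping.single {} 1) = a"
  using assms
  by (induction rule: ext_induct)
     (simp_all add: wedge_add_left wedge_add_right wedge_single ext_term_def ext_sign_def)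

lemma ext_ring_simps:
  "carrier (ext_ring n) = {a. \<forall>F\<in>Poly_Mapping.keys a. F \<subseteq> {..<n}}"
  "x \<otimes>\<^bsub>ext_ring n\<^esub> y = wedge x y" "x \<oplus>\<^bsub>ext_ring n\<^esub> y = x + y"
  "\<one>\<^bsub>ext_ring n\<^esub> = Poly_Mapping.single {} 1" "\<zero>\<^bsub>ext_ring n\<^esub> = 0"
  by (simp_all add: ext_ring_def)

lemma ring_ext_ring: "ring (ext_ring n :: 'k::field ext ring)"
proof (intro ringI abelian_groupI monoidI)
  fix x :: "'k ext" assume "x \<in> carrier (ext_ring n)"
  then show "\<exists>y\<in>carrier (ext_ring n). y \<oplus>\<^bsub>ext_ring n\<^esub> x = \<zero>\<^bsub>ext_ring n\<^esub>"
    by (intro bexI[of _ "- x"]) (auto simp: ext_ring_simps in_keys_iff)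
qed (simp_all add: ext_ring_simps(2-5) wedge_assoc ext_add_closed wedge_closed wedge_one
    wedge_add_left wedge_add_right add_ac, simp_all add: ext_ring_simps(1))

end

theory Submission
  imports Defs "Jordan_Normal_Form.Determinant"
begin

text \<open>
  In a perfect elimination order let \<open>d v\<close> be the number of earlier neighbours of \<open>v\<close>, which form a
  clique. Both shifted complexes turn out to be the clique complex of one explicit graph on \<open>[n]\<close>,
  determined by the numbers \<open>#{v. d v \<ge> t}\<close>; under \<open>\<sigma>\<close> its minimal non-edges \<open>{i, j+1}\<close> correspond to
  the generators \<open>x\<^sub>i x\<^sub>j\<close> of the symmetric generic initial ideal.

  In degree 2 the leading monomials are bounded from above by evaluation. If \<open>z \<in> K\<^bsup>j+1\<^esup>\<close> and \<open>A\<^sup>T z\<close>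
  is supported on a face, then \<open>A f\<close> vanishes at \<open>z\<close> for all \<open>f\<close> in the face ideal, so a leading
  monomial \<open>x\<^sub>i x\<^sub>j\<close> of \<open>A f\<close> yields a linear relation between \<open>z\<^sub>i, \<dots>, z\<^sub>j\<close>. Every \<open>v\<close> with
  \<open>d v \<ge> n - 1 - j\<close> provides such a vector, and generically these vectors are independent even after
  restriction to their last \<open>#{v. d v \<ge> n - 1 - j}\<close> coordinates, which excludes the relation for large
  \<open>i\<close>. In the exterior algebra the alternating form at a pair \<open>(z, z')\<close> with \<open>z' \<in> K\<^bsup>j+2\<^esup>\<close> plays the
  same role, whence the index shift by one.

  Equality follows from Hilbert functions. A monomial supported on a clique is determined by its last
  vertex \<open>v\<close> and a monomial in \<open>d v + 1\<close> variables, a monomial outside the candidate ideal by its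
  smallest index \<open>i\<close> and a monomial in \<open>e i\<close> variables, and the multisets of the \<open>d v + 1\<close> and of the
  \<open>e i\<close> agree. Hence the candidate ideal is reached in degree 2 and then, being generated there, in all
  degrees.
\<close>

section \<open>Polynomial functions of matrices and generic values\<close>

text \<open>The vectors \<open>z\<close> have to depend polynomially on \<open>A\<close>, since
  genericity means nonvanishing of polynomials in the entries. They are therefore read off from
  adjugates of square blocks of \<open>A\<close>, and their independence becomes one determinant,
  which only has to be nonzero at a single matrix. The elimination order makes it triangular at a
  well chosen one. Reverse lexicographic order is what turns evaluation into linear algebra: once
  the variables after \<open>j\<close> are set to 0, the monomials of degree 2 not above
  \<open>x_i x_j\<close> are \<open>x_a x_j\<close> with \<open>a \<ge> i\<close>, so the value at
  \<open>z\<close> is \<open>z_j\<close> times a linear form in \<open>z_i, ..., z_j\<close>. The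
  upper bound is sharp because every number below some \<open>d v\<close> is itself a value of
  \<open>d\<close>; hence the counts \<open>#{v. d v \<ge> t}\<close> drop strictly until they
  vanish, and the explicit graph has exactly the right numbers \<open>e i\<close>. Characteristic 0
  enters three times: nonzero polynomials have nonzero values on lines, the Vandermonde nodes
  \<open>of_nat a\<close> are distinct, and \<open>2 \<noteq> 0\<close> yields that a vector wedged
  with itself is 0.\<close>

abbreviation keys :: "('a \<Rightarrow>\<^sub>0 'b::zero) \<Rightarrow> 'a set" where
  "keys \<equiv> Poly_Mapping.keys"

abbreviation lookup :: "('a \<Rightarrow>\<^sub>0 'b::zero) \<Rightarrow> 'a \<Rightarrow> 'b" where
  "lookup \<equiv> Poly_Mapping.lookup"

abbreviation single :: "'a \<Rightarrow> 'b \<Rightarrow> 'a \<Rightarrow>\<^sub>0 'b::zero" where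
  "single \<equiv> Poly_Mapping.single"

lemma poly_mapping_sum_single:
  fixes p :: "'m \<Rightarrow>\<^sub>0 'k::comm_monoid_add"
  shows "p = (\<Sum>m\<in>keys p. single m (lookup p m))"
  by (rule poly_mapping_eqI) (simp add: lookup_sum lookup_single when_def in_keys_iff)

lemma poly_mapping_induct_on [consumes 1, case_names zero add]:
  fixes p :: "'m \<Rightarrow>\<^sub>0 'k::comm_monoid_add"
  assumes "keys p \<subseteq> S" and "P 0"
    and "\<And>m c q. m \<in> S \<Longrightarrow> keys q \<subseteq> S \<Longrightarrow> P q \<Longrightarrow> P (single m c + q)"
  shows "P p"
proof -
  have *: "keys (\<Sum>m\<in>A. single m (g m)) \<subseteq> S \<and>
      P (\<Sum>m\<in>A. single m (g m))" if "finite A" "A \<subseteq> S" for A g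
    using that
  proof (induction A)
    case (insert F A)
    then show ?case
      using assms(3)[of F "\<Sum>F\<in>A. single F (g F)" "g F"]
        Poly_Mapping.keys_add[of "single F (g F)" "\<Sum>F\<in>A. single F (g F)"]
      by (fastforce split: if_splits)
  qed (use assms(2) in simp)
  show ?thesis
    using *[OF finite_keys assms(1)] poly_mapping_sum_single[of p] by metis
qed

section \<open>Evaluation of polynomials as a ring homomorphism\<close>

definition mon_val :: "('v \<Rightarrow> 'r::comm_ring_1) \<Rightarrow> 'v mon \<Rightarrow> 'r" where
  "mon_val f m = (\<Prod>v\<in>keys m. f v ^ lookup m v)"

lemma mon_val_superset:
  assumes "finite A" "keys m \<subseteq> A"
  shows "mon_val f m = (\<Prod>v\<in>A. f v ^ lookup m v)"
  unfolding mon_val_def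
  by (rule prod.mono_neutral_left) (use assms in \<open>auto simp: in_keys_iff\<close>)

lemma mon_val_add: "mon_val f (m + m') = mon_val f m * mon_val f m'"
proof -
  let ?A = "keys m \<union> keys m'"
  have "keys (m + m') \<subseteq> ?A"
    by (rule Poly_Mapping.keys_add)
  then show ?thesis
    by (simp add: mon_val_superset[of ?A] lookup_add power_add prod.distrib)
qed

lemma mon_val_0 [simp]: "mon_val f 0 = 1"
  by (simp add: mon_val_def)

lemma mon_val_single [simp]: "mon_val f (single v k) = f v ^ k"
  by (simp add: mon_val_def)

text \<open>Two coefficient maps matter: the identity, which gives values at points, and the
  embedding of constants, which gives the substitution \<open>poly_act\<close>. The locale proves
  the homomorphism laws for both at once.\<close>

locale coeff_hom = comm_ring_hom hom for hom :: "'k::field \<Rightarrow> 'r::comm_ring_1"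
begin

lemma eval_mpoly_superset:
  assumes "finite A" "keys p \<subseteq> A"
  shows "eval_mpoly hom f p = (\<Sum>m\<in>A. hom (lookup p m) * mon_val f m)"
  unfolding eval_mpoly_def mon_val_def
  by (rule sum.mono_neutral_left) (use assms in \<open>auto simp: in_keys_iff\<close>)

lemma eval_mpoly_add: "eval_mpoly hom f (p + q) = eval_mpoly hom f p + eval_mpoly hom f q"
proof -
  let ?A = "keys p \<union> keys q"
  have "keys (p + q) \<subseteq> ?A"
    by (rule Poly_Mapping.keys_add)
  then show ?thesis
    by (simp add: eval_mpoly_superset[of ?A] lookup_add hom_distribs algebra_simps sum.distrib)
qed

lemma eval_mpoly_single: "eval_mpoly hom f (single m a) = hom a * mon_val f m"
  by (simp add: eval_mpoly_superset[of "{m}"])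

lemma eval_mpoly_0 [simp]: "eval_mpoly hom f 0 = 0"
  by (simp add: eval_mpoly_def)

lemma eval_mpoly_sum: "eval_mpoly hom f (\<Sum>i\<in>I. p i) = (\<Sum>i\<in>I. eval_mpoly hom f (p i))"
  by (induction I rule: infinite_finite_induct) (simp_all add: eval_mpoly_add)

lemma eval_mpoly_mult: "eval_mpoly hom f (p * q) = eval_mpoly hom f p * eval_mpoly hom f q"
proof -
  have *: "eval_mpoly hom f (single m a * q) =
      eval_mpoly hom f (single m a) * eval_mpoly hom f q" for m a
    using subset_UNIV[of "keys q"]
    by (induction q rule: poly_mapping_induct_on)
       (simp_all add: distrib_left eval_mpoly_add mult_single eval_mpoly_single mon_val_add hom_distribs mult_ac)
  show ?thesis
    using subset_UNIV[of "keys p"]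
    by (induction p rule: poly_mapping_induct_on) (simp_all add: distrib_right eval_mpoly_add *)
qed

lemma eval_mpoly_1 [simp]: "eval_mpoly hom f 1 = 1"
  using eval_mpoly_single[of f 0 1] by (simp add: hom_distribs)

lemma eval_mpoly_prod: "eval_mpoly hom f (\<Prod>i\<in>I. p i) = (\<Prod>i\<in>I. eval_mpoly hom f (p i))"
  by (induction I rule: infinite_finite_induct) (simp_all add: eval_mpoly_mult)

end

text \<open>One principle with three uses: restricting a polynomial to a line of matrices, composing
  two linear substitutions, and evaluating at a point after a substitution.\<close>

lemma (in comm_ring_hom) hom_eval_mpoly: "hom (eval_mpoly c f p) = eval_mpoly (\<lambda>x. hom (c x)) (\<lambda>v. hom (f v)) p"
  by (simp add: eval_mpoly_def hom_distribs)

lemma eval_mpoly_cong: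
  assumes "p \<in> polys V" "\<And>v. v \<in> V \<Longrightarrow> f v = g v"
  shows "eval_mpoly c f p = eval_mpoly c g p"
  unfolding eval_mpoly_def
proof (intro sum.cong refl arg_cong2[where f = "(*)"] prod.cong)
  fix m v assume "m \<in> keys p" "v \<in> keys m"
  then have "v \<in> V"
    using assms(1) unfolding polys_def by blast
  then show "f v ^ lookup m v = g v ^ lookup m v"
    using assms(2) by simp
qed

lemma coeff_hom_ident: "coeff_hom (\<lambda>x. x)"
  by unfold_locales auto

lemma coeff_hom_single_0: "coeff_hom (single (0 :: 'v mon) :: 'k::field \<Rightarrow> _)"
  by unfold_locales (simp_all add: single_add mult_single)

lemma comm_ring_hom_poly: "comm_ring_hom (\<lambda>p. poly p (t :: 'k::field))"
  by unfold_locales simp_all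

abbreviation eval_at :: "('v \<Rightarrow> 'k) \<Rightarrow> ('v, 'k::field) mpoly \<Rightarrow> 'k" where
  "eval_at \<equiv> eval_mpoly (\<lambda>c. c)"

lemmas eval_at_simps =
  coeff_hom.eval_mpoly_add[OF coeff_hom_ident]
  coeff_hom.eval_mpoly_mult[OF coeff_hom_ident]
  coeff_hom.eval_mpoly_sum[OF coeff_hom_ident]
  coeff_hom.eval_mpoly_prod[OF coeff_hom_ident]
  coeff_hom.eval_mpoly_single[OF coeff_hom_ident]
  coeff_hom.eval_mpoly_0[OF coeff_hom_ident]
  coeff_hom.eval_mpoly_1[OF coeff_hom_ident]

lemma polys_0: "0 \<in> polys V"
  and polys_1: "1 \<in> polys V"
  and polys_const: "single 0 c \<in> polys V"
  and polys_var: "v \<in> V \<Longrightarrow> single (single v k) c \<in> polys V"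
  by (auto simp: polys_def)

lemma polys_sum: "(\<And>i. i \<in> I \<Longrightarrow> p i \<in> polys V) \<Longrightarrow> (\<Sum>i\<in>I. p i) \<in> polys V"
  by (induction I rule: infinite_finite_induct) (simp_all add: polys_0 polys_closed)

lemma polys_prod: "(\<And>i. i \<in> I \<Longrightarrow> p i \<in> polys V) \<Longrightarrow> (\<Prod>i\<in>I. p i) \<in> polys V"
  by (induction I rule: infinite_finite_induct) (simp_all add: polys_1 polys_closed)

lemma polys_power: "p \<in> polys V \<Longrightarrow> p ^ k \<in> polys V"
  by (induction k) (simp_all add: polys_1 polys_closed)

text \<open>Only values on square matrices matter for Zariski open sets, so genericity conditions
  are handled as functions, and determinants need no explicit polynomial.\<close>

definition polyfun :: "nat \<Rightarrow> ('k::field mat \<Rightarrow> 'k) \<Rightarrow> bool" where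
  "polyfun n \<phi> \<longleftrightarrow> (\<exists>p\<in>polys ({..<n} \<times> {..<n}).
     \<forall>A\<in>carrier_mat n n. eval_at (\<lambda>ij. A $$ ij) p = \<phi> A)"

lemma polyfun_const: "polyfun n (\<lambda>A. c)"
  unfolding polyfun_def
  by (rule bexI[of _ "single 0 c"]) (simp_all add: eval_at_simps polys_const)

lemma polyfun_entry: "i < n \<Longrightarrow> j < n \<Longrightarrow> polyfun n (\<lambda>A. A $$ (i, j))"
  unfolding polyfun_def
  by (rule bexI[of _ "single (single (i, j) 1) 1"])
     (simp_all add: eval_at_simps polys_var)

lemma polyfun_add:
  assumes "polyfun n \<phi>" "polyfun n \<psi>" shows "polyfun n (\<lambda>A. \<phi> A + \<psi> A)"
proof -
  from assms obtain p q where "p \<in> polys ({..<n} \<times> {..<n})" "q \<in> polys ({..<n} \<times> {..<n})"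
    "\<forall>A\<in>carrier_mat n n. eval_at (\<lambda>ij. A $$ ij) p = \<phi> A"
    "\<forall>A\<in>carrier_mat n n. eval_at (\<lambda>ij. A $$ ij) q = \<psi> A"
    by (auto simp: polyfun_def)
  then show ?thesis unfolding polyfun_def
    by (intro bexI[of _ "p + q"]) (simp_all add: eval_at_simps polys_closed)
qed

lemma polyfun_mult:
  assumes "polyfun n \<phi>" "polyfun n \<psi>" shows "polyfun n (\<lambda>A. \<phi> A * \<psi> A)"
proof -
  from assms obtain p q where "p \<in> polys ({..<n} \<times> {..<n})" "q \<in> polys ({..<n} \<times> {..<n})"
    "\<forall>A\<in>carrier_mat n n. eval_at (\<lambda>ij. A $$ ij) p = \<phi> A"
    "\<forall>A\<in>carrier_mat n n. eval_at (\<lambda>ij. A $$ ij) q = \<psi> A"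
    by (auto simp: polyfun_def)
  then show ?thesis unfolding polyfun_def
    by (intro bexI[of _ "p * q"]) (simp_all add: eval_at_simps polys_closed)
qed

lemma polyfun_sum: "(\<And>i. i \<in> I \<Longrightarrow> polyfun n (\<phi> i)) \<Longrightarrow> polyfun n (\<lambda>A. \<Sum>i\<in>I. \<phi> i A)"
  by (induction I rule: infinite_finite_induct) (simp_all add: polyfun_const polyfun_add)

lemma polyfun_prod: "(\<And>i. i \<in> I \<Longrightarrow> polyfun n (\<phi> i)) \<Longrightarrow> polyfun n (\<lambda>A. \<Prod>i\<in>I. \<phi> i A)"
  by (induction I rule: infinite_finite_induct) (simp_all add: polyfun_const polyfun_mult)

lemma polyfun_det:
  assumes "\<And>i j. i < k \<Longrightarrow> j < k \<Longrightarrow> polyfun n (\<lambda>A. f A i j)"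
  shows "polyfun n (\<lambda>A. det (mat k k (\<lambda>(i, j). f A i j)))"
proof -
  have "polyfun n (\<lambda>A. \<Sum>p | p permutes {0..<k}. signof p * (\<Prod>i = 0..<k. f A i (p i)))"
    by (intro polyfun_sum polyfun_mult polyfun_const polyfun_prod assms)
       (auto simp: permutes_in_image[where S = "{0..<k}", simplified atLeastLessThan_iff, simplified])
  moreover have "det (mat k k (\<lambda>(i, j). f A i j)) =
      (\<Sum>p | p permutes {0..<k}. signof p * (\<Prod>i = 0..<k. f A i (p i)))" for A
    by (subst det_def'[of _ k]) (auto intro!: sum.cong prod.cong simp: permutes_in_image[where S = "{0..<k}", simplified atLeastLessThan_iff, simplified])
  ultimately show ?thesis by simp
qed

text \<open>Entry \<open>(i, j)\<close> of the adjugate is a signed minor with row \<open>j\<close>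
  and column \<open>i\<close> deleted; the conditionals only skip these indices. Through this lemma
  kernel vectors become polynomial in \<open>A\<close>.\<close>

lemma polyfun_adj_mat:
  assumes "\<And>i j. i < k \<Longrightarrow> j < k \<Longrightarrow> polyfun n (\<lambda>A. f A i j)" "i < k" "j < k"
  shows "polyfun n (\<lambda>A. adj_mat (mat k k (\<lambda>(i, j). f A i j)) $$ (i, j))"
proof -
  have "polyfun n (\<lambda>A. (-1) ^ (j + i) * det (mat (k - 1) (k - 1)
      (\<lambda>(i', j'). f A (if i' < j then i' else Suc i') (if j' < i then j' else Suc j'))))"
    using assms by (intro polyfun_mult polyfun_const polyfun_det) auto
  moreover have "adj_mat (mat k k (\<lambda>(i, j). f A i j)) $$ (i, j) = (-1) ^ (j + i) * det (mat (k - 1) (k - 1)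
      (\<lambda>(i', j'). f A (if i' < j then i' else Suc i') (if j' < i then j' else Suc j')))" for A
    using assms(2,3) unfolding adj_mat_def cofactor_def mat_delete_def
    by (auto intro!: arg_cong[where f = det] arg_cong2[where f = "(*)"] eq_matI)
  ultimately show ?thesis by simp
qed

text \<open>The witness may be singular, which makes explicit witnesses easier to find; an
  invertible one is obtained later by multiplying with the determinant.\<close>

definition nonzero_polyfun :: "nat \<Rightarrow> ('k::field mat \<Rightarrow> 'k) \<Rightarrow> bool" where
  "nonzero_polyfun n \<phi> \<longleftrightarrow> polyfun n \<phi> \<and> (\<exists>A\<in>carrier_mat n n. \<phi> A \<noteq> 0)"

lemma polyfun_on_line:
  assumes "polyfun n \<phi>" "A \<in> carrier_mat n n" "B \<in> carrier_mat n n"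
  shows "\<exists>P. \<forall>t. poly P t = \<phi> (mat n n (\<lambda>ij. A $$ ij + t * B $$ ij))"
proof -
  from assms(1) obtain p where p: "p \<in> polys ({..<n} \<times> {..<n})"
    "\<forall>A\<in>carrier_mat n n. eval_at (\<lambda>ij. A $$ ij) p = \<phi> A"
    by (auto simp: polyfun_def)
  let ?P = "eval_mpoly (\<lambda>c. [:c:]) (\<lambda>ij. [:A $$ ij, B $$ ij:]) p"
  have "poly ?P t = \<phi> (mat n n (\<lambda>ij. A $$ ij + t * B $$ ij))" for t
  proof -
    have "poly ?P t = eval_at (\<lambda>ij. A $$ ij + t * B $$ ij) p"
      by (simp add: comm_ring_hom.hom_eval_mpoly[OF comm_ring_hom_poly])
    also have "\<dots> = eval_at (\<lambda>ij. mat n n (\<lambda>ij. A $$ ij + t * B $$ ij) $$ ij) p"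
      by (rule eval_mpoly_cong[OF p(1)]) auto
    also have "\<dots> = \<phi> (mat n n (\<lambda>ij. A $$ ij + t * B $$ ij))"
      using p(2) by simp
    finally show ?thesis .
  qed
  then show ?thesis by blast
qed

text \<open>Irreducibility of matrix space: on the line joining a nonzero of \<open>\<phi>\<close>
  to a nonzero of \<open>\<psi>\<close> both restrict to nonzero univariate polynomials, whose
  product has a nonzero value because the field is infinite.\<close>

lemma nonzero_polyfun_mult:
  fixes \<phi> \<psi> :: "'k::field_char_0 mat \<Rightarrow> 'k"
  assumes "nonzero_polyfun n \<phi>" "nonzero_polyfun n \<psi>"
  shows "nonzero_polyfun n (\<lambda>A. \<phi> A * \<psi> A)"
proof -
  from assms obtain A B where A: "A \<in> carrier_mat n n" "\<phi> A \<noteq> 0" and B: "B \<in> carrier_mat n n" "\<psi> B \<noteq> 0"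
    and pf: "polyfun n \<phi>" "polyfun n \<psi>"
    by (auto simp: nonzero_polyfun_def)
  let ?L = "\<lambda>t. mat n n (\<lambda>ij. A $$ ij + t * (B - A) $$ ij)"
  have BA: "B - A \<in> carrier_mat n n" by (rule minus_carrier_mat[OF A(1)])
  obtain P Q where P: "\<And>t. poly P t = \<phi> (?L t)" and Q: "\<And>t. poly Q t = \<psi> (?L t)"
    using polyfun_on_line[OF pf(1) A(1) BA] polyfun_on_line[OF pf(2) A(1) BA] by blast
  have "?L 0 = A" "?L 1 = B"
    using A B by auto
  then have "poly P 0 \<noteq> 0" "poly Q 1 \<noteq> 0"
    using P[of 0] Q[of 1] A(2) B(2) by auto
  then have "P * Q \<noteq> 0"
    by auto
  then obtain t where "poly (P * Q) t \<noteq> 0"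
    using poly_all_0_iff_0 by blast
  then have "\<phi> (?L t) * \<psi> (?L t) \<noteq> 0"
    using P Q by simp
  moreover have "?L t \<in> carrier_mat n n" by simp
  ultimately show ?thesis
    unfolding nonzero_polyfun_def using polyfun_mult[OF pf] by blast
qed

lemma nonzero_polyfun_prod:
  fixes \<phi> :: "'i \<Rightarrow> 'k::field_char_0 mat \<Rightarrow> 'k"
  assumes "\<And>i. i \<in> I \<Longrightarrow> nonzero_polyfun n (\<phi> i)"
  shows "nonzero_polyfun n (\<lambda>A. \<Prod>i\<in>I. \<phi> i A)"
proof -
  have 1: "nonzero_polyfun n (\<lambda>A. 1 :: 'k)"
    using zero_carrier_mat[of n n] by (auto simp: nonzero_polyfun_def polyfun_const)
  show ?thesis
    using assms by (induction I rule: infinite_finite_induct) (simp_all add: 1 nonzero_polyfun_mult)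
qed

section \<open>Invertible matrices and generic values\<close>

lemma GL_iff_det:
  fixes A :: "'k::field mat"
  shows "A \<in> GL n \<longleftrightarrow> A \<in> carrier_mat n n \<and> det A \<noteq> 0"
proof (cases "A \<in> carrier_mat n n")
  case A: True
  have "det A \<noteq> 0" if "A \<in> GL n"
  proof -
    from that obtain B where "A * B = 1\<^sub>m (dim_row A)" "B * A = 1\<^sub>m (dim_row B)"
      by (auto simp: GL_def invertible_mat_def inverts_mat_def)
    moreover from this have "B \<in> carrier_mat n n"
      using A by (metis carrier_matD carrier_matI index_mult_mat(2,3) index_one_mat(2,3))
    ultimately show ?thesis
      using A det_mult[of A n B] by auto
  qed
  moreover have "A \<in> GL n" if nz: "det A \<noteq> 0"
  proof -
    obtain B where "B \<in> carrier_mat n n" "B * A = 1\<^sub>m n" "A * B = 1\<^sub>m n"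
      using det_non_zero_imp_unit[OF A nz, of "()"] by (auto simp: Units_def ring_mat_def)
    then show ?thesis
      using A by (auto simp: GL_def invertible_mat_def inverts_mat_def square_mat.simps)
  qed
  ultimately show ?thesis using A by blast
qed (auto simp: GL_def)

lemma GL_inverse:
  fixes A :: "'k::field mat"
  assumes "A \<in> GL n"
  obtains B where "B \<in> GL n" "B * A = 1\<^sub>m n" "A * B = 1\<^sub>m n"
proof -
  have A: "A \<in> carrier_mat n n" "det A \<noteq> 0"
    using assms by (simp_all add: GL_iff_det)
  obtain B where B: "B \<in> carrier_mat n n" "B * A = 1\<^sub>m n" "A * B = 1\<^sub>m n"
    using det_non_zero_imp_unit[OF A, of "()"] by (auto simp: Units_def ring_mat_def)
  moreover have "det B \<noteq> 0"
    using det_mult[OF B(1) A(1)] B(2) by auto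
  ultimately show ?thesis
    using that by (auto simp: GL_iff_det)
qed

lemma nonzero_polyfun_det: "nonzero_polyfun n (det :: 'k::field mat \<Rightarrow> 'k)"
  unfolding nonzero_polyfun_def
proof
  have "polyfun n (\<lambda>A :: 'k mat. det (mat n n (\<lambda>(i, j). A $$ (i, j))))"
    by (intro polyfun_det polyfun_entry)
  moreover have "mat n n (\<lambda>(i, j). A $$ (i, j)) = A" if "A \<in> carrier_mat n n" for A :: "'k mat"
    using that by auto
  ultimately show "polyfun n (det :: 'k mat \<Rightarrow> 'k)"
    unfolding polyfun_def by auto
  show "\<exists>A\<in>carrier_mat n n. det A \<noteq> (0 :: 'k)"
    by (rule bexI[of _ "1\<^sub>m n"]) auto
qed

lemma nonzero_polyfun_GL:
  fixes \<phi> :: "'k::field_char_0 mat \<Rightarrow> 'k"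
  assumes "nonzero_polyfun n \<phi>"
  obtains A where "A \<in> GL n" "\<phi> A \<noteq> 0"
  using nonzero_polyfun_mult[OF assms nonzero_polyfun_det]
  by (auto simp: nonzero_polyfun_def GL_iff_det)

text \<open>Uniqueness of the generic value is the point. A competing open set contains the nonzeros
  of some polynomial on \<open>GL n\<close>; its product with \<open>\<phi>\<close> and the
  determinant is again nonzero somewhere, so the two sets share a matrix.\<close>

lemma generic_value_eqI:
  fixes \<phi> :: "'k::field_char_0 mat \<Rightarrow> 'k"
  assumes "nonzero_polyfun n \<phi>" and "\<And>A. A \<in> GL n \<Longrightarrow> \<phi> A \<noteq> 0 \<Longrightarrow> f A = v"
  shows "generic_value n f = v"
  unfolding generic_value_def
proof (rule the_equality)
  from assms(1) obtain p where p: "p \<in> polys ({..<n} \<times> {..<n})"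
    "\<forall>A\<in>carrier_mat n n. eval_at (\<lambda>ij. A $$ ij) p = \<phi> A"
    by (auto simp: polyfun_def nonzero_polyfun_def)
  let ?U = "{A \<in> GL n. \<phi> A \<noteq> 0}"
  have "zariski_open n ?U"
    unfolding zariski_open_def using p by (intro exI[of _ "{p}"]) (auto simp: GL_def)
  moreover have "?U \<noteq> {}"
    using nonzero_polyfun_GL[OF assms(1)] by blast
  ultimately show "\<exists>U. zariski_open n U \<and> U \<noteq> {} \<and> (\<forall>A\<in>U. f A = v)"
    using assms(2) by blast
next
  fix w assume "\<exists>U. zariski_open n U \<and> U \<noteq> {} \<and> (\<forall>A\<in>U. f A = w)"
  then obtain U B where U: "zariski_open n U" "\<forall>A\<in>U. f A = w" and B: "B \<in> U"
    by blast
  from U(1) obtain P where P: "P \<subseteq> polys ({..<n} \<times> {..<n})"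
    "U = {A \<in> GL n. \<exists>p\<in>P. eval_at (\<lambda>ij. A $$ ij) p \<noteq> 0}"
    by (auto simp: zariski_open_def)
  with B obtain p where p: "p \<in> P" "eval_at (\<lambda>ij. B $$ ij) p \<noteq> 0" "B \<in> GL n"
    by auto
  have "nonzero_polyfun n (\<lambda>A. eval_at (\<lambda>ij. A $$ ij) p)"
    unfolding nonzero_polyfun_def polyfun_def using p P(1) by (auto simp: GL_def)
  from nonzero_polyfun_mult[OF assms(1) this]
  obtain A where A: "A \<in> GL n" "\<phi> A * eval_at (\<lambda>ij. A $$ ij) p \<noteq> 0"
    by (rule nonzero_polyfun_GL)
  then have "A \<in> U"
    using P(2) p(1) by auto
  then show "w = v"
    using U(2) assms(2)[of A] A by auto
qed

section \<open>Leading monomials\<close>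

lemma mon_deg_superset:
  "finite A \<Longrightarrow> keys m \<subseteq> A \<Longrightarrow> mon_deg m = (\<Sum>i\<in>A. lookup m i)"
  unfolding mon_deg_def by (rule sum.mono_neutral_left) (auto simp: in_keys_iff)

lemma mon_deg_add [simp]: "mon_deg (a + b) = mon_deg a + mon_deg b"
proof -
  have "keys (a + b) \<subseteq> keys a \<union> keys b"
    by (rule Poly_Mapping.keys_add)
  then show ?thesis
    by (simp add: mon_deg_superset[of "keys a \<union> keys b"] lookup_add sum.distrib)
qed

lemma mon_deg_single [simp]: "mon_deg (single i k) = k"
  by (simp add: mon_deg_def)

lemma mon_deg_0 [simp]: "mon_deg 0 = 0"
  by (simp add: mon_deg_def)

text \<open>The laws are relativised to \<open>M\<close> because \<open>ext_less\<close> is total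
  only on finite sets: \<open>sqfree\<close> sends every infinite set to 0.\<close>

locale term_order =
  fixes lt :: "'m \<Rightarrow> 'm \<Rightarrow> bool" and M :: "'m set"
  assumes irrefl: "a \<in> M \<Longrightarrow> \<not> lt a a"
    and trans: "a \<in> M \<Longrightarrow> b \<in> M \<Longrightarrow> c \<in> M \<Longrightarrow> lt a b \<Longrightarrow> lt b c \<Longrightarrow> lt a c"
    and total: "a \<in> M \<Longrightarrow> b \<in> M \<Longrightarrow> a \<noteq> b \<Longrightarrow> lt a b \<or> lt b a"
begin

lemma asym: "a \<in> M \<Longrightarrow> b \<in> M \<Longrightarrow> lt a b \<Longrightarrow> \<not> lt b a"
  using irrefl[of a] trans[of a b a] by blast

lemma ex_max:
  assumes "finite A" "A \<noteq> {}" "A \<subseteq> M"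
  shows "\<exists>m\<in>A. \<forall>m'\<in>A. m' \<noteq> m \<longrightarrow> lt m' m"
  using assms
proof (induction A rule: finite_ne_induct)
  case (insert x A)
  then obtain m where m: "m \<in> A" "\<forall>m'\<in>A. m' \<noteq> m \<longrightarrow> lt m' m" by auto
  have M: "x \<in> M" "m \<in> M" "A \<subseteq> M" using insert m by auto
  have "x \<noteq> m" using insert m by auto
  with total[OF M(1,2)] consider "lt x m" | "lt m x" by blast
  then show ?case
  proof cases
    case 1
    then show ?thesis using m by auto
  next
    case 2
    have "lt m' x" if "m' \<in> A" for m'
      using 2 m that M trans[of m' m x] by (cases "m' = m") auto
    then show ?thesis by auto
  qed
qed auto

lemma leading_eqI:
  assumes "keys f \<subseteq> M" "m \<in> keys f"
    and "\<And>m'. m' \<in> keys f \<Longrightarrow> m' \<noteq> m \<Longrightarrow> lt m' m"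
  shows "leading lt f = m"
  unfolding leading_def
proof (rule the_equality)
  fix m' assume m': "m' \<in> keys f \<and> (\<forall>m''\<in>keys f. m'' \<noteq> m' \<longrightarrow> lt m'' m')"
  show "m' = m"
  proof (rule ccontr)
    assume "m' \<noteq> m"
    then have "lt m m'" "lt m' m" using m' assms(2,3) by auto
    then show False using asym m' assms(1,2) by blast
  qed
qed (use assms in auto)

lemma leading:
  assumes "keys f \<subseteq> M" "f \<noteq> 0"
  shows "leading lt f \<in> keys f"
    and "\<And>m. m \<in> keys f \<Longrightarrow> m \<noteq> leading lt f \<Longrightarrow> lt m (leading lt f)"
proof -
  have "keys f \<noteq> {}"
    using assms(2) by simp
  then obtain m where "m \<in> keys f" "\<forall>m'\<in>keys f. m' \<noteq> m \<longrightarrow> lt m' m"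
    using ex_max[OF finite_keys _ assms(1)] by blast
  moreover from this have "leading lt f = m"
    using leading_eqI[OF assms(1)] by blast
  ultimately show "leading lt f \<in> keys f"
    "\<And>m. m \<in> keys f \<Longrightarrow> m \<noteq> leading lt f \<Longrightarrow> lt m (leading lt f)"
    by auto
qed

end

definition pm_scale :: "'k::field \<Rightarrow> ('m \<Rightarrow>\<^sub>0 'k) \<Rightarrow> ('m \<Rightarrow>\<^sub>0 'k)" where
  "pm_scale c f = Poly_Mapping.map ((*) c) f"

lemma lookup_pm_scale [simp]: "lookup (pm_scale c f) m = c * lookup f m"
  by (simp add: pm_scale_def map.rep_eq when_def)

lemma keys_pm_scale: "keys (pm_scale c f) \<subseteq> keys f"
  by (auto simp: in_keys_iff)

lemma vector_space_pm_scale: "vector_space pm_scale"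
  by unfold_locales (auto intro!: poly_mapping_eqI simp: lookup_add algebra_simps)

text \<open>Both sides are the dimension of the image. Choosing one element \<open>h t\<close> for
  each leading monomial \<open>t\<close> gives a basis: distinct leading monomials force
  independence, and reduction by leading terms shows that the \<open>h t\<close> span.\<close>

lemma (in term_order) card_leading:
  fixes \<phi> :: "('x \<Rightarrow>\<^sub>0 'k::field) \<Rightarrow> ('m \<Rightarrow>\<^sub>0 'k)"
  assumes X: "finite X"
    and add: "\<And>f g. \<phi> (f + g) = \<phi> f + \<phi> g"
    and scale: "\<And>c f. \<phi> (pm_scale c f) = pm_scale c (\<phi> f)"
    and keysM: "\<And>f. keys f \<subseteq> X \<Longrightarrow> keys (\<phi> f) \<subseteq> M"
    and inj: "\<And>f. keys f \<subseteq> X \<Longrightarrow> \<phi> f = 0 \<Longrightarrow> f = 0"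
  defines "T \<equiv> {leading lt (\<phi> f) | f. keys f \<subseteq> X \<and> f \<noteq> 0}"
  shows "finite T" "card T = card X"
proof -
  interpret V: vector_space "pm_scale :: 'k \<Rightarrow> ('m \<Rightarrow>\<^sub>0 'k) \<Rightarrow> _"
    by (rule vector_space_pm_scale)
  define W where "W = {\<phi> f | f. keys f \<subseteq> X}"
  define b where "b x = \<phi> (single x 1)" for x
  have zero: "\<phi> 0 = 0"
    using add[of 0 0] by simp
  have sum: "\<phi> (\<Sum>i\<in>I. f i) = (\<Sum>i\<in>I. \<phi> (f i))" if "finite I" for I :: "'x set" and f
    using that by (induction I) (simp_all add: add zero)
  have single: "\<phi> (single x c) = pm_scale c (b x)" for x c
  proof -
    have "single x c = pm_scale c (single x 1)"
      by (rule poly_mapping_eqI) (simp add: lookup_single when_def)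
    then show ?thesis by (simp add: scale b_def)
  qed
  have expand: "\<phi> f = (\<Sum>x\<in>X. pm_scale (lookup f x) (b x))" if "keys f \<subseteq> X" for f
  proof -
    have "f = (\<Sum>x\<in>X. single x (lookup f x))"
      by (rule poly_mapping_eqI)
         (use that X in \<open>auto simp: lookup_sum lookup_single when_def in_keys_iff\<close>)
    then have "\<phi> f = (\<Sum>x\<in>X. \<phi> (single x (lookup f x)))"
      using sum[OF X] by metis
    then show ?thesis by (simp add: single)
  qed
  have combine: "\<exists>f. keys f \<subseteq> X \<and> (\<forall>x\<in>X. lookup f x = u x) \<and>
      (\<Sum>x\<in>X. pm_scale (u x) (b x)) = \<phi> f" for u
  proof -
    let ?f = "\<Sum>x\<in>X. single x (u x)"
    have l: "lookup ?f x = (if x \<in> X then u x else 0)" for x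
      using X by (simp add: lookup_sum lookup_single when_def)
    then have "keys ?f \<subseteq> X"
      by (auto simp: in_keys_iff split: if_splits)
    with l expand[OF this] show ?thesis
      by (intro exI[of _ ?f]) simp
  qed
  have W_subspace: "V.subspace W"
  proof (rule V.subspaceI)
    show "0 \<in> W" unfolding W_def using zero by (intro CollectI exI[of _ 0]) simp
  next
    fix x y assume "x \<in> W" "y \<in> W"
    then obtain f g where "x = \<phi> f" "y = \<phi> g" "keys f \<subseteq> X" "keys g \<subseteq> X"
      by (auto simp: W_def)
    then show "x + y \<in> W" unfolding W_def
      using Poly_Mapping.keys_add[of f g] by (intro CollectI exI[of _ "f + g"]) (auto simp: add)
  next
    fix c x assume "x \<in> W"
    then obtain f where "x = \<phi> f" "keys f \<subseteq> X"
      by (auto simp: W_def)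
    then show "pm_scale c x \<in> W" unfolding W_def
      using keys_pm_scale[of c f] by (intro CollectI exI[of _ "pm_scale c f"]) (auto simp: scale)
  qed
  have b_inj: "inj_on b X"
  proof (rule inj_onI)
    fix x y assume xy: "x \<in> X" "y \<in> X" "b x = b y"
    let ?f = "single x 1 + single y (- 1) :: 'x \<Rightarrow>\<^sub>0 'k"
    have "\<phi> ?f = 0"
      by (rule poly_mapping_eqI) (simp add: add single xy lookup_add)
    moreover have "keys ?f \<subseteq> X"
      using Poly_Mapping.keys_add[of "single x 1 :: 'x \<Rightarrow>\<^sub>0 'k" "single y (- 1)"] xy
      by auto
    ultimately have "?f = 0" using inj by blast
    then have "lookup ?f x = 0" by simp
    then show "x = y"
      by (auto simp: lookup_add lookup_single when_def split: if_splits)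
  qed
  have b_span: "V.span (b ` X) = W"
  proof
    have "b ` X \<subseteq> W"
      by (auto simp: W_def b_def)
    then show "V.span (b ` X) \<subseteq> W"
      using W_subspace by (rule V.span_minimal)
    show "W \<subseteq> V.span (b ` X)"
    proof
      fix w assume "w \<in> W"
      then obtain f where f: "w = \<phi> f" "keys f \<subseteq> X" by (auto simp: W_def)
      show "w \<in> V.span (b ` X)"
        unfolding f(1) expand[OF f(2)] by (intro V.span_sum V.span_scale V.span_base imageI)
    qed
  qed
  have b_indep: "V.independent (b ` X)"
  proof
    assume "V.dependent (b ` X)"
    then obtain u where u: "\<exists>v\<in>b ` X. u v \<noteq> 0" "(\<Sum>v\<in>b ` X. pm_scale (u v) v) = 0"
      unfolding V.dependent_finite[OF finite_imageI[OF X]] by blast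
    then have "(\<Sum>x\<in>X. pm_scale (u (b x)) (b x)) = 0"
      by (simp add: sum.reindex[OF b_inj])
    with combine[of "\<lambda>x. u (b x)"] inj have "\<forall>x\<in>X. u (b x) = 0"
      by (metis lookup_zero)
    with u(1) show False by auto
  qed
  have W_keys: "keys f \<subseteq> M" if "f \<in> W" for f
    using that keysM by (auto simp: W_def)
  have T_alt: "T = {leading lt f | f. f \<in> W \<and> f \<noteq> 0}"
    unfolding T_def W_def using inj zero by blast
  have T_M: "T \<subseteq> M"
    unfolding T_alt using leading(1) W_keys by blast
  \<comment> \<open>Every leading monomial already occurs in the image of one of the finitely many
    basis elements, which bounds \<open>T\<close>.\<close>
  have "T \<subseteq> (\<Union>x\<in>X. keys (b x))"
  proof
    fix t assume "t \<in> T"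
    then obtain f where f: "t = leading lt (\<phi> f)" "keys f \<subseteq> X" "f \<noteq> 0"
      by (auto simp: T_def)
    then have "t \<in> keys (\<phi> f)"
      using leading(1)[OF keysM] inj by blast
    then have "(\<Sum>x\<in>X. lookup f x * lookup (b x) t) \<noteq> 0"
      by (simp add: expand[OF f(2)] in_keys_iff lookup_sum)
    then obtain x where "x \<in> X" "lookup (b x) t \<noteq> 0"
      using sum.not_neutral_contains_not_neutral by force
    then show "t \<in> (\<Union>x\<in>X. keys (b x))"
      by (auto simp: in_keys_iff)
  qed
  then show finT: "finite T"
    using X by (meson finite_UN_I finite_keys finite_subset)
  have "\<forall>t\<in>T. \<exists>f. f \<in> W \<and> f \<noteq> 0 \<and> leading lt f = t"
    unfolding T_alt by blast
  then obtain h where h: "\<And>t. t \<in> T \<Longrightarrow> h t \<in> W" "\<And>t. t \<in> T \<Longrightarrow> h t \<noteq> 0"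
    "\<And>t. t \<in> T \<Longrightarrow> leading lt (h t) = t"
    by metis
  have h_lead: "t \<in> keys (h t)" "\<And>m. m \<in> keys (h t) \<Longrightarrow> m \<noteq> t \<Longrightarrow> lt m t"
    if "t \<in> T" for t
    using leading[OF W_keys[OF h(1)[OF that]] h(2)[OF that]] h(3)[OF that] by auto
  have h_inj: "inj_on h T"
    using h(3) by (metis inj_onI)
  have h_indep: "V.independent (h ` T)"
  proof
    assume "V.dependent (h ` T)"
    then obtain u where u: "\<exists>v\<in>h ` T. u v \<noteq> 0" "(\<Sum>v\<in>h ` T. pm_scale (u v) v) = 0"
      unfolding V.dependent_finite[OF finite_imageI[OF finT]] by blast
    then have s0: "(\<Sum>t\<in>T. pm_scale (u (h t)) (h t)) = 0"
      by (simp add: sum.reindex[OF h_inj])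
    \<comment> \<open>In a linear relation the largest leading monomial with a nonzero coefficient
      cannot cancel.\<close>
    let ?A = "{t \<in> T. u (h t) \<noteq> 0}"
    obtain m where m: "m \<in> ?A" "\<forall>m'\<in>?A. m' \<noteq> m \<longrightarrow> lt m' m"
      using ex_max[of ?A] u(1) finT T_M by auto
    have "u (h t) * lookup (h t) m = 0" if "t \<in> T - {m}" for t
    proof (cases "u (h t) = 0")
      case False
      then have "lt t m" using m that by auto
      then have "m \<notin> keys (h t)"
        using h_lead(2)[of t m] that m T_M asym by blast
      then show ?thesis by (simp add: in_keys_iff)
    qed simp
    then have "(\<Sum>t\<in>T - {m}. u (h t) * lookup (h t) m) = 0"
      by (rule sum.neutral[OF ballI])
    then have "(\<Sum>t\<in>T. u (h t) * lookup (h t) m) = u (h m) * lookup (h m) m"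
      using m finT by (subst sum.remove[of T m]) auto
    moreover have "(\<Sum>t\<in>T. u (h t) * lookup (h t) m) = 0"
      using arg_cong[OF s0, of "\<lambda>f. lookup f m"] by (simp add: lookup_sum)
    ultimately show False
      using m h_lead(1)[of m] by (auto simp: in_keys_iff)
  qed
  have "f \<in> V.span (h ` T)" if "f \<in> W" for f
    using that
  proof (induction "card {t \<in> T. lt t (leading lt f)}" arbitrary: f rule: less_induct)
    case less
    show ?case
    proof (cases "f = 0")
      case False
      define m where "m = leading lt f"
      have m: "m \<in> T" unfolding m_def T_alt using less.prems False by blast
      \<comment> \<open>One reduction step: the multiple of \<open>h m\<close> cancels the leading
        term of \<open>f\<close>, and the induction measure is the number of members of
        \<open>T\<close> below the leading monomial.\<close>
      define g where "g = f - pm_scale (lookup f m / lookup (h m) m) (h m)"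
      have gW: "g \<in> W"
        unfolding g_def using less.prems h(1)[OF m] W_subspace
        by (intro V.subspace_diff V.subspace_scale)
      have "g \<in> V.span (h ` T)"
      proof (cases "g = 0")
        case g0: False
        have gm: "m \<notin> keys g"
          using h_lead(1)[OF m] by (simp add: g_def in_keys_iff lookup_minus)
        have lg: "leading lt g \<in> keys g"
          using leading(1)[OF W_keys[OF gW] g0] .
        have "leading lt g \<in> keys f \<union> keys (h m)"
          using lg by (auto simp: g_def in_keys_iff lookup_minus)
        moreover have "leading lt g \<noteq> m"
          using lg gm by auto
        ultimately have ltg: "lt (leading lt g) m"
          using leading(2)[OF W_keys[OF less.prems] False] h_lead(2)[OF m] unfolding m_def by blast
        have gT: "leading lt g \<in> T"
          unfolding T_alt using gW g0 by blast
        have "{t \<in> T. lt t (leading lt g)} \<subset> {t \<in> T. lt t m}"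
          using ltg gT irrefl trans T_M m by blast
        then have "card {t \<in> T. lt t (leading lt g)} < card {t \<in> T. lt t m}"
          using finT by (intro psubset_card_mono) auto
        then show ?thesis
          using less.hyps[OF _ gW] unfolding m_def by blast
      qed (simp add: V.span_zero)
      moreover have "f = g + pm_scale (lookup f m / lookup (h m) m) (h m)"
        by (simp add: g_def)
      ultimately show ?thesis
        using m by (metis V.span_add V.span_base V.span_scale imageI)
    qed (simp add: V.span_zero)
  qed
  then have h_span: "V.span (h ` T) = W"
    using V.span_minimal[OF _ W_subspace, of "h ` T"] h(1) by blast
  have "card T = card (h ` T)"
    using h_inj by (simp add: card_image)
  also have "\<dots> = V.dim W"
    using V.dim_span_eq_card_independent[OF h_indep] h_span by simp
  also have "\<dots> = card (b ` X)"
    using V.dim_span_eq_card_independent[OF b_indep] b_span by simp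
  also have "\<dots> = card X"
    using b_inj by (simp add: card_image)
  finally show "card T = card X" .
qed

section \<open>Reverse lexicographic order on monomials and on finite sets\<close>

lemma revlex_term_order: "term_order revlex_less UNIV"
proof
  fix a :: "nat mon"
  show "\<not> revlex_less a a" by (simp add: revlex_less_def)
next
  fix a b c :: "nat mon" assume ab: "revlex_less a b" and bc: "revlex_less b c"
  show "revlex_less a c"
  proof (cases "mon_deg a = mon_deg b \<and> mon_deg b = mon_deg c")
    case True
    with ab bc obtain k l where
      k: "lookup a k > lookup b k" "\<forall>j>k. lookup a j = lookup b j" and
      l: "lookup b l > lookup c l" "\<forall>j>l. lookup b j = lookup c j"
      by (auto simp: revlex_less_def)
    \<comment> \<open>Beyond the larger of the two deciding indices all three monomials agree, so
      that index decides between \<open>a\<close> and \<open>c\<close>.\<close>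
    have "lookup a (max k l) > lookup c (max k l)"
      using k l by (cases k l rule: linorder_cases) (auto simp: max_def)
    moreover have "\<forall>j>max k l. lookup a j = lookup c j"
      using k(2) l(2) by simp
    ultimately show ?thesis
      using True unfolding revlex_less_def by auto
  next
    case False
    then show ?thesis using ab bc by (auto simp: revlex_less_def)
  qed
next
  fix a b :: "nat mon" assume "a \<noteq> b"
  \<comment> \<open>The supports are finite, so there is a last index of difference, and it decides
    the comparison.\<close>
  let ?D = "{k. lookup a k \<noteq> lookup b k}"
  have "?D \<subseteq> keys a \<union> keys b"
    by (auto simp: in_keys_iff)
  then have fin: "finite ?D" by (rule finite_subset) simp
  have "?D \<noteq> {}" using \<open>a \<noteq> b\<close> by (auto intro: poly_mapping_eqI)
  then have "Max ?D \<in> ?D" using fin Max_in by blast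
  moreover define K where "K = Max ?D"
  ultimately have K: "lookup a K \<noteq> lookup b K" by simp
  have above: "lookup a j = lookup b j" if "j > K" for j
    using Max_ge[OF fin, of j] that unfolding K_def by force
  have "\<forall>j>K. lookup a j = lookup b j"
    "\<forall>j>K. lookup b j = lookup a j"
    by (simp_all add: above)
  then have "mon_deg a = mon_deg b \<Longrightarrow> lookup a K > lookup b K \<Longrightarrow> revlex_less a b"
    "mon_deg a = mon_deg b \<Longrightarrow> lookup b K > lookup a K \<Longrightarrow> revlex_less b a"
    by (auto simp only: revlex_less_def)
  moreover have "mon_deg a < mon_deg b \<Longrightarrow> revlex_less a b" "mon_deg b < mon_deg a \<Longrightarrow> revlex_less b a"
    by (simp_all only: revlex_less_def simp_thms)
  ultimately show "revlex_less a b \<or> revlex_less b a"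
    using K by (meson linorder_neqE_nat)
qed

lemma revlex_less_add: "revlex_less a b \<Longrightarrow> revlex_less (c + a) (c + b)"
  by (auto simp: revlex_less_def lookup_add)

lemma lookup_sqfree:
  assumes "finite F" shows "lookup (sqfree F) i = (if i \<in> F then 1 else 0)"
  using assms by (simp add: sqfree_def lookup_sum lookup_single when_def)

lemma keys_sqfree: "finite F \<Longrightarrow> keys (sqfree F) = F"
  by (auto simp: in_keys_iff lookup_sqfree split: if_splits)

lemma mon_deg_sqfree: "finite F \<Longrightarrow> mon_deg (sqfree F) = card F"
  by (simp add: mon_deg_def keys_sqfree lookup_sqfree)

lemma sqfree_union: "finite F \<Longrightarrow> finite G \<Longrightarrow> F \<inter> G = {} \<Longrightarrow> sqfree (F \<union> G) = sqfree F + sqfree G"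
  by (simp add: sqfree_def sum.union_disjoint)

lemma ext_term_order: "term_order ext_less {F. finite F}"
proof -
  interpret R: term_order revlex_less UNIV by (rule revlex_term_order)
  show ?thesis
  proof
    fix F G :: "nat set" assume "F \<in> {F. finite F}" "G \<in> {F. finite F}" "F \<noteq> G"
    then have "sqfree F \<noteq> sqfree G" using keys_sqfree by (metis mem_Collect_eq)
    then show "ext_less F G \<or> ext_less G F"
      using R.total by (auto simp: ext_less_def)
  next
    fix F :: "nat set" show "\<not> ext_less F F"
      by (simp add: ext_less_def R.irrefl)
  next
    fix F G H :: "nat set" assume "ext_less F G" "ext_less G H"
    then show "ext_less F H"
      unfolding ext_less_def by (rule R.trans[OF UNIV_I UNIV_I UNIV_I])
  qed
qed

text \<open>For disjoint sets the union is multiplication of squarefree monomials, so compatibility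
  of the order with products carries over.\<close>

lemma ext_less_union:
  assumes "finite F" "finite G" "finite H" "F \<inter> H = {}" "G \<inter> H = {}" "ext_less F G"
  shows "ext_less (H \<union> F) (H \<union> G)"
  using assms revlex_less_add[of "sqfree F" "sqfree G" "sqfree H"]
  by (simp add: ext_less_def sqfree_union Int_commute)

section \<open>Monomial ideals\<close>

text \<open>Additive inverses are asked for as witnesses, because the ring records specify addition
  only and negation is derived from it.\<close>

lemma ideal_by_closure:
  assumes "ring R" "I \<subseteq> carrier R" "\<zero>\<^bsub>R\<^esub> \<in> I"
    and "\<And>x y. x \<in> I \<Longrightarrow> y \<in> I \<Longrightarrow> x \<oplus>\<^bsub>R\<^esub> y \<in> I"
    and "\<And>x. x \<in> I \<Longrightarrow> \<exists>y\<in>I. y \<oplus>\<^bsub>R\<^esub> x = \<zero>\<^bsub>R\<^esub>"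
    and "\<And>a x. a \<in> I \<Longrightarrow> x \<in> carrier R \<Longrightarrow> x \<otimes>\<^bsub>R\<^esub> a \<in> I"
    and "\<And>a x. a \<in> I \<Longrightarrow> x \<in> carrier R \<Longrightarrow> a \<otimes>\<^bsub>R\<^esub> x \<in> I"
  shows "ideal I R"
proof -
  interpret R: ring R by fact
  show ?thesis
  proof (rule idealI)
    show "subgroup I (add_monoid R)"
    proof
      fix x assume x: "x \<in> I"
      then obtain y where y: "y \<in> I" "y \<oplus>\<^bsub>R\<^esub> x = \<zero>\<^bsub>R\<^esub>" using assms(5) by blast
      then have "\<ominus>\<^bsub>R\<^esub> x = y" using x assms(2) R.minus_equality by blast
      then show "inv\<^bsub>add_monoid R\<^esub> x \<in> I" using y by (simp add: a_inv_def)
    qed (use assms in auto)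
  qed (use assms in auto)
qed

lemma poly_ring_simps:
  "carrier (poly_ring V) = polys V" "x \<otimes>\<^bsub>poly_ring V\<^esub> y = x * y" "x \<oplus>\<^bsub>poly_ring V\<^esub> y = x + y"
  "\<zero>\<^bsub>poly_ring V\<^esub> = 0"
  by (simp_all add: poly_ring_def)

definition monomial_ideal :: "'v set \<Rightarrow> 'v mon set \<Rightarrow> ('v, 'k::field) mpoly set" where
  "monomial_ideal V G = {p \<in> polys V. \<forall>m\<in>keys p. \<exists>g\<in>G. \<exists>k. m = g + k}"

lemma Idl_monomials:
  assumes "\<And>g. g \<in> G \<Longrightarrow> keys g \<subseteq> V"
  shows "Idl\<^bsub>poly_ring V\<^esub> (monomial ` G) = (monomial_ideal V G :: ('v, 'k::field) mpoly set)"
proof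
  interpret R: ring "poly_ring V :: ('v, 'k) mpoly ring" by (rule ring_poly_ring)
  have sub: "monomial ` G \<subseteq> carrier (poly_ring V :: ('v, 'k) mpoly ring)"
    using assms by (fastforce simp: poly_ring_simps polys_def)
  have mult: "x * a \<in> monomial_ideal V G" if a: "a \<in> monomial_ideal V G" and x: "x \<in> polys V" for a x :: "('v, 'k) mpoly"
    unfolding monomial_ideal_def
  proof (intro CollectI conjI ballI)
    show "x * a \<in> polys V" using a x by (simp add: polys_closed monomial_ideal_def)
    fix m assume "m \<in> keys (x * a)"
    then obtain k l where "m = k + l" "k \<in> keys x" "l \<in> keys a"
      using keys_mult by blast
    moreover from this obtain g l' where "g \<in> G" "l = g + l'"
      using a unfolding monomial_ideal_def by blast
    ultimately show "\<exists>g\<in>G. \<exists>k. m = g + k"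
      by (intro bexI[of _ g] exI[of _ "k + l'"]) (auto simp: add_ac)
  qed
  have "ideal (monomial_ideal V G) (poly_ring V :: ('v, 'k) mpoly ring)"
  proof (rule ideal_by_closure)
    fix x y :: "('v, 'k) mpoly" assume "x \<in> monomial_ideal V G" "y \<in> monomial_ideal V G"
    then show "x \<oplus>\<^bsub>poly_ring V\<^esub> y \<in> monomial_ideal V G"
      using Poly_Mapping.keys_add[of x y] by (auto simp: poly_ring_simps monomial_ideal_def polys_closed)
  next
    fix x :: "('v, 'k) mpoly" assume x: "x \<in> monomial_ideal V G"
    then have "- x \<in> monomial_ideal V G"
      by (auto simp: monomial_ideal_def polys_closed in_keys_iff)
    then show "\<exists>y\<in>monomial_ideal V G. y \<oplus>\<^bsub>poly_ring V\<^esub> x = \<zero>\<^bsub>poly_ring V\<^esub>"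
      by (intro bexI[of _ "- x"]) (auto simp: poly_ring_simps)
  next
    fix a x :: "('v, 'k) mpoly" assume ax: "a \<in> monomial_ideal V G" "x \<in> carrier (poly_ring V)"
    then show "x \<otimes>\<^bsub>poly_ring V\<^esub> a \<in> monomial_ideal V G" "a \<otimes>\<^bsub>poly_ring V\<^esub> x \<in> monomial_ideal V G"
      using mult[of a x] by (simp_all add: poly_ring_simps mult.commute)
  qed (auto simp: R.ring_axioms poly_ring_simps monomial_ideal_def polys_0)
  moreover have "monomial ` G \<subseteq> (monomial_ideal V G :: ('v, 'k) mpoly set)"
  proof clarify
    fix g assume "g \<in> G"
    then show "(monomial g :: ('v, 'k) mpoly) \<in> monomial_ideal V G"
      using assms[of g] by (auto simp: monomial_ideal_def polys_def intro!: bexI[of _ g] exI[of _ 0])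
  qed
  ultimately show "Idl\<^bsub>poly_ring V\<^esub> (monomial ` G) \<subseteq> (monomial_ideal V G :: ('v, 'k) mpoly set)"
    by (rule R.genideal_minimal)
  have I: "ideal (Idl\<^bsub>poly_ring V\<^esub> (monomial ` G)) (poly_ring V :: ('v, 'k) mpoly ring)"
    by (rule R.genideal_ideal[OF sub])
  show "(monomial_ideal V G :: ('v, 'k) mpoly set) \<subseteq> Idl\<^bsub>poly_ring V\<^esub> (monomial ` G)"
  proof
    fix p :: "('v, 'k) mpoly" assume p: "p \<in> monomial_ideal V G"
    let ?S = "{m. keys m \<subseteq> V \<and> (\<exists>g\<in>G. \<exists>k. m = g + k)}"
    have "keys p \<subseteq> ?S"
      using p by (auto simp: monomial_ideal_def polys_def)
    then show "p \<in> Idl\<^bsub>poly_ring V\<^esub> (monomial ` G)"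
    proof (induction p rule: poly_mapping_induct_on)
      case zero
      show ?case
        using additive_subgroup.zero_closed[OF ideal.axioms(1)[OF I]] by (simp add: poly_ring_simps)
    next
      case (add m c q)
      then obtain g k where m: "m = g + k" "g \<in> G" "keys m \<subseteq> V" by blast
      have "keys k \<subseteq> keys m"
        by (auto simp: m(1) in_keys_iff lookup_add)
      then have "single k c \<in> polys V"
        using m by (auto simp: polys_def)
      moreover have "monomial g \<in> Idl\<^bsub>poly_ring V\<^esub> (monomial ` G :: ('v, 'k) mpoly set)"
        using R.genideal_self[OF sub] m(2) by blast
      ultimately have "single k c * monomial g \<in> Idl\<^bsub>poly_ring V\<^esub> (monomial ` G)"
        using ideal.I_l_closed[OF I] by (simp add: poly_ring_simps)
      then have "single m c \<in> Idl\<^bsub>poly_ring V\<^esub> (monomial ` G)"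
        by (simp add: mult_single m(1) add.commute)
      then show ?case
        using additive_subgroup.a_closed[OF ideal.axioms(1)[OF I]] add.IH by (simp add: poly_ring_simps)
    qed
  qed
qed

lemma ext_sign_square: "ext_sign F G * ext_sign F G = (1 :: 'k::field)"
  by (simp add: ext_sign_def flip: power_mult_distrib)

lemma keys_wedge:
  assumes "H \<in> keys (wedge a b)"
  shows "\<exists>F\<in>keys a. \<exists>G\<in>keys b. F \<inter> G = {} \<and> H = F \<union> G"
proof -
  have "wedge a b = (\<Sum>F\<in>keys a. \<Sum>G\<in>keys b.
      ext_term F G (lookup a F * lookup b G))"
    by (rule wedge_superset) auto
  with assms have "(\<Sum>F\<in>keys a. \<Sum>G\<in>keys b. lookup
      (ext_term F G (lookup a F * lookup b G)) H) \<noteq> 0"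
    by (simp add: in_keys_iff lookup_sum)
  then obtain F where F: "F \<in> keys a" "(\<Sum>G\<in>keys b. lookup
      (ext_term F G (lookup a F * lookup b G)) H) \<noteq> 0"
    by (meson sum.not_neutral_contains_not_neutral)
  then obtain G where "G \<in> keys b" "lookup
      (ext_term F G (lookup a F * lookup b G)) H \<noteq> 0"
    by (meson sum.not_neutral_contains_not_neutral)
  with F(1) show ?thesis
    by (auto simp: ext_term_def lookup_single when_def split: if_splits)
qed

text \<open>In the exterior algebra \<open>e_g\<close> divides \<open>e_F\<close> exactly when
  \<open>g \<subseteq> F\<close>, so inclusion takes the place of divisibility.\<close>

definition ext_monomial_ideal :: "nat \<Rightarrow> nat set set \<Rightarrow> 'k::field ext set" where
  "ext_monomial_ideal n G =
     {a. \<forall>F\<in>keys a. F \<subseteq> {..<n} \<and> (\<exists>g\<in>G. g \<subseteq> F)}"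

lemma Idl_ext_monomials:
  assumes "\<And>g. g \<in> G \<Longrightarrow> g \<subseteq> {..<n}"
  shows "Idl\<^bsub>ext_ring n\<^esub> (ext_monomial ` G) = (ext_monomial_ideal n G :: 'k::field ext set)"
proof
  interpret R: ring "ext_ring n :: 'k ext ring" by (rule ring_ext_ring)
  have sub: "ext_monomial ` G \<subseteq> carrier (ext_ring n :: 'k ext ring)"
    using assms by (fastforce simp: ext_ring_simps)
  have "ideal (ext_monomial_ideal n G) (ext_ring n :: 'k ext ring)"
  proof (rule ideal_by_closure)
    fix x y :: "'k ext" assume "x \<in> ext_monomial_ideal n G" "y \<in> ext_monomial_ideal n G"
    then show "x \<oplus>\<^bsub>ext_ring n\<^esub> y \<in> ext_monomial_ideal n G"
      using Poly_Mapping.keys_add[of x y] by (auto simp: ext_ring_simps ext_monomial_ideal_def)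
  next
    fix x :: "'k ext" assume x: "x \<in> ext_monomial_ideal n G"
    then have "- x \<in> ext_monomial_ideal n G"
      by (auto simp: ext_monomial_ideal_def in_keys_iff)
    then show "\<exists>y\<in>ext_monomial_ideal n G. y \<oplus>\<^bsub>ext_ring n\<^esub> x = \<zero>\<^bsub>ext_ring n\<^esub>"
      by (intro bexI[of _ "- x"]) (auto simp: ext_ring_simps)
  next
    fix a x :: "'k ext" assume a: "a \<in> ext_monomial_ideal n G" and "x \<in> carrier (ext_ring n)"
    then have x: "F \<subseteq> {..<n}" if "F \<in> keys x" for F
      using that by (simp add: ext_ring_simps)
    have "H \<subseteq> {..<n} \<and> (\<exists>g\<in>G. g \<subseteq> H)"
      if "F \<in> keys x" "F' \<in> keys a" "H = F \<union> F' \<or> H = F' \<union> F" for F F' H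
    proof -
      have *: "F' \<subseteq> {..<n} \<and> (\<exists>g\<in>G. g \<subseteq> F')"
        using a that(2) by (simp add: ext_monomial_ideal_def)
      then obtain g where g: "g \<in> G" "g \<subseteq> F'" by (elim conjE bexE)
      have "F' \<subseteq> H" "F \<subseteq> H" "H \<subseteq> F \<union> F'" using that(3) by (elim disjE; simp)+
      moreover from g this have "g \<subseteq> H" by (meson subset_trans)
      ultimately show ?thesis using g(1) x[OF that(1)] * by (meson Un_least subset_trans)
    qed
    then show "x \<otimes>\<^bsub>ext_ring n\<^esub> a \<in> ext_monomial_ideal n G" "a \<otimes>\<^bsub>ext_ring n\<^esub> x \<in> ext_monomial_ideal n G"
      unfolding ext_ring_simps ext_monomial_ideal_def mem_Collect_eq by (meson keys_wedge)+
  qed (auto simp: R.ring_axioms ext_ring_simps ext_monomial_ideal_def)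
  moreover have "ext_monomial ` G \<subseteq> (ext_monomial_ideal n G :: 'k ext set)"
    using assms by (fastforce simp: ext_monomial_ideal_def)
  ultimately show "Idl\<^bsub>ext_ring n\<^esub> (ext_monomial ` G) \<subseteq> (ext_monomial_ideal n G :: 'k ext set)"
    by (rule R.genideal_minimal)
  have I: "ideal (Idl\<^bsub>ext_ring n\<^esub> (ext_monomial ` G)) (ext_ring n :: 'k ext ring)"
    by (rule R.genideal_ideal[OF sub])
  show "(ext_monomial_ideal n G :: 'k ext set) \<subseteq> Idl\<^bsub>ext_ring n\<^esub> (ext_monomial ` G)"
  proof
    fix p :: "'k ext" assume p: "p \<in> ext_monomial_ideal n G"
    let ?S = "{F. F \<subseteq> {..<n} \<and> (\<exists>g\<in>G. g \<subseteq> F)}"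
    have "keys p \<subseteq> ?S"
      using p by (auto simp: ext_monomial_ideal_def)
    then show "p \<in> Idl\<^bsub>ext_ring n\<^esub> (ext_monomial ` G)"
    proof (induction p rule: poly_mapping_induct_on)
      case zero
      show ?case
        using additive_subgroup.zero_closed[OF ideal.axioms(1)[OF I]] by (simp add: ext_ring_simps)
    next
      case (add F c q)
      then obtain g where g: "F \<subseteq> {..<n}" "g \<in> G" "g \<subseteq> F" by blast
      \<comment> \<open>The complementary monomial is multiplied in with the sign that the product
        will produce; the two signs cancel, which leaves \<open>c e_F\<close>.\<close>
      let ?s = "ext_sign (F - g) g :: 'k"
      have "single (F - g) (?s * c) \<in> carrier (ext_ring n)"
        using g(1) by (auto simp: ext_ring_simps)
      moreover have "ext_monomial g \<in> Idl\<^bsub>ext_ring n\<^esub> (ext_monomial ` G :: 'k ext set)"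
        using R.genideal_self[OF sub] g(2) by blast
      ultimately have "wedge (single (F - g) (?s * c)) (ext_monomial g) \<in> Idl\<^bsub>ext_ring n\<^esub> (ext_monomial ` G)"
        using ideal.I_l_closed[OF I] by (simp add: ext_ring_simps)
      moreover have "wedge (single (F - g) (?s * c)) (ext_monomial g) = single F c"
        using g(3) ext_sign_square[of "F - g" g, where 'k = 'k]
        by (simp add: wedge_single ext_term_def Un_absorb2 Int_commute flip: mult.assoc)
      ultimately show ?case
        using additive_subgroup.a_closed[OF ideal.axioms(1)[OF I]] add.IH by (simp add: ext_ring_simps)
    qed
  qed
qed

section \<open>The linear action on polynomials\<close>

abbreviation linear_form :: "nat \<Rightarrow> 'k::field mat \<Rightarrow> nat \<Rightarrow> (nat, 'k) mpoly" where
  "linear_form n A j \<equiv> \<Sum>i<n. single (single i 1) (A $$ (i, j))"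

lemmas poly_act_add = coeff_hom.eval_mpoly_add[OF coeff_hom_single_0,
    where f = "linear_form n A" for n A, folded poly_act_def]
  and poly_act_mult = coeff_hom.eval_mpoly_mult[OF coeff_hom_single_0,
    where f = "linear_form n A" for n A, folded poly_act_def]
  and poly_act_sum = coeff_hom.eval_mpoly_sum[OF coeff_hom_single_0,
    where f = "linear_form n A" for n A, folded poly_act_def]
  and poly_act_0 = coeff_hom.eval_mpoly_0[OF coeff_hom_single_0,
    where f = "linear_form n A" for n A, folded poly_act_def]
  and poly_act_1 = coeff_hom.eval_mpoly_1[OF coeff_hom_single_0,
    where f = "linear_form n A" for n A, folded poly_act_def]
  and poly_act_single = coeff_hom.eval_mpoly_single[OF coeff_hom_single_0,
    where f = "linear_form n A" for n A, folded poly_act_def]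

lemma poly_act_const [simp]: "poly_act n A (single 0 c) = single 0 c"
  by (simp add: poly_act_single)

lemma pm_scale_eq_mult: "pm_scale c (p :: ('v, 'k::field) mpoly) = single 0 c * p"
  by (simp add: pm_scale_def mult_map_scale_conv_mult)

lemma poly_act_scale: "poly_act n A (pm_scale c p) = pm_scale c (poly_act n A p)"
  by (simp add: pm_scale_eq_mult poly_act_mult)

lemma mon_val_polys: "(\<And>v. f v \<in> polys V) \<Longrightarrow> mon_val f m \<in> polys V"
  by (simp add: mon_val_def polys_prod polys_power)

lemma poly_act_polys: "poly_act n A p \<in> polys {..<n}"
proof -
  have "linear_form n A j \<in> polys {..<n}" for j
    by (intro polys_sum polys_var) simp
  then have "mon_val (linear_form n A) m \<in> polys {..<n}" for m
    by (rule mon_val_polys)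
  then show ?thesis
    unfolding poly_act_def eval_mpoly_def mon_val_def[symmetric]
    by (intro polys_sum polys_closed(2) polys_const)
qed

definition homogeneous :: "nat \<Rightarrow> (nat, 'k::field) mpoly \<Rightarrow> bool" where
  "homogeneous d p \<longleftrightarrow> (\<forall>m\<in>keys p. mon_deg m = d)"

lemma homogeneous_add: "homogeneous d p \<Longrightarrow> homogeneous d q \<Longrightarrow> homogeneous d (p + q)"
  using Poly_Mapping.keys_add[of p q] by (auto simp: homogeneous_def)

lemma homogeneous_mult:
  assumes "homogeneous d p" "homogeneous e q" shows "homogeneous (d + e) (p * q)"
  unfolding homogeneous_def
proof
  fix m assume "m \<in> keys (p * q)"
  then obtain a b where "m = a + b" "a \<in> keys p" "b \<in> keys q"
    using keys_mult by blast
  then show "mon_deg m = d + e"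
    using assms by (simp add: homogeneous_def)
qed

lemma homogeneous_0: "homogeneous d 0" and homogeneous_1: "homogeneous 0 1"
  and homogeneous_single: "homogeneous (mon_deg m) (single m c)"
  by (auto simp: homogeneous_def)

lemma homogeneous_sum: "(\<And>i. i \<in> I \<Longrightarrow> homogeneous d (p i)) \<Longrightarrow> homogeneous d (\<Sum>i\<in>I. p i)"
  by (induction I rule: infinite_finite_induct) (simp_all add: homogeneous_0 homogeneous_add)

lemma homogeneous_power: "homogeneous d p \<Longrightarrow> homogeneous (k * d) (p ^ k)"
  by (induction k) (simp_all add: homogeneous_1 homogeneous_mult)

lemma homogeneous_prod:
  "finite I \<Longrightarrow> (\<And>i. i \<in> I \<Longrightarrow> homogeneous (d i) (p i)) \<Longrightarrow> homogeneous (\<Sum>i\<in>I. d i) (\<Prod>i\<in>I. p i)"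
  by (induction I rule: finite_induct) (simp_all add: homogeneous_1 homogeneous_mult)

text \<open>Variables are replaced by linear forms, so a term of degree \<open>d\<close> becomes
  homogeneous of degree \<open>d\<close>.\<close>

lemma mon_deg_keys_poly_act:
  assumes "m \<in> keys (poly_act n A p)"
  shows "\<exists>m'\<in>keys p. mon_deg m = mon_deg m'"
proof -
  have "homogeneous (mon_deg (single i 1)) (single (single i 1) (A $$ (i, j)))"
    for i j by (rule homogeneous_single)
  then have form: "homogeneous 1 (linear_form n A j)" for j
    by (intro homogeneous_sum) (simp only: mon_deg_single)
  have mon: "homogeneous (mon_deg m) (mon_val (linear_form n A) m)" for m
    unfolding mon_val_def mon_deg_def
  proof (rule homogeneous_prod)
    fix i
    show "homogeneous (lookup m i) (linear_form n A i ^ lookup m i)"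
      using homogeneous_power[OF form[of i], of "lookup m i"] by (simp only: mult_1_right)
  qed simp
  have single: "homogeneous (mon_deg m) (poly_act n A (single m c))" for m c
    using homogeneous_mult[OF homogeneous_single[of 0 c] mon[of m]]
    by (simp only: poly_act_single mon_deg_0 add_0)
  have eq: "poly_act n A p =
      (\<Sum>m'\<in>keys p. poly_act n A (single m' (lookup p m')))"
    by (subst poly_mapping_sum_single[of p]) (simp only: poly_act_sum)
  have "m \<in> (\<Union>m'\<in>keys p.
      keys (poly_act n A (single m' (lookup p m'))))"
    using assms unfolding eq by (rule subsetD[OF keys_sum])
  then show ?thesis
    using single by (auto simp: homogeneous_def)
qed

lemma comm_ring_hom_poly_act: "comm_ring_hom (poly_act n A)"
  by unfold_locales (simp_all add: poly_act_add poly_act_mult poly_act_0 poly_act_1)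

lemma comm_ring_hom_eval_at: "comm_ring_hom (eval_at z)"
  by unfold_locales (simp_all add: eval_at_simps)

lemma poly_act_var: "poly_act n A (single (single i 1) c) =
    single 0 c * linear_form n A i"
  by (simp add: poly_act_single)

text \<open>The image of a variable is a column of the matrix, so substituting first by
  \<open>A\<close> and then by \<open>B\<close> multiplies in the order \<open>B * A\<close>.
  Invertible matrices therefore act bijectively.\<close>

lemma poly_act_comp:
  assumes p: "p \<in> polys {..<n}" and A: "A \<in> carrier_mat n n" and B: "B \<in> carrier_mat n n"
  shows "poly_act n B (poly_act n A p) = poly_act n (B * A) p"
proof -
  have "poly_act n B (linear_form n A j) = linear_form n (B * A) j" if "j < n" for j
  proof -
    have "poly_act n B (linear_form n A j) =
        (\<Sum>i<n. \<Sum>k<n. single (single k 1) (A $$ (i, j) * B $$ (k, i)))"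
      by (simp only: poly_act_sum poly_act_var) (simp add: sum_distrib_left mult_single)
    also have "\<dots> = (\<Sum>k<n. \<Sum>i<n. single (single k 1) (B $$ (k, i) * A $$ (i, j)))"
      by (subst sum.swap) (simp add: mult.commute)
    also have "\<dots> = (\<Sum>k<n. single (single k 1) (\<Sum>i<n. B $$ (k, i) * A $$ (i, j)))"
      by (intro sum.cong refl poly_mapping_eqI) (simp add: lookup_sum lookup_single when_def)
    also have "\<dots> = linear_form n (B * A) j"
      using A B that by (intro sum.cong refl) (simp add: scalar_prod_def atLeast0LessThan)
    finally show ?thesis .
  qed
  moreover have "poly_act n B (poly_act n A p) =
      eval_mpoly (single 0) (\<lambda>j. poly_act n B (linear_form n A j)) p"
    by (subst poly_act_def[of n A], subst comm_ring_hom.hom_eval_mpoly[OF comm_ring_hom_poly_act]) simp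
  moreover from calculation(1) have "eval_mpoly (single 0) (\<lambda>j. poly_act n B (linear_form n A j)) p =
      eval_mpoly (single 0) (linear_form n (B * A)) p"
    by (intro eval_mpoly_cong[OF p]) (simp only: lessThan_iff)
  ultimately show ?thesis
    by (simp only: poly_act_def[of n "B * A"])
qed

lemma monomial_var_power:
  "(monomial (single v 1) :: ('v, 'k::field) mpoly) ^ k = monomial (single v k)"
  by (induction k) (simp_all add: mult_single flip: single_add)

lemma monomial_prod: "(\<Prod>v\<in>S. monomial (f v) :: ('v, 'k::field) mpoly) = monomial (\<Sum>v\<in>S. f v)"
  by (induction S rule: infinite_finite_induct) (simp_all add: mult_single)

lemma mon_val_monomial: "mon_val (\<lambda>j. monomial (single j 1) :: (nat, 'k::field) mpoly) m = monomial m"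
  by (simp only: mon_val_def monomial_var_power monomial_prod poly_mapping_sum_single[symmetric])

lemma poly_act_one:
  assumes "p \<in> polys {..<n}" shows "poly_act n (1\<^sub>m n) p = p"
proof -
  have "linear_form n (1\<^sub>m n :: 'a mat) j = monomial (single j 1)" if "j < n" for j
  proof -
    have "linear_form n (1\<^sub>m n :: 'a mat) j =
        (\<Sum>i<n. if i = j then monomial (single j 1) else 0)"
      using that by (intro sum.cong) auto
    then show ?thesis using that by simp
  qed
  then have "poly_act n (1\<^sub>m n) p =
      eval_mpoly (single 0) (\<lambda>j. monomial (single j 1)) p"
    unfolding poly_act_def by (intro eval_mpoly_cong[OF assms]) simp
  also have "\<dots> = (\<Sum>m\<in>keys p. single m (lookup p m))"
    unfolding eval_mpoly_def mon_val_def[symmetric] by (simp only: mon_val_monomial mult_single) simp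
  also have "\<dots> = p" by (rule poly_mapping_sum_single[symmetric])
  finally show ?thesis .
qed

text \<open>The action on polynomials is dual to \<open>z \<mapsto> A^T z\<close> on points. Hence
  the transformed ideal vanishes at \<open>z\<close> as soon as \<open>A^T z\<close> is supported on
  a face.\<close>

lemma eval_at_poly_act:
  "eval_at z (poly_act n A p) = eval_at (\<lambda>j. \<Sum>i<n. A $$ (i, j) * z i) p"
  unfolding poly_act_def
  by (subst comm_ring_hom.hom_eval_mpoly[OF comm_ring_hom_eval_at]) (simp add: eval_at_simps)

section \<open>The linear action on the exterior algebra\<close>

definition ext_vec :: "nat \<Rightarrow> (nat \<Rightarrow> 'k::field) \<Rightarrow> 'k ext" where
  "ext_vec n x = (\<Sum>i<n. single {i} (x i))"

text \<open>The image of \<open>e_F\<close>: the wedge of the columns of \<open>A\<close> indexed by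
  \<open>F\<close>, in increasing order.\<close>

definition ext_prod :: "nat \<Rightarrow> 'k::field mat \<Rightarrow> nat set \<Rightarrow> 'k ext" where
  "ext_prod n A F = foldr (\<lambda>j. wedge (ext_vec n (\<lambda>i. A $$ (i, j)))) (sorted_list_of_set F) (ext_monomial {})"

lemma wedge_const: "wedge (single {} c) b = pm_scale c b"
proof -
  have "wedge (single {} c) b =
      (\<Sum>G\<in>keys b. single G (c * lookup b G))"
    by (simp add: wedge_superset[where A = "{{}}" and B = "keys b"] ext_term_def ext_sign_def)
  also have "\<dots> = pm_scale c b"
    by (rule poly_mapping_eqI) (simp add: lookup_sum lookup_single when_def in_keys_iff)
  finally show ?thesis .
qed

lemma pm_scale_0 [simp]: "pm_scale c 0 = 0" "pm_scale 0 a = 0"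
  and pm_scale_1 [simp]: "pm_scale 1 a = a"
  and pm_scale_add: "pm_scale c (a + b) = pm_scale c a + pm_scale c b"
  and pm_scale_scale [simp]: "pm_scale c (pm_scale d a) = pm_scale (c * d) a"
  and pm_scale_single [simp]: "pm_scale c (single m d) = single m (c * d)"
  and pm_scale_minus_1: "pm_scale (- 1) a = - a"
  by (auto intro!: poly_mapping_eqI simp: lookup_add lookup_single when_def algebra_simps)

lemma pm_scale_sum: "pm_scale c (\<Sum>i\<in>I. a i) = (\<Sum>i\<in>I. pm_scale c (a i))"
  by (induction I rule: infinite_finite_induct) (simp_all add: pm_scale_add)

lemma pm_scale_ext_term: "pm_scale c (ext_term F G d) = ext_term F G (c * d)"
  by (simp add: ext_term_def mult_ac)

lemma wedge_scale_left: "wedge (pm_scale c a) b = pm_scale c (wedge a b)"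
  by (simp add: wedge_superset[where A = "keys a" and B = "keys b"]
      keys_pm_scale pm_scale_sum pm_scale_ext_term mult_ac)

lemma wedge_scale_right: "wedge a (pm_scale c b) = pm_scale c (wedge a b)"
  by (simp add: wedge_superset[where A = "keys a" and B = "keys b"]
      keys_pm_scale pm_scale_sum pm_scale_ext_term mult_ac)

lemma ext_act_alt: "ext_act n A a = (\<Sum>F\<in>keys a. pm_scale (lookup a F) (ext_prod n A F))"
  by (simp add: ext_act_def wedge_const ext_prod_def ext_vec_def)

lemma ext_act_superset:
  assumes "finite S" "keys a \<subseteq> S"
  shows "ext_act n A a = (\<Sum>F\<in>S. pm_scale (lookup a F) (ext_prod n A F))"
  unfolding ext_act_alt by (rule sum.mono_neutral_left) (use assms in \<open>auto simp: in_keys_iff\<close>)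

lemma pm_scale_add_left: "pm_scale (c + d) a = pm_scale c a + pm_scale d a"
  by (rule poly_mapping_eqI) (simp add: lookup_add algebra_simps)

lemma ext_act_add: "ext_act n A (a + b) = ext_act n A a + ext_act n A b"
proof -
  let ?S = "keys a \<union> keys b"
  have "keys (a + b) \<subseteq> ?S"
    by (rule Poly_Mapping.keys_add)
  then show ?thesis
    by (simp add: ext_act_superset[of ?S] lookup_add pm_scale_add_left sum.distrib)
qed

lemma ext_act_scale: "ext_act n A (pm_scale c a) = pm_scale c (ext_act n A a)"
  by (simp add: ext_act_superset[of "keys a"] keys_pm_scale pm_scale_sum)

lemma ext_act_single: "ext_act n A (single F c) = pm_scale c (ext_prod n A F)"
  by (simp add: ext_act_superset[of "{F}"])

lemma ext_act_0 [simp]: "ext_act n A 0 = 0"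
  by (simp add: ext_act_alt)

lemma ext_act_sum: "ext_act n A (\<Sum>i\<in>I. a i) = (\<Sum>i\<in>I. ext_act n A (a i))"
  by (induction I rule: infinite_finite_induct) (simp_all add: ext_act_add)

lemma wedge_sum_left: "wedge (\<Sum>i\<in>I. a i) b = (\<Sum>i\<in>I. wedge (a i) b)"
  by (induction I rule: infinite_finite_induct) (simp_all add: wedge_add_left)

lemma wedge_sum_right: "wedge b (\<Sum>i\<in>I. a i) = (\<Sum>i\<in>I. wedge b (a i))"
  by (induction I rule: infinite_finite_induct) (simp_all add: wedge_add_right)

lemma wedge_ext_vec: "wedge (ext_vec n x) (ext_vec n y) = (\<Sum>i<n. \<Sum>j<n. ext_term {i} {j} (x i * y j))"
  by (simp add: ext_vec_def wedge_sum_left wedge_sum_right wedge_single) (rule sum.swap)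

lemma ext_sign_singletons:
  "ext_sign {i} {j} = (if j < i then - 1 else 1 :: 'k::field)"
proof -
  have "{(a, b). a \<in> {i} \<and> b \<in> {j} \<and> b < a} = (if j < i then {(i, j)} else {})"
    by auto
  then show ?thesis by (simp add: ext_sign_def)
qed

lemma ext_term_swap: "ext_term {j} {i} c = - ext_term {i} {j} (c :: 'k::field)"
  by (auto simp: ext_term_def ext_sign_singletons insert_commute single_uminus)

lemma wedge_ext_vec_swap: "wedge (ext_vec n y) (ext_vec n x) = - wedge (ext_vec n x) (ext_vec n y)"
proof -
  have "wedge (ext_vec n y) (ext_vec n x) = (\<Sum>j<n. \<Sum>i<n. - ext_term {i} {j} (x i * y j))"
    unfolding wedge_ext_vec by (intro sum.cong refl) (metis ext_term_swap mult.commute)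
  also have "\<dots> = (\<Sum>i<n. \<Sum>j<n. - ext_term {i} {j} (x i * y j))"
    by (rule sum.swap)
  finally show ?thesis by (simp add: wedge_ext_vec sum_negf)
qed

text \<open>Antisymmetry makes the product equal to its own negative, and 2 is invertible in
  characteristic 0.\<close>

lemma wedge_ext_vec_self: "wedge (ext_vec n x) (ext_vec n x) = (0 :: 'k::field_char_0 ext)"
proof (rule poly_mapping_eqI)
  fix F
  have "lookup (wedge (ext_vec n x) (ext_vec n x)) F =
      - lookup (wedge (ext_vec n x) (ext_vec n x)) F"
    using wedge_ext_vec_swap[of n x x] by (metis lookup_uminus)
  then show "lookup (wedge (ext_vec n x) (ext_vec n x)) F = lookup 0 F"
    by simp
qed

lemma ext_carrier_iff: "a \<in> carrier (ext_ring n) \<longleftrightarrow> (\<forall>F\<in>keys a. F \<subseteq> {..<n})"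
  by (simp add: ext_ring_simps)

lemma ext_vec_closed: "ext_vec n x \<in> carrier (ext_ring n)"
proof -
  have "keys (ext_vec n x) \<subseteq> (\<Union>i<n. {{i}})"
    unfolding ext_vec_def by (rule order_trans[OF keys_sum]) (auto split: if_splits)
  then show ?thesis by (auto simp: ext_carrier_iff)
qed

lemma foldr_wedge_closed:
  "foldr (\<lambda>j. wedge (ext_vec n (f j))) xs (ext_monomial {}) \<in> carrier (ext_ring n)"
  by (induction xs) (simp_all add: wedge_closed ext_vec_closed, simp add: ext_carrier_iff)

lemma ext_prod_closed: "ext_prod n A F \<in> carrier (ext_ring n)"
  unfolding ext_prod_def by (rule foldr_wedge_closed)

lemma ext_prod_empty [simp]: "ext_prod n A {} = ext_monomial {}"
  by (simp add: ext_prod_def)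

lemma sorted_list_of_set_insert_min:
  fixes A :: "nat set"
  assumes "finite A" "\<forall>a\<in>A. b < a"
  shows "sorted_list_of_set (insert b A) = b # sorted_list_of_set A"
proof -
  have "Min (insert b A) = b"
    using assms by (intro Min_eqI) auto
  moreover have "insert b A - {b} = A" using assms by auto
  ultimately show ?thesis
    using assms(1) sorted_list_of_set_nonempty[of "insert b A"] by simp
qed

lemma ext_prod_insert_min:
  "finite F \<Longrightarrow> \<forall>a\<in>F. b < a \<Longrightarrow>
    ext_prod n A (insert b F) = wedge (ext_vec n (\<lambda>i. A $$ (i, b))) (ext_prod n A F)"
  by (simp only: ext_prod_def sorted_list_of_set_insert_min foldr_Cons o_apply)

lemma ext_sign_min: "\<forall>a\<in>F. b < a \<Longrightarrow> ext_sign {b} F = (1 :: 'k::field)"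
proof -
  assume "\<forall>a\<in>F. b < a"
  then have "{(i, j). i \<in> {b} \<and> j \<in> F \<and> j < i} = {}" by auto
  then show ?thesis by (simp only: ext_sign_def) simp
qed

lemma ext_sign_insert_right:
  "finite F \<Longrightarrow> b \<notin> F \<Longrightarrow> ext_sign {j} (insert b F) = (ext_sign {j} {b} * ext_sign {j} F :: 'k::field)"
  using ext_sign_union_right[of "{b}" F "{j}"] by simp

text \<open>Column \<open>j\<close> is moved past the smaller columns of \<open>F\<close>, each
  costing a sign; \<open>ext_sign\<close> counts them. If it meets its own copy, the product
  vanishes.\<close>

lemma wedge_vec_ext_prod:
  fixes A :: "'k::field_char_0 mat"
  assumes "finite F"
  shows "wedge (ext_vec n (\<lambda>i. A $$ (i, j))) (ext_prod n A F) =
    (if j \<in> F then 0 else pm_scale (ext_sign {j} F) (ext_prod n A (insert j F)))"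
  using assms
proof (induction F rule: finite_linorder_min_induct)
  case empty
  then show ?case by (simp add: ext_prod_insert_min ext_sign_min)
next
  case (insert b F)
  let ?w = "\<lambda>j. ext_vec n (\<lambda>i. A $$ (i, j))"
  have bF: "b \<notin> F" using insert.hyps(2) by auto
  have W: "ext_prod n A (insert b F) = wedge (?w b) (ext_prod n A F)"
    by (rule ext_prod_insert_min[OF insert.hyps(1,2)])
  \<comment> \<open>The new column trades places with the smallest one, after which the induction
    hypothesis applies to the rest.\<close>
  have swap: "wedge (?w j) (ext_prod n A (insert b F)) = - wedge (?w b) (wedge (?w j) (ext_prod n A F))"
  proof -
    have "wedge (?w j) (ext_prod n A (insert b F)) = wedge (wedge (?w j) (?w b)) (ext_prod n A F)"
      by (simp add: W wedge_assoc[OF ext_vec_closed ext_vec_closed ext_prod_closed])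
    also have "\<dots> = wedge (pm_scale (- 1) (wedge (?w b) (?w j))) (ext_prod n A F)"
      by (subst wedge_ext_vec_swap) (simp add: pm_scale_minus_1)
    also have "\<dots> = - wedge (?w b) (wedge (?w j) (ext_prod n A F))"
      by (simp only: wedge_scale_left wedge_assoc[OF ext_vec_closed ext_vec_closed ext_prod_closed])
         (simp only: pm_scale_minus_1)
    finally show ?thesis .
  qed
  consider "j < b" | "j = b" | "b < j" by linarith
  then show ?case
  proof cases
    case 1
    then have "\<forall>a\<in>insert b F. j < a" using insert.hyps(2) by auto
    then show ?thesis
      using insert.hyps(1) by (auto simp: ext_prod_insert_min ext_sign_min)
  next
    case 2
    then have "wedge (?w j) (ext_prod n A (insert b F)) = wedge (wedge (?w b) (?w b)) (ext_prod n A F)"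
      by (simp add: W wedge_assoc[OF ext_vec_closed ext_vec_closed ext_prod_closed])
    then show ?thesis using 2 by (simp add: wedge_ext_vec_self)
  next
    case 3
    show ?thesis
    proof (cases "j \<in> F")
      case True
      then show ?thesis using swap insert.IH by simp
    next
      case False
      have "\<forall>a\<in>insert j F. b < a" using 3 insert.hyps(2) by auto
      then have "ext_prod n A (insert b (insert j F)) = wedge (?w b) (ext_prod n A (insert j F))"
        using insert.hyps(1) by (simp add: ext_prod_insert_min)
      then have "wedge (?w j) (ext_prod n A (insert b F)) =
          pm_scale (- ext_sign {j} F) (ext_prod n A (insert j (insert b F)))"
        using swap insert.IH False
        by (simp add: wedge_scale_right pm_scale_minus_1[symmetric] insert_commute)
      then show ?thesis
        using 3 False ext_sign_insert_right[OF insert.hyps(1) bF, of j, where 'k = 'k]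
        by (simp add: ext_sign_singletons)
    qed
  qed
qed

text \<open>The products of columns multiply by the same rule as the basis elements
  \<open>e_F\<close>. This is what makes \<open>ext_act\<close> an algebra homomorphism.\<close>

lemma wedge_ext_prod:
  fixes A :: "'k::field_char_0 mat"
  assumes "finite F" "finite G"
  shows "wedge (ext_prod n A F) (ext_prod n A G) =
    (if F \<inter> G = {} then pm_scale (ext_sign F G) (ext_prod n A (F \<union> G)) else 0)"
  using assms(1)
proof (induction F rule: finite_linorder_min_induct)
  case empty
  then show ?case by (simp add: wedge_one[OF ext_prod_closed] ext_sign_def)
next
  case (insert b F)
  let ?w = "ext_vec n (\<lambda>i. A $$ (i, b))"
  have bF: "b \<notin> F" using insert.hyps(2) by auto
  have eq: "wedge (ext_prod n A (insert b F)) (ext_prod n A G) =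
      wedge ?w (wedge (ext_prod n A F) (ext_prod n A G))"
    by (simp add: ext_prod_insert_min[OF insert.hyps(1,2)]
        wedge_assoc[OF ext_vec_closed ext_prod_closed ext_prod_closed])
  show ?case
  proof (cases "F \<inter> G = {}")
    case True
    then have eq2: "wedge (ext_prod n A (insert b F)) (ext_prod n A G) =
        pm_scale (ext_sign F G) (wedge ?w (ext_prod n A (F \<union> G)))"
      using eq insert.IH by (simp add: wedge_scale_right)
    show ?thesis
    proof (cases "b \<in> G")
      case True
      then show ?thesis using eq2 insert.hyps(1) assms(2) by (simp add: wedge_vec_ext_prod)
    next
      case False
      have "ext_sign {b} (F \<union> G) = (ext_sign {b} G :: 'k)"
        using ext_sign_union_right[OF insert.hyps(1) assms(2), of "{b}", where 'k = 'k] True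
        by (simp add: ext_sign_min[OF insert.hyps(2)])
      moreover have "ext_sign (insert b F) G = (ext_sign {b} G * ext_sign F G :: 'k)"
        using ext_sign_union_left[of "{b}" F G, where 'k = 'k] bF insert.hyps(1) assms(2) by simp
      ultimately show ?thesis
        using eq2 insert.hyps(1) assms(2) False True bF by (simp add: wedge_vec_ext_prod mult.commute)
    qed
  next
    case False
    then show ?thesis using eq insert.IH by auto
  qed
qed

lemma ext_act_wedge:
  fixes A :: "'k::field_char_0 mat"
  assumes "a \<in> carrier (ext_ring n)" "b \<in> carrier (ext_ring n)"
  shows "ext_act n A (wedge a b) = wedge (ext_act n A a) (ext_act n A b)"
  using assms(1)
proof (induction rule: ext_induct)
  case (add F c a)
  have "ext_act n A (wedge (single F c) b) =
      wedge (ext_act n A (single F c)) (ext_act n A b)"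
    using assms(2)
  proof (induction rule: ext_induct)
    case (add G d b)
    have "finite F" "finite G"
      using \<open>F \<subseteq> {..<n}\<close> add.hyps(1) finite_subset by blast+
    then have "ext_act n A (wedge (single F c) (single G d)) =
        wedge (ext_act n A (single F c)) (ext_act n A (single G d))"
      by (simp add: wedge_single ext_term_def ext_act_single wedge_scale_left wedge_scale_right
          wedge_ext_prod mult_ac)
    then show ?case
      using add.IH by (simp add: wedge_add_right ext_act_add)
  qed simp
  then show ?case
    using add.IH by (simp add: wedge_add_left ext_act_add)
qed simp

lemma ext_prod_singleton [simp]: "ext_prod n A {i} = ext_vec n (\<lambda>k. A $$ (k, i))"
  by (simp add: ext_prod_def wedge_one[OF ext_vec_closed])

lemma ext_act_vec:
  assumes "A \<in> carrier_mat n n" "B \<in> carrier_mat n n" "j < n"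
  shows "ext_act n B (ext_vec n (\<lambda>i. A $$ (i, j))) = ext_vec n (\<lambda>i. (B * A) $$ (i, j))"
proof -
  have "ext_act n B (ext_vec n (\<lambda>i. A $$ (i, j))) =
      (\<Sum>i<n. \<Sum>k<n. single {k} (A $$ (i, j) * B $$ (k, i)))"
    by (simp add: ext_vec_def[of n "\<lambda>i. A $$ (i, j)"] ext_act_sum ext_act_single)
       (simp add: ext_vec_def pm_scale_sum)
  also have "\<dots> = (\<Sum>k<n. \<Sum>i<n. single {k} (B $$ (k, i) * A $$ (i, j)))"
    by (subst sum.swap) (simp add: mult.commute)
  also have "\<dots> = (\<Sum>k<n. single {k} (\<Sum>i<n. B $$ (k, i) * A $$ (i, j)))"
    by (intro sum.cong refl poly_mapping_eqI) (simp add: lookup_sum lookup_single when_def)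
  also have "\<dots> = ext_vec n (\<lambda>i. (B * A) $$ (i, j))"
    unfolding ext_vec_def using assms
    by (intro sum.cong refl) (simp add: scalar_prod_def atLeast0LessThan)
  finally show ?thesis .
qed

lemma ext_act_ext_prod:
  fixes A :: "'k::field_char_0 mat"
  assumes A: "A \<in> carrier_mat n n" and B: "B \<in> carrier_mat n n" and F: "F \<subseteq> {..<n}"
  shows "ext_act n B (ext_prod n A F) = ext_prod n (B * A) F"
proof -
  have "finite F" using F finite_subset by blast
  then show ?thesis using F
  proof (induction F rule: finite_linorder_min_induct)
    case empty
    then show ?case by (simp add: ext_act_single)
  next
    case (insert b F)
    then show ?case
      by (simp add: ext_prod_insert_min ext_act_wedge[OF ext_vec_closed ext_prod_closed] ext_act_vec[OF A B])
  qed
qed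

lemma ext_act_comp:
  fixes A :: "'k::field_char_0 mat"
  assumes "a \<in> carrier (ext_ring n)" "A \<in> carrier_mat n n" "B \<in> carrier_mat n n"
  shows "ext_act n B (ext_act n A a) = ext_act n (B * A) a"
  using assms(1)
  by (induction rule: ext_induct)
     (simp_all add: ext_act_add ext_act_single ext_act_scale ext_act_ext_prod assms(2,3))

lemma ext_prod_one:
  assumes "F \<subseteq> {..<n}" shows "ext_prod n (1\<^sub>m n) F = (ext_monomial F :: 'k::field ext)"
proof -
  have w: "ext_vec n (\<lambda>i. (1\<^sub>m n :: 'k mat) $$ (i, j)) = ext_monomial {j}" if "j < n" for j
  proof -
    have "ext_vec n (\<lambda>i. (1\<^sub>m n :: 'k mat) $$ (i, j)) = (\<Sum>i<n. if i = j then ext_monomial {j} else 0)"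
      unfolding ext_vec_def using that by (intro sum.cong) auto
    then show ?thesis using that by simp
  qed
  have "finite F" using assms finite_subset by blast
  then show ?thesis using assms
  proof (induction F rule: finite_linorder_min_induct)
    case (insert b F)
    moreover have "b \<notin> F" using insert.hyps(2) by auto
    ultimately show ?case
      by (simp add: ext_prod_insert_min w wedge_single ext_term_def ext_sign_min)
  qed simp
qed

lemma ext_act_one:
  assumes "a \<in> carrier (ext_ring n)" shows "ext_act n (1\<^sub>m n) a = a"
  using assms
  by (induction rule: ext_induct) (simp_all add: ext_act_add ext_act_single ext_prod_one)

lemma ext_act_closed: "ext_act n A a \<in> carrier (ext_ring n)"
proof -
  have "keys (ext_act n A a) \<subseteq> (\<Union>F\<in>keys a. keys (ext_prod n A F))"
    unfolding ext_act_alt by (rule order_trans[OF keys_sum]) (intro UN_mono subset_refl keys_pm_scale)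
  then show ?thesis
    using ext_prod_closed[of n A] unfolding ext_carrier_iff by (meson UN_E subsetD)
qed

text \<open>Each column contributes one generator, and a wedge keeps only disjoint unions.\<close>

lemma card_keys_ext_prod:
  assumes "finite F" "H \<in> keys (ext_prod n A F)"
  shows "card H = card F"
  using assms
proof (induction F arbitrary: H rule: finite_linorder_min_induct)
  case empty
  then show ?case by simp
next
  case (insert b F)
  have "b \<notin> F" using insert.hyps(2) by auto
  have "H \<in> keys (wedge (ext_vec n (\<lambda>i. A $$ (i, b))) (ext_prod n A F))"
    using insert.prems by (simp add: ext_prod_insert_min[OF insert.hyps(1,2)])
  from keys_wedge[OF this] obtain G G' where G: "G \<in> keys (ext_vec n (\<lambda>i. A $$ (i, b)))"
    "G' \<in> keys (ext_prod n A F)" "G \<inter> G' = {}" "H = G \<union> G'" by (elim bexE conjE)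
  have "keys (ext_vec n (\<lambda>i. A $$ (i, b))) \<subseteq> (\<Union>i<n. {{i}})"
    unfolding ext_vec_def by (rule order_trans[OF keys_sum]) (auto split: if_splits)
  with G(1) obtain i where "G = {i}" by auto
  moreover have "finite G'"
    using ext_prod_closed[of n A F] G(2) finite_subset[OF _ finite_lessThan] by (auto simp: ext_carrier_iff)
  ultimately show ?case
    using G(3,4) insert.IH[OF G(2)] \<open>b \<notin> F\<close> insert.hyps(1) by simp
qed

lemma card_keys_ext_act:
  assumes "\<And>F. F \<in> keys a \<Longrightarrow> finite F" "H \<in> keys (ext_act n A a)"
  shows "\<exists>F\<in>keys a. card H = card F"
proof -
  have "keys (ext_act n A a) \<subseteq> (\<Union>F\<in>keys a. keys (ext_prod n A F))"
    unfolding ext_act_alt by (rule order_trans[OF keys_sum]) (intro UN_mono subset_refl keys_pm_scale)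
  with assms(2) obtain F where "F \<in> keys a" "H \<in> keys (ext_prod n A F)"
    by (meson UN_E subsetD)
  with assms(1)[of F] card_keys_ext_prod[of F H n A] show ?thesis by auto
qed

text \<open>The Pluecker coordinate of the pair \<open>(z, z')\<close> at a two-element set, that
  is, the 2 by 2 minor in the coordinates \<open>Min F < Max F\<close>.\<close>

definition alt_form :: "(nat \<Rightarrow> 'k::field) \<Rightarrow> (nat \<Rightarrow> 'k) \<Rightarrow> nat set \<Rightarrow> 'k" where
  "alt_form z z' F = (if card F = 2 then z (Min F) * z' (Max F) - z (Max F) * z' (Min F) else 0)"

definition ext_pair :: "(nat \<Rightarrow> 'k::field) \<Rightarrow> (nat \<Rightarrow> 'k) \<Rightarrow> 'k ext \<Rightarrow> 'k" where
  "ext_pair z z' a = (\<Sum>F\<in>keys a. lookup a F * alt_form z z' F)"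

lemma ext_pair_superset:
  assumes "finite S" "keys a \<subseteq> S"
  shows "ext_pair z z' a = (\<Sum>F\<in>S. lookup a F * alt_form z z' F)"
  unfolding ext_pair_def by (rule sum.mono_neutral_left) (use assms in \<open>auto simp: in_keys_iff\<close>)

lemma ext_pair_add: "ext_pair z z' (a + b) = ext_pair z z' a + ext_pair z z' b"
proof -
  let ?S = "keys a \<union> keys b"
  have "keys (a + b) \<subseteq> ?S"
    by (rule Poly_Mapping.keys_add)
  then show ?thesis
    by (simp add: ext_pair_superset[of ?S] lookup_add algebra_simps sum.distrib)
qed

lemma ext_pair_0 [simp]: "ext_pair z z' 0 = 0"
  by (simp add: ext_pair_def)

lemma ext_pair_scale: "ext_pair z z' (pm_scale c a) = c * ext_pair z z' a"
  by (simp add: ext_pair_superset[of "keys a"] keys_pm_scale sum_distrib_left mult_ac)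

lemma ext_pair_single: "ext_pair z z' (single F c) = c * alt_form z z' F"
  by (simp add: ext_pair_superset[of "{F}"])

lemma ext_pair_sum: "ext_pair z z' (\<Sum>i\<in>I. a i) = (\<Sum>i\<in>I. ext_pair z z' (a i))"
  by (induction I rule: infinite_finite_induct) (simp_all add: ext_pair_add)

lemma alt_form_pair: "i < j \<Longrightarrow> alt_form z z' {i, j} = z i * z' j - z j * z' i"
  by (simp add: alt_form_def min_def max_def)

text \<open>The sign in \<open>ext_term\<close> and the antisymmetry of the minor compensate each
  other, so one formula covers all orders of \<open>i\<close> and \<open>j\<close>, including
  equality.\<close>

lemma ext_pair_term: "ext_pair z z' (ext_term {i} {j} c) = c * (z i * z' j - z j * z' i)"
proof (cases i j rule: linorder_cases)
  case less
  then have "alt_form z z' {j, i} = z i * z' j - z j * z' i"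
    by (metis alt_form_pair insert_commute)
  then show ?thesis
    using less by (simp add: ext_term_def ext_pair_single ext_sign_singletons)
qed (simp_all add: ext_term_def ext_pair_single ext_sign_singletons alt_form_pair algebra_simps)

text \<open>The exterior counterpart of \<open>eval_at_poly_act\<close>: on elements of degree 2 the
  action of \<open>A\<close> passes to both vectors as the transpose.\<close>

lemma ext_pair_act:
  assumes "\<And>F. F \<in> keys a \<Longrightarrow> card F = 2"
  shows "ext_pair z z' (ext_act n A a) =
    ext_pair (\<lambda>j. \<Sum>i<n. A $$ (i, j) * z i) (\<lambda>j. \<Sum>i<n. A $$ (i, j) * z' i) a"
proof -
  let ?y = "\<lambda>j. \<Sum>i<n. A $$ (i, j) * z i" and ?y' = "\<lambda>j. \<Sum>i<n. A $$ (i, j) * z' i"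
  have "ext_pair z z' (ext_prod n A F) = alt_form ?y ?y' F" if c: "card F = 2" for F
  proof -
    obtain i j where F: "F = {i, j}" "i < j"
      using c by (metis card_2_iff insert_commute linorder_neqE_nat)
    have "ext_prod n A F = wedge (ext_vec n (\<lambda>k. A $$ (k, i))) (ext_vec n (\<lambda>k. A $$ (k, j)))"
      using F ext_prod_insert_min[of "{j}" i n A] by simp
    then have "ext_pair z z' (ext_prod n A F) =
        (\<Sum>k<n. \<Sum>l<n. A $$ (k, i) * A $$ (l, j) * (z k * z' l - z l * z' k))"
      by (simp add: wedge_ext_vec ext_pair_sum ext_pair_term)
    also have "\<dots> = (\<Sum>k<n. \<Sum>l<n. (A $$ (k, i) * z k) * (A $$ (l, j) * z' l)) -
        (\<Sum>k<n. \<Sum>l<n. (A $$ (k, i) * z' k) * (A $$ (l, j) * z l))"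
      by (simp add: algebra_simps sum_subtractf)
    also have "\<dots> = ?y i * ?y' j - ?y' i * ?y j"
      by (simp add: sum_product)
    finally show ?thesis
      using F by (simp add: alt_form_pair)
  qed
  then show ?thesis
    unfolding ext_act_alt ext_pair_sum ext_pair_scale
    by (simp add: ext_pair_def[of ?y ?y'] assms)
qed

section \<open>Generic kernel vectors\<close>

lemma det_mat_nonzero_rightI:
  fixes f :: "nat \<Rightarrow> nat \<Rightarrow> 'k::field"
  assumes "\<And>x. (\<And>k. k < n \<Longrightarrow> (\<Sum>a<n. f k a * x a) = 0) \<Longrightarrow> (\<forall>a<n. x a = 0)"
  shows "det (mat n n (\<lambda>(k, a). f k a)) \<noteq> 0"
proof
  assume "det (mat n n (\<lambda>(k, a). f k a)) = 0"
  then obtain v where v: "v \<in> carrier_vec n" "v \<noteq> 0\<^sub>v n" "mat n n (\<lambda>(k, a). f k a) *\<^sub>v v = 0\<^sub>v n"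
    using det_0_iff_vec_prod_zero[of "mat n n (\<lambda>(k, a). f k a)" n] by auto
  have "(\<Sum>a<n. f k a * v $ a) = 0" if "k < n" for k
  proof -
    have "(mat n n (\<lambda>(k, a). f k a) *\<^sub>v v) $ k = (\<Sum>a<n. f k a * v $ a)"
      using v(1) that by (simp add: scalar_prod_def atLeast0LessThan)
    then show ?thesis using v(3) that by simp
  qed
  then have "\<forall>a<n. v $ a = 0" by (rule assms)
  then show False using v(1,2) by (auto intro!: eq_vecI)
qed

lemma det_mat_nonzero_leftI:
  fixes f :: "nat \<Rightarrow> nat \<Rightarrow> 'k::field"
  assumes "\<And>w. (\<And>a. a < n \<Longrightarrow> (\<Sum>k<n. w k * f k a) = 0) \<Longrightarrow> (\<forall>k<n. w k = 0)"
  shows "det (mat n n (\<lambda>(k, a). f k a)) \<noteq> 0"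
proof -
  have "det (mat n n (\<lambda>(a, k). f k a)) \<noteq> 0"
    by (rule det_mat_nonzero_rightI) (use assms in \<open>simp add: mult.commute\<close>)
  moreover have "mat n n (\<lambda>(a, k). f k a) = transpose_mat (mat n n (\<lambda>(k, a). f k a))"
    by auto
  ultimately show ?thesis
    using det_transpose[of "mat n n (\<lambda>(k, a). f k a)" n] by simp
qed

lemma det_mat_nonzero_inverse:
  fixes f :: "nat \<Rightarrow> nat \<Rightarrow> 'k::field"
  assumes "det (mat n n (\<lambda>(k, a). f k a)) \<noteq> 0"
  shows "\<exists>g. \<forall>i<n. \<forall>l<n. (\<Sum>k<n. f i k * g k l) = (if i = l then 1 else 0) \<and>
    (\<Sum>k<n. g i k * f k l) = (if i = l then 1 else 0)"
proof -
  let ?A = "mat n n (\<lambda>(k, a). f k a)"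
  have "?A \<in> GL n" using assms by (simp add: GL_iff_det)
  then obtain B where B: "B \<in> GL n" "B * ?A = 1\<^sub>m n" "?A * B = 1\<^sub>m n" by (rule GL_inverse)
  then have dims: "B \<in> carrier_mat n n" by (simp add: GL_iff_det)
  have "(\<Sum>k<n. f i k * B $$ (k, l)) = (if i = l then 1 else 0)"
    "(\<Sum>k<n. B $$ (i, k) * f k l) = (if i = l then 1 else 0)" if il: "i < n" "l < n" for i l
  proof -
    have "(?A * B) $$ (i, l) = (\<Sum>k<n. f i k * B $$ (k, l))"
      "(B * ?A) $$ (i, l) = (\<Sum>k<n. B $$ (i, k) * f k l)"
      using il dims by (auto simp: scalar_prod_def atLeast0LessThan)
    then show "(\<Sum>k<n. f i k * B $$ (k, l)) = (if i = l then 1 else 0)"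
      "(\<Sum>k<n. B $$ (i, k) * f k l) = (if i = l then 1 else 0)"
      unfolding B(2,3) using il by simp_all
  qed
  then show ?thesis by (intro exI[of _ "\<lambda>k l. B $$ (k, l)"]) simp
qed

lemma det_mat_nonzero_left:
  fixes f :: "nat \<Rightarrow> nat \<Rightarrow> 'k::field"
  assumes "det (mat n n (\<lambda>(k, a). f k a)) \<noteq> 0"
  shows "(\<And>a. a < n \<Longrightarrow> (\<Sum>k<n. w k * f k a) = 0) \<Longrightarrow> k < n \<Longrightarrow> w k = 0"
    and "\<exists>w. \<forall>a<n. (\<Sum>k<n. w k * f k a) = b a"
proof -
  obtain g where "\<forall>i<n. \<forall>l<n. (\<Sum>k<n. f i k * g k l) = (if i = l then 1 else 0) \<and>
      (\<Sum>k<n. g i k * f k l) = (if i = l then 1 else 0)"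
    using det_mat_nonzero_inverse[OF assms] ..
  then have g: "\<And>i l. i < n \<Longrightarrow> l < n \<Longrightarrow> (\<Sum>k<n. f i k * g k l) = (if i = l then 1 else 0)"
    "\<And>i l. i < n \<Longrightarrow> l < n \<Longrightarrow> (\<Sum>k<n. g i k * f k l) = (if i = l then 1 else 0)"
    by simp_all
  show "w k = 0" if w: "\<And>a. a < n \<Longrightarrow> (\<Sum>k<n. w k * f k a) = 0" and k: "k < n"
  proof -
    have "0 = (\<Sum>a<n. (\<Sum>i<n. w i * f i a) * g a k)" using w by simp
    also have "\<dots> = (\<Sum>i<n. w i * (\<Sum>a<n. f i a * g a k))"
      by (simp add: sum_distrib_right sum_distrib_left mult.assoc) (rule sum.swap)
    also have "\<dots> = (\<Sum>i<n. if i = k then w i else 0)"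
      using k by (intro sum.cong) (simp_all add: g(1))
    finally show ?thesis using k by simp
  qed
  have "(\<Sum>k<n. (\<Sum>c<n. b c * g c k) * f k a) = b a" if "a < n" for a
  proof -
    have "(\<Sum>k<n. (\<Sum>c<n. b c * g c k) * f k a) = (\<Sum>c<n. b c * (\<Sum>k<n. g c k * f k a))"
      by (simp add: sum_distrib_right sum_distrib_left mult.assoc) (rule sum.swap)
    also have "\<dots> = (\<Sum>c<n. if c = a then b c else 0)"
      using that by (intro sum.cong) (simp_all add: g(2))
    finally show ?thesis using that by simp
  qed
  then show "\<exists>w. \<forall>a<n. (\<Sum>k<n. w k * f k a) = b a"
    by (intro exI[of _ "\<lambda>k. \<Sum>c<n. b c * g c k"]) simp
qed

text \<open>The rows combine to evaluations of all polynomials of degree below \<open>t\<close>. The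
  polynomial that vanishes at every node of \<open>T\<close> except \<open>a\<close> has degree
  \<open>card T - 1\<close> and isolates \<open>x a\<close>.\<close>

lemma vandermonde_kernel:
  fixes x :: "nat \<Rightarrow> 'k::field_char_0"
  assumes "finite T" "card T \<le> t" and ker: "\<And>r. r < t \<Longrightarrow> (\<Sum>a\<in>T. of_nat a ^ r * x a) = 0" and a: "a \<in> T"
  shows "x a = 0"
proof -
  have *: "(\<Sum>b\<in>T. poly p (of_nat b) * x b) = 0" if "degree p < t" for p
  proof -
    have "(\<Sum>b\<in>T. poly p (of_nat b) * x b) = (\<Sum>b\<in>T. \<Sum>r\<le>degree p. coeff p r * (of_nat b ^ r * x b))"
      by (simp add: poly_altdef sum_distrib_right mult.assoc)
    also have "\<dots> = (\<Sum>r\<le>degree p. coeff p r * (\<Sum>b\<in>T. of_nat b ^ r * x b))"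
      by (subst sum.swap) (simp add: sum_distrib_left)
    also have "\<dots> = 0" using that ker by (intro sum.neutral) simp
    finally show ?thesis .
  qed
  define p where "p = (\<Prod>b\<in>T - {a}. [:- of_nat b, 1:] :: 'k poly)"
  have "degree p \<le> (\<Sum>b\<in>T - {a}. degree [:- of_nat b, 1 :: 'k:])"
    unfolding p_def using degree_prod_sum_le[of "T - {a}" "\<lambda>b. [:- of_nat b, 1 :: 'k:]"] assms(1)
    by (simp add: comp_def)
  also have "\<dots> = card T - 1" using a assms(1) by simp
  also have "\<dots> < t" using assms(1,2) a card_gt_0_iff[of T] by auto
  finally have "(\<Sum>b\<in>T. poly p (of_nat b) * x b) = 0" by (rule *)
  moreover have "poly p (of_nat b) = 0" if "b \<in> T - {a}" for b
    using that assms(1) by (auto simp: p_def poly_prod)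
  then have "(\<Sum>b\<in>T - {a}. poly p (of_nat b) * x b) = 0" by (intro sum.neutral) simp
  ultimately have "poly p (of_nat a) * x a = 0"
    using sum.remove[OF assms(1) a, of "\<lambda>b. poly p (of_nat b) * x b"] by simp
  moreover have "poly p (of_nat a) \<noteq> 0"
    using assms(1) by (simp add: p_def poly_prod)
  ultimately show ?thesis by simp
qed

text \<open>When \<open>F\<close> has \<open>n - j\<close> elements, the first \<open>j\<close> rows
  outside the columns \<open>F\<close> form a square block. Its invertibility is recorded twice:
  injectivity will give a nonzero last coordinate, surjectivity the second vector of an exterior
  pair.\<close>

definition regular_rows :: "nat \<Rightarrow> nat \<Rightarrow> nat set \<Rightarrow> 'k::field mat \<Rightarrow> bool" where
  "regular_rows n j F A \<longleftrightarrow>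
    (\<forall>w. (\<forall>a<n. a \<notin> F \<longrightarrow> (\<Sum>k<j. A $$ (k, a) * w k) = 0) \<longrightarrow> (\<forall>k<j. w k = 0)) \<and>
    (\<forall>b. \<exists>w. \<forall>a<n. a \<notin> F \<longrightarrow> (\<Sum>k<j. A $$ (k, a) * w k) = b a)"

text \<open>With \<open>n - j\<close> columns in \<open>F v\<close> there are \<open>j\<close>
  equations for \<open>j + 1\<close> unknowns, so one kernel vector is expected for each
  \<open>v\<close>. The last clause says that the vectors, cut down to their last
  \<open>card S\<close> coordinates, span the whole space: no nonzero functional kills them.\<close>

definition kernel_family ::
  "nat \<Rightarrow> nat \<Rightarrow> nat set \<Rightarrow> (nat \<Rightarrow> nat set) \<Rightarrow> 'k::field mat \<Rightarrow> (nat \<Rightarrow> nat \<Rightarrow> 'k) \<Rightarrow> bool" where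
  "kernel_family n j S F A z \<longleftrightarrow>
    (\<forall>v\<in>S. \<forall>a<n. a \<notin> F v \<longrightarrow> (\<Sum>k<Suc j. A $$ (k, a) * z v k) = 0) \<and>
    (\<forall>v\<in>S. \<exists>k<Suc j. z v k \<noteq> 0) \<and>
    (\<forall>\<alpha>. (\<forall>v\<in>S. (\<Sum>k<card S. \<alpha> k * z v (Suc j - card S + k)) = 0) \<longrightarrow> (\<forall>k<card S. \<alpha> k = 0))"

lemma generic_minor:
  assumes "F \<subseteq> {..<n}" "card F = n - j" "j \<le> n"
  shows "\<exists>\<phi>. nonzero_polyfun n \<phi> \<and> (\<forall>A::'k::field mat. \<phi> A \<noteq> 0 \<longrightarrow> regular_rows n j F A)"
proof -
  define L where "L = sorted_list_of_set ({..<n} - F)"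
  have fF: "finite F" using assms(1) finite_subset by blast
  have L: "set L = {..<n} - F" "distinct L" "length L = j"
    using assms fF by (auto simp: L_def card_Diff_subset)
  define \<phi> where "\<phi> A = det (mat j j (\<lambda>(i, c). A $$ (i, L ! c)))" for A :: "'k mat"
  have Ln: "L ! c < n" if "c < j" for c using L that nth_mem[of c L] by auto
  have "polyfun n \<phi>"
    unfolding \<phi>_def using assms(3) Ln by (intro polyfun_det polyfun_entry) auto
  \<comment> \<open>A matrix whose chosen minor is the identity shows that the determinant is not
    identically 0.\<close>
  moreover have "\<phi> (mat n n (\<lambda>(i, a). if i < j \<and> a = L ! i then 1 else 0)) \<noteq> 0"
  proof -
    have eq: "mat j j (\<lambda>(i, c). mat n n (\<lambda>(i, a). if i < j \<and> a = L ! i then 1 else 0) $$ (i, L ! c)) = 1\<^sub>m j"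
      using Ln assms(3) L(2,3) by (auto intro!: eq_matI simp: nth_eq_iff_index_eq)
    show ?thesis unfolding \<phi>_def eq by simp
  qed
  ultimately have nz: "nonzero_polyfun n \<phi>"
    unfolding nonzero_polyfun_def by (meson mat_carrier)
  \<comment> \<open>Conditions on the columns outside \<open>F\<close> are translated into
    conditions on positions in the list \<open>L\<close>, which index the square block.\<close>
  have conv: "(\<forall>a<n. a \<notin> F \<longrightarrow> Q a) \<longleftrightarrow> (\<forall>c<j. Q (L ! c))" for Q
  proof -
    have "(\<forall>a<n. a \<notin> F \<longrightarrow> Q a) \<longleftrightarrow> (\<forall>a\<in>set L. Q a)" by (auto simp: L(1))
    then show ?thesis by (simp add: all_set_conv_all_nth L(3))
  qed
  have 1: "w k = 0" if d: "\<phi> A \<noteq> 0" and w: "\<forall>a<n. a \<notin> F \<longrightarrow> (\<Sum>k<j. A $$ (k, a) * w k) = 0" and k: "k < j" for A w k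
  proof (rule det_mat_nonzero_left(1)[OF d[unfolded \<phi>_def] _ k])
    fix c assume "c < j"
    then show "(\<Sum>k<j. w k * A $$ (k, L ! c)) = 0"
      using w unfolding conv by (simp add: mult.commute)
  qed
  have 2: "\<exists>w. \<forall>a<n. a \<notin> F \<longrightarrow> (\<Sum>k<j. A $$ (k, a) * w k) = b a" if d: "\<phi> A \<noteq> 0" for A b
    unfolding conv using det_mat_nonzero_left(2)[OF d[unfolded \<phi>_def], of "\<lambda>c. b (L ! c)"]
    by (simp add: mult.commute)
  show ?thesis
    unfolding regular_rows_def
    by (intro exI[of _ \<phi>] conjI allI impI) (fact nz, (rule 1; assumption), (rule 2; assumption))
qed

text \<open>The hypothesis on \<open>pos\<close> makes the supports \<open>F v\<close> triangular:
  \<open>v\<close> is the last element of its own set, so it belongs to no \<open>F u\<close> of an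
  earlier \<open>u\<close>.\<close>

lemma generic_kernel_vectors:
  fixes F :: "nat \<Rightarrow> nat set" and pos :: "nat \<Rightarrow> nat"
  assumes jn: "j < n" and S': "S \<subseteq> {..<n}" "card S \<le> Suc j"
    and F: "\<And>v. v \<in> S \<Longrightarrow> v \<in> F v \<and> F v \<subseteq> {..<n} \<and> card (F v) = n - j"
    and pos: "inj_on pos {..<n}" "\<And>v a. v \<in> S \<Longrightarrow> a \<in> F v \<Longrightarrow> a \<noteq> v \<Longrightarrow> pos a < pos v"
  shows "\<exists>\<phi>. nonzero_polyfun n \<phi> \<and>
    (\<forall>A::'k::field_char_0 mat. \<phi> A \<noteq> 0 \<longrightarrow> (\<exists>z. kernel_family n j S F A z))"
proof -
  define s where "s = card S"
  have S: "S \<subseteq> {..<n}" "card S = s" "s \<le> Suc j" using S' by (simp_all add: s_def)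
  define t where "t = n - Suc j"
  define N where "N v = F v - {v}" for v
  define L where "L v = sorted_list_of_set ({..<n} - N v)" for v
  have finS: "finite S" using S(1) finite_subset by blast
  have finF: "finite (F v)" if "v \<in> S" for v using F[OF that] finite_subset by blast
  have cN: "card (N v) = t" "N v \<subseteq> {..<n}" "finite (N v)" if "v \<in> S" for v
    using F[OF that] finF[OF that] by (auto simp: N_def t_def)
  have L: "set (L v) = {..<n} - N v" "distinct (L v)" "length (L v) = Suc j" if "v \<in> S" for v
    using cN[OF that] jn by (auto simp: L_def card_Diff_subset t_def)
  have Ln: "L v ! c < n" if "v \<in> S" "c < Suc j" for v c
    using L[OF that(1)] that(2) nth_mem[of c "L v"] by auto
  have "\<forall>v\<in>S. \<exists>c<Suc j. L v ! c = v"
  proof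
    fix v assume v: "v \<in> S"
    then have "v \<in> set (L v)" using L(1)[OF v] S(1) by (auto simp: N_def)
    then show "\<exists>c<Suc j. L v ! c = v" using L(3)[OF v] by (auto simp: in_set_conv_nth)
  qed
  then obtain ci where ci: "\<And>v. v \<in> S \<Longrightarrow> ci v < Suc j" "\<And>v. v \<in> S \<Longrightarrow> L v ! ci v = v"
    by metis
  \<comment> \<open>Adjoining column \<open>v\<close> to the columns outside \<open>F v\<close>
    gives a square block of size \<open>j + 1\<close>. The row of its adjugate that belongs to
    \<open>v\<close> annihilates every other column of the block and pairs with column
    \<open>v\<close> to the determinant.\<close>
  define B where "B v A = mat (Suc j) (Suc j) (\<lambda>(i, c). A $$ (i, L v ! c))" for v and A :: "'k mat"
  define z where "z A v k = adj_mat (B v A) $$ (ci v, k)" for A v k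
  have BL: "(\<Sum>k<Suc j. A $$ (k, L v ! c) * z A v k) = (if c = ci v then det (B v A) else 0)"
    if v: "v \<in> S" and c: "c < Suc j" for v c A
  proof -
    have carr: "B v A \<in> carrier_mat (Suc j) (Suc j)" by (simp add: B_def)
    have "(adj_mat (B v A) * B v A) $$ (ci v, c) = (\<Sum>k<Suc j. adj_mat (B v A) $$ (ci v, k) * B v A $$ (k, c))"
      using adj_mat(1)[OF carr] carr ci(1)[OF v] c by (simp add: scalar_prod_def atLeast0LessThan)
    also have "\<dots> = (\<Sum>k<Suc j. A $$ (k, L v ! c) * z A v k)"
      using c by (intro sum.cong) (auto simp: B_def z_def)
    finally show ?thesis
      unfolding adj_mat(3)[OF carr] using ci(1)[OF v] c by auto
  qed
  have x_out: "(\<Sum>k<Suc j. A $$ (k, a) * z A v k) = 0" if v: "v \<in> S" and a: "a < n" "a \<notin> F v" for v a A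
  proof -
    have "a \<in> set (L v)" using L(1)[OF v] a by (auto simp: N_def)
    then obtain c where c: "c < Suc j" "L v ! c = a" using L(3)[OF v] by (auto simp: in_set_conv_nth)
    moreover have "c \<noteq> ci v" using c(2) ci(2)[OF v] a(2) F[OF v] by auto
    ultimately show ?thesis using BL[OF v c(1)] by simp
  qed
  have x_self: "(\<Sum>k<Suc j. A $$ (k, v) * z A v k) = det (B v A)" if v: "v \<in> S" for v A
    using BL[OF v ci(1)[OF v]] ci(2)[OF v] by simp
  define Ls where "Ls = sorted_list_of_set S"
  have Ls: "set Ls = S" "distinct Ls" "length Ls = s"
    using finS S(2) by (auto simp: Ls_def)
  have LsS: "Ls ! i \<in> S" if "i < s" for i using Ls that nth_mem by blast
  \<comment> \<open>The first factor is the independence of the truncated vectors, the others ensure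
    that no kernel vector is 0.\<close>
  define \<phi> where "\<phi> A = det (mat s s (\<lambda>(k, i). z A (Ls ! i) (Suc j - s + k))) * (\<Prod>v\<in>S. det (B v A))" for A
  have "polyfun n \<phi>"
    unfolding \<phi>_def
  proof (intro polyfun_mult polyfun_prod polyfun_det)
    fix k i assume "k < s" "i < s"
    then show "polyfun n (\<lambda>A. z A (Ls ! i) (Suc j - s + k))"
      unfolding z_def B_def using S(3) ci(1)[OF LsS] jn Ln[OF LsS]
      by (intro polyfun_adj_mat polyfun_entry) auto
  next
    fix v assume "v \<in> S"
    then show "polyfun n (\<lambda>A. det (B v A))"
      unfolding B_def using Ln jn by (intro polyfun_det polyfun_entry) auto
  qed
  moreover have "\<exists>A\<in>carrier_mat n n. \<phi> A \<noteq> 0"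
  proof -
    \<comment> \<open>Since \<open>card S \<le> j + 1\<close>, there is room outside
      \<open>S\<close> for \<open>t = n - 1 - j\<close> vertices. Leaving these out keeps exactly
      \<open>j + 1\<close> coordinates, among them all of \<open>S\<close>.\<close>
    have "t \<le> card ({..<n} - S)" using S finS by (simp add: card_Diff_subset t_def)
    then obtain T where T: "T \<subseteq> {..<n} - S" "card T = t" "finite T"
      by (rule obtain_subset_with_card_n)
    define R where "R = {..<n} - S - T"
    have cR: "card R = Suc j - s" unfolding R_def
      using T S finS jn card_Diff_subset[of T "{..<n} - S"] by (simp add: card_Diff_subset t_def)
    \<comment> \<open>The vertices of \<open>S\<close> come last, so that the last \<open>s\<close>
      coordinates of a vector are its values on \<open>S\<close>.\<close>
    define Q where "Q = sorted_list_of_set R @ Ls"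
    have Q: "set Q = {..<n} - T" "length Q = Suc j"
      using T(1) S cR Ls by (auto simp: Q_def R_def)
    have Q_Ls: "Q ! (Suc j - s + k) = Ls ! k" for k
      using cR by (simp add: Q_def nth_append)
    have Qn: "Q ! k < n" if "k < Suc j" for k using Q that nth_mem[of k Q] by auto
    \<comment> \<open>The transpose of \<open>Y\<inverse>\<close> is a nonzero of the determinant: its kernel vectors are \<open>Y x\<close> with \<open>x\<close>
      supported on \<open>F v\<close> and annihilated by the Vandermonde rows, and their coordinates
      \<open>Suc j - s, \<dots>, j\<close>, namely \<open>x u\<close> for \<open>u \<in> S\<close>, form a triangular matrix with respect to \<open>pos\<close>.\<close>
    define Y where "Y k a = (if k < Suc j then (if a = Q ! k then 1 else 0) else of_nat a ^ (k - Suc j) :: 'k)" for k a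
    have Y_Q: "(\<Sum>a<n. Y k a * x a) = x (Q ! k)" if "k < Suc j" for k x
    proof -
      have "(\<Sum>a<n. Y k a * x a) = (\<Sum>a<n. if a = Q ! k then x a else 0)"
        using that by (intro sum.cong) (auto simp: Y_def)
      then show ?thesis using Qn[OF that] by simp
    qed
    have Y_V: "(\<Sum>a<n. of_nat a ^ r * x a) = 0" if "\<And>k. k < n \<Longrightarrow> Suc j \<le> k \<Longrightarrow> (\<Sum>a<n. Y k a * x a) = 0" "r < t" for x r
      using that(1)[of "Suc j + r"] that(2) by (simp add: Y_def t_def)
    \<comment> \<open>A vector killed by the \<open>t\<close> Vandermonde rows and supported on at
      most \<open>t\<close> columns is 0; this is used for \<open>T\<close> and for every
      \<open>N v\<close>.\<close>
    have supp: "x a = 0" if V: "\<And>r. r < t \<Longrightarrow> (\<Sum>a<n. of_nat a ^ r * x a) = 0" and T': "T' \<subseteq> {..<n}" "card T' \<le> t"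
      and out: "\<And>a. a < n \<Longrightarrow> a \<notin> T' \<Longrightarrow> x a = 0" and a: "a < n" for x :: "nat \<Rightarrow> 'k" and T' a
    proof (cases "a \<in> T'")
      case True
      have "finite T'" using T'(1) finite_subset by blast
      moreover have "(\<Sum>a\<in>T'. of_nat a ^ r * x a) = 0" if "r < t" for r
      proof -
        have "(\<Sum>a\<in>T'. of_nat a ^ r * x a) = (\<Sum>a<n. of_nat a ^ r * x a)"
          using T'(1) out by (intro sum.mono_neutral_left) auto
        then show ?thesis using V[OF that] by simp
      qed
      ultimately show ?thesis using vandermonde_kernel[OF _ T'(2) _ True] by blast
    qed (simp add: out a)
    have detY: "det (mat n n (\<lambda>(k, a). Y k a)) \<noteq> 0"
    proof (rule det_mat_nonzero_rightI, intro allI impI)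
      fix x a assume x: "\<And>k. k < n \<Longrightarrow> (\<Sum>a<n. Y k a * x a) = 0" and a: "a < n"
      show "x a = 0"
      proof (rule supp[of x T])
        show "(\<Sum>a<n. of_nat a ^ r * x a) = 0" if "r < t" for r
          by (rule Y_V[OF _ that]) (rule x)
        fix b assume "b < n" "b \<notin> T"
        then have "b \<in> set Q" using Q by simp
        then obtain k where "k < Suc j" "Q ! k = b" using Q(2) by (auto simp: in_set_conv_nth)
        then show "x b = 0" using Y_Q[of k x] x[of k] jn by simp
      qed (use T a in auto)
    qed
    obtain g where "\<forall>i<n. \<forall>l<n. (\<Sum>k<n. Y i k * g k l) = (if i = l then 1 else 0) \<and>
        (\<Sum>k<n. g i k * Y k l) = (if i = l then 1 else 0)"
      using det_mat_nonzero_inverse[OF detY] ..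
    then have g: "\<And>i l. i < n \<Longrightarrow> l < n \<Longrightarrow> (\<Sum>k<n. Y i k * g k l) = (if i = l then 1 else 0)"
      by simp
    define A where "A = mat n n (\<lambda>(k, a). g a k)"
    have A_Y: "(\<Sum>a<n. Y l a * (\<Sum>k<Suc j. A $$ (k, a) * w k)) = (if l < Suc j then w l else 0)" if "l < n" for l w
    proof -
      have "(\<Sum>a<n. Y l a * (\<Sum>k<Suc j. A $$ (k, a) * w k)) = (\<Sum>a<n. \<Sum>k<Suc j. Y l a * g a k * w k)"
        unfolding sum_distrib_left using jn by (intro sum.cong refl) (auto simp: A_def mult.assoc)
      also have "\<dots> = (\<Sum>k<Suc j. (\<Sum>a<n. Y l a * g a k) * w k)"
        by (subst sum.swap) (simp only: sum_distrib_right)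
      also have "\<dots> = (\<Sum>k<Suc j. if k = l then w k else 0)"
        using that jn by (intro sum.cong) (auto simp: g)
      finally show ?thesis by simp
    qed
    have A_Q: "(\<Sum>k<Suc j. A $$ (k, Q ! l) * w k) = w l" if "l < Suc j" for l w
      using A_Y[of l w] Y_Q[OF that, of "\<lambda>a. \<Sum>k<Suc j. A $$ (k, a) * w k"] that jn by simp
    have A_V: "(\<Sum>a<n. of_nat a ^ r * (\<Sum>k<Suc j. A $$ (k, a) * w k)) = 0" if "r < t" for r w
      by (rule Y_V[OF _ that]) (simp add: A_Y del: sum.lessThan_Suc)
    \<comment> \<open>A left kernel vector of the block maps to a vector supported on
      \<open>N v\<close>, which has only \<open>t\<close> elements, so \<open>supp\<close>
      applies.\<close>
    have detB: "det (B v A) \<noteq> 0" if v: "v \<in> S" for v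
      unfolding B_def
    proof (rule det_mat_nonzero_leftI, intro allI impI)
      fix w l assume w: "\<And>c. c < Suc j \<Longrightarrow> (\<Sum>k<Suc j. w k * A $$ (k, L v ! c)) = 0" and l: "l < Suc j"
      have "(\<Sum>k<Suc j. A $$ (k, Q ! l) * w k) = 0"
      proof (rule supp[of "\<lambda>a. \<Sum>k<Suc j. A $$ (k, a) * w k" "N v"])
        fix a assume "a < n" "a \<notin> N v"
        then have "a \<in> set (L v)" using L(1)[OF v] by simp
        then obtain c where "c < Suc j" "L v ! c = a" using L(3)[OF v] by (auto simp: in_set_conv_nth)
        then show "(\<Sum>k<Suc j. A $$ (k, a) * w k) = 0"
          using w[of c] by (simp add: mult.commute del: sum.lessThan_Suc)
      qed (use A_V cN[OF v] Qn[OF l] in auto)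
      then show "w l = 0" using A_Q[OF l] by simp
    qed
    have "det (mat s s (\<lambda>(k, i). z A (Ls ! i) (Suc j - s + k))) \<noteq> 0"
    proof (rule det_mat_nonzero_rightI, rule ccontr)
      fix \<beta> assume \<beta>: "\<And>k. k < s \<Longrightarrow> (\<Sum>i<s. z A (Ls ! i) (Suc j - s + k) * \<beta> i) = 0"
        and nonzero: "\<not> (\<forall>i<s. \<beta> i = 0)"
      \<comment> \<open>In a relation the vertex that is last with respect to \<open>pos\<close> is
        examined: the other vectors in the relation vanish at this coordinate, and its own value
        there is a nonzero determinant.\<close>
      define I where "I = {i. i < s \<and> \<beta> i \<noteq> 0}"
      have I: "finite I" "I \<noteq> {}" using nonzero by (auto simp: I_def)
      have "Max ((\<lambda>i. pos (Ls ! i)) ` I) \<in> (\<lambda>i. pos (Ls ! i)) ` I" using I by (intro Max_in) auto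
      then obtain m where m: "m \<in> I" "pos (Ls ! m) = Max ((\<lambda>i. pos (Ls ! i)) ` I)" by auto
      have m_max: "pos (Ls ! i) \<le> pos (Ls ! m)" if "i \<in> I" for i using I(1) that m(2) by simp
      have ms: "m < s" "\<beta> m \<noteq> 0" using m(1) by (auto simp: I_def)
      have zx: "z A (Ls ! i) (Suc j - s + k) = (\<Sum>l<Suc j. A $$ (l, Ls ! k) * z A (Ls ! i) l)" if "k < s" for i k
        using A_Q[of "Suc j - s + k" "z A (Ls ! i)"] that S(3) Q_Ls by simp
      have "z A (Ls ! i) (Suc j - s + m) * \<beta> i = 0" if i: "i \<in> {..<s} - {m}" for i
      proof (cases "\<beta> i = 0")
        case False
        then have iI: "i \<in> I" using i by (simp add: I_def)
        have neq: "Ls ! i \<noteq> Ls ! m" using Ls i ms by (auto simp: nth_eq_iff_index_eq)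
        then have "pos (Ls ! i) \<noteq> pos (Ls ! m)"
          using inj_onD[OF pos(1), of "Ls ! i" "Ls ! m"] LsS i ms S(1) by auto
        then have "pos (Ls ! i) < pos (Ls ! m)" using m_max[OF iI] by simp
        then have "Ls ! m \<notin> F (Ls ! i)" using pos(2)[OF LsS, of i "Ls ! m"] neq i by auto
        then have "(\<Sum>l<Suc j. A $$ (l, Ls ! m) * z A (Ls ! i) l) = 0"
          using i LsS ms S(1) by (intro x_out) auto
        then show ?thesis using zx[OF ms(1)] by simp
      qed simp
      then have "(\<Sum>i\<in>{..<s} - {m}. z A (Ls ! i) (Suc j - s + m) * \<beta> i) = 0"
        by (rule sum.neutral[OF ballI])
      then have "z A (Ls ! m) (Suc j - s + m) * \<beta> m = 0"
        using \<beta>[OF ms(1)] ms(1) sum.remove[of "{..<s}" m "\<lambda>i. z A (Ls ! i) (Suc j - s + m) * \<beta> i"] by simp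
      moreover have "z A (Ls ! m) (Suc j - s + m) = det (B (Ls ! m) A)"
        using zx[OF ms(1)] x_self[OF LsS[OF ms(1)]] by simp
      ultimately show False using detB[OF LsS[OF ms(1)]] ms(2) by simp
    qed
    moreover have "(\<Prod>v\<in>S. det (B v A)) \<noteq> 0" using detB finS by simp
    moreover have "A \<in> carrier_mat n n" by (simp add: A_def)
    ultimately show ?thesis unfolding \<phi>_def by (intro bexI[of _ A]) simp_all
  qed
  ultimately have nz: "nonzero_polyfun n \<phi>" by (simp add: nonzero_polyfun_def)
  have ex: "\<exists>z. (\<forall>v\<in>S. \<forall>a<n. a \<notin> F v \<longrightarrow> (\<Sum>k<Suc j. A $$ (k, a) * z v k) = 0) \<and>
      (\<forall>v\<in>S. \<exists>k<Suc j. z v k \<noteq> 0) \<and>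
      (\<forall>\<alpha>. (\<forall>v\<in>S. (\<Sum>k<s. \<alpha> k * z v (Suc j - s + k)) = 0) \<longrightarrow> (\<forall>k<s. \<alpha> k = 0))"
    if A: "\<phi> A \<noteq> 0" for A
  proof (intro exI[of _ "z A"] conjI ballI allI impI)
    fix v a assume "v \<in> S" "a < n" "a \<notin> F v"
    then show "(\<Sum>k<Suc j. A $$ (k, a) * z A v k) = 0" by (rule x_out)
  next
    fix v assume v: "v \<in> S"
    then have "det (B v A) \<noteq> 0" using A finS by (auto simp: \<phi>_def)
    then have "(\<Sum>k<Suc j. A $$ (k, v) * z A v k) \<noteq> 0" by (simp only: x_self[OF v]) simp
    then obtain k where "k \<in> {..<Suc j}" "A $$ (k, v) * z A v k \<noteq> 0"
      by (rule sum.not_neutral_contains_not_neutral)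
    then show "\<exists>k<Suc j. z A v k \<noteq> 0" by auto
  next
    fix \<alpha> k assume h: "\<forall>v\<in>S. (\<Sum>k<s. \<alpha> k * z A v (Suc j - s + k)) = 0" and k: "k < s"
    have d: "det (mat s s (\<lambda>(k, i). z A (Ls ! i) (Suc j - s + k))) \<noteq> 0"
      using A by (auto simp: \<phi>_def)
    show "\<alpha> k = 0"
      by (rule det_mat_nonzero_left(1)[OF d _ k]) (use h LsS in blast)
  qed
  show ?thesis
    unfolding kernel_family_def S(2)
    by (intro exI[of _ \<phi>] conjI allI impI) (fact nz, rule ex)
qed

section \<open>Perfect elimination orders\<close>

definition simplicial_vertex :: "nat set set \<Rightarrow> nat set \<Rightarrow> nat \<Rightarrow> bool" where
  "simplicial_vertex E W u \<longleftrightarrow> u \<in> W \<and>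
     (\<forall>a\<in>W. \<forall>b\<in>W. {u, a} \<in> E \<longrightarrow> {u, b} \<in> E \<longrightarrow> a \<noteq> b \<longrightarrow> {a, b} \<in> E)"

text \<open>An induced path with at least three vertices, closed up by a vertex adjacent to its two
  ends only, is a chordless cycle of length at least 4.\<close>

lemma chordal_no_induced_cycle:
  assumes chordal: "chordal E" and loops: "\<And>v. {v} \<notin> E"
    and q: "successively (\<lambda>a b. {a, b} \<in> E) q" "distinct q" "length q \<ge> 3"
    and x: "\<And>i. i < length q \<Longrightarrow> {x, q ! i} \<in> E \<longleftrightarrow> i = 0 \<or> Suc i = length q"
    and x': "x \<notin> set q"
    and induced: "\<And>i j. i < j \<Longrightarrow> j < length q \<Longrightarrow> {q ! i, q ! j} \<in> E \<Longrightarrow> j = Suc i"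
  shows False
proof -
  let ?m = "length q"
  have cyc: "is_cycle E (x # q)"
    unfolding is_cycle_def
  proof (intro conjI allI impI)
    fix i assume i: "i < length (x # q)"
    show "{(x # q) ! i, (x # q) ! (Suc i mod length (x # q))} \<in> E"
    proof (cases i)
      case 0
      then show ?thesis using x[of 0] q(3) by (cases q) auto
    next
      case (Suc k)
      show ?thesis
      proof (cases "Suc k = ?m")
        case True
        have "(x # q) ! i = q ! k" by (simp only: Suc nth_Cons_Suc)
        moreover have "Suc i mod length (x # q) = 0" using True Suc by simp
        moreover have "{q ! k, x} \<in> E" using x[of k] True by (simp add: insert_commute)
        ultimately show ?thesis by (simp only: nth_Cons_0)
      next
        case False
        then have "Suc k < ?m" using i Suc by simp
        then show ?thesis using q(1) Suc by (simp add: successively_conv_nth)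
      qed
    qed
  qed (use q x' in auto)
  then have "has_chord E (x # q)"
    using chordal q(3) unfolding chordal_def by simp
  then obtain i j where ij: "i \<le> ?m" "j \<le> ?m" "i \<noteq> j" "j \<noteq> Suc i mod Suc ?m" "i \<noteq> Suc j mod Suc ?m"
    "{(x # q) ! i, (x # q) ! j} \<in> E"
    unfolding has_chord_def by (auto simp: less_Suc_eq_le)
  \<comment> \<open>Chords are symmetric, so \<open>i < j\<close> may be assumed; index 0 stands for
    \<open>x\<close>, all other indices for path vertices shifted by one.\<close>
  have *: False if h: "i < j" "j \<le> ?m" "j \<noteq> Suc i mod Suc ?m" "i \<noteq> Suc j mod Suc ?m"
    "{(x # q) ! i, (x # q) ! j} \<in> E" for i j
  proof (cases i)
    case 0
    then have "{x, q ! (j - 1)} \<in> E" using h(1,5) by (cases j) auto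
    then have "j - 1 = 0 \<or> Suc (j - 1) = ?m"
      using x[of "j - 1"] h(1,2) by simp
    moreover have "q \<noteq> []" using q(3) by auto
    ultimately show False using 0 h by auto
  next
    case (Suc k)
    then obtain l where l: "j = Suc l" "k < l" using h(1) by (cases j) auto
    then have "l = Suc k"
      using induced[of k l] h(2,5) Suc by simp
    then show False using h(2,3) Suc l by simp
  qed
  show False
  proof (cases "i < j")
    case True
    then show False using *[OF True ij(2,4,5,6)] by simp
  next
    case False
    then have "j < i" using ij(3) by simp
    then show False using *[of j i] ij by (simp add: insert_commute)
  qed
qed

text \<open>Dirac's argument: let \<open>C\<close> be the component of \<open>y\<close> among the non-neighbours of \<open>x\<close> and \<open>S\<close> the set
  of its neighbours. A shortest path through \<open>C\<close> between two non-adjacent vertices of \<open>S\<close> would close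
  up with \<open>x\<close> to a chordless cycle, so \<open>S\<close> is a clique, and induction applies to \<open>C \<union> S\<close>.\<close>

lemma ex_simplicial_nonneighbour:
  assumes chordal: "chordal E" and loops: "\<And>v. {v} \<notin> E" and "finite W"
    and "x \<in> W" "y \<in> W" "y \<noteq> x" "{x, y} \<notin> E"
  shows "\<exists>u. u \<noteq> x \<and> {x, u} \<notin> E \<and> simplicial_vertex E W u"
  using assms(3-)
proof (induction "card W" arbitrary: W x y rule: less_induct)
  case less
  define U where "U = {c \<in> W. c \<noteq> x \<and> {x, c} \<notin> E}"
  define R where "R = {(a, b). a \<in> U \<and> b \<in> U \<and> {a, b} \<in> E}"
  define C where "C = {c. (y, c) \<in> R\<^sup>*}"
  define S where "S = {s \<in> W. {x, s} \<in> E \<and> (\<exists>c\<in>C. {s, c} \<in> E)}"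
  define H where "H = C \<union> S"
  have yC: "y \<in> C" by (simp add: C_def)
  have CU: "C \<subseteq> U"
  proof
    fix c assume "c \<in> C"
    then have "(y, c) \<in> R\<^sup>*" by (simp add: C_def)
    then show "c \<in> U"
      using less.prems by (induction rule: rtrancl_induct) (auto simp: U_def R_def)
  qed
  have CW: "C \<subseteq> W" using CU by (auto simp: U_def)
  have xC: "{x, c} \<notin> E" "c \<noteq> x" "c \<in> U" if "c \<in> C" for c
    using CU that by (auto simp: U_def)
  have SC: "s \<notin> C" if "s \<in> S" for s
    using that xC(1) by (auto simp: S_def)
  have xH: "x \<notin> H"
    using xC(2) loops by (auto simp: H_def S_def)
  have C_step: "b \<in> C" if "a \<in> C" "b \<in> U" "{a, b} \<in> E" for a b
  proof -
    have "(a, b) \<in> R" using that xC(3) by (simp add: R_def)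
    then show ?thesis using that(1) by (auto simp: C_def intro: rtrancl_into_rtrancl)
  qed
  have C_nbrs: "w \<in> H" if "c \<in> C" "w \<in> W" "{c, w} \<in> E" for c w
  proof (cases "w \<in> U")
    case True
    then show ?thesis using C_step that by (auto simp: H_def)
  next
    case False
    then have "w = x \<or> {x, w} \<in> E" using that(2) by (auto simp: U_def)
    moreover have "w \<noteq> x" using that xC(1)[of c] by (auto simp: insert_commute)
    ultimately have "w \<in> S" using that by (auto simp: S_def insert_commute)
    then show ?thesis by (simp add: H_def)
  qed
  have S_clique: "{s, s'} \<in> E" if s: "s \<in> S" "s' \<in> S" "s \<noteq> s'" for s s'
  proof (rule ccontr)
    assume nadj: "{s, s'} \<notin> E"
    define P where "P q \<longleftrightarrow> q \<noteq> [] \<and> hd q = s \<and> last q = s' \<and> length q \<ge> 2 \<and>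
      successively (\<lambda>a b. {a, b} \<in> E) q \<and> (\<forall>i. 0 < i \<longrightarrow> Suc i < length q \<longrightarrow> q ! i \<in> C)" for q
    have "\<exists>q. P q"
    proof -
      obtain c c' where c: "c \<in> C" "{s, c} \<in> E" "c' \<in> C" "{s', c'} \<in> E"
        using s by (auto simp: S_def)
      have "sym R" by (auto simp: sym_def R_def insert_commute)
      then have "sym (R\<^sup>*)" by (rule sym_rtrancl)
      then have "(c, y) \<in> R\<^sup>*" using c(1) by (auto simp: C_def dest: symD)
      then have "(c, c') \<in> R\<^sup>*" using c(3) by (auto simp: C_def)
      then have "\<exists>p. p \<noteq> [] \<and> hd p = c \<and> last p = c' \<and> set p \<subseteq> C \<and> successively (\<lambda>a b. {a, b} \<in> E) p"
      proof (induction rule: rtrancl_induct)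
        case base
        then show ?case using c(1) by (intro exI[of _ "[c]"]) auto
      next
        case (step d e)
        then obtain p where p: "p \<noteq> []" "hd p = c" "last p = d" "set p \<subseteq> C" "successively (\<lambda>a b. {a, b} \<in> E) p"
          by auto
        have "d \<in> C" using p by auto
        then have "e \<in> C" using step.hyps(2) by (auto simp: C_def)
        then show ?case using p step.hyps(2)
          by (intro exI[of _ "p @ [e]"]) (auto simp: successively_append_iff R_def)
      qed
      then obtain p where p: "p \<noteq> []" "hd p = c" "last p = c'" "set p \<subseteq> C" "successively (\<lambda>a b. {a, b} \<in> E) p"
        by auto
      have inner: "(s # p @ [s']) ! i \<in> C" if i: "0 < i" "Suc i < length (s # p @ [s'])" for i
      proof -
        have "(s # p @ [s']) ! i = p ! (i - 1)" "i - 1 < length p"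
          using i by (auto simp: nth_Cons' nth_append)
        then show ?thesis using p(4) by auto
      qed
      have "P (s # p @ [s'])"
        unfolding P_def using p c(2,4) inner
        by (auto simp: successively_Cons successively_append_iff insert_commute)
      then show ?thesis ..
    qed
    then obtain q where q: "P q" and q_min: "\<And>q'. P q' \<Longrightarrow> length q \<le> length q'"
      using ex_has_least_nat[of P _ length] by metis
    let ?m = "length q"
    have m2: "?m \<ge> 2" and walk: "\<And>i. Suc i < ?m \<Longrightarrow> {q ! i, q ! Suc i} \<in> E"
      and succ: "successively (\<lambda>a b. {a, b} \<in> E) q"
      and inner: "\<And>i. 0 < i \<Longrightarrow> Suc i < ?m \<Longrightarrow> q ! i \<in> C"
      and q0: "q ! 0 = s" and ql: "q ! (?m - 1) = s'"
      using q unfolding P_def by (auto simp: successively_conv_nth hd_conv_nth last_conv_nth)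
    have shortcut: False if ij: "i < j" "j < ?m" "Suc i < j \<and> {q ! i, q ! j} \<in> E" for i j
    proof -
      let ?q = "take (Suc i) q @ drop j q"
      have "q \<noteq> []" using m2 by auto
      then have tk: "last (take (Suc i) q) = q ! i" "hd (take (Suc i) q) = s" "take (Suc i) q \<noteq> []"
        "hd (drop j q) = q ! j" "last (drop j q) = s'" "drop j q \<noteq> []"
        using ij m2 q0 ql
        by (auto simp: last_conv_nth hd_conv_nth hd_drop_conv_nth last_drop take_Suc_conv_app_nth nth_append)
      have "successively (\<lambda>a b. {a, b} \<in> E) (take (Suc i) q)" "successively (\<lambda>a b. {a, b} \<in> E) (drop j q)"
        using succ ij by (auto simp: successively_conv_nth)
      then have s1: "successively (\<lambda>a b. {a, b} \<in> E) ?q"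
        using tk ij by (auto simp: successively_append_iff)
      have len: "length ?q = Suc i + (?m - j)" using ij by simp
      have s2: "?q ! k \<in> C" if k: "0 < k" "Suc k < length ?q" for k
      proof (cases "k < Suc i")
        case True
        then have "?q ! k = q ! k" using ij by (simp add: nth_append)
        then show ?thesis using inner[of k] True k ij by auto
      next
        case False
        then have "?q ! k = q ! (j + (k - Suc i))" using ij by (simp add: nth_append min_def)
        then show ?thesis using inner[of "j + (k - Suc i)"] False k ij len by auto
      qed
      have "P ?q" unfolding P_def using s1 s2 tk len ij by auto
      then show False using q_min[of ?q] len ij by linarith
    qed
    have ql': "q ! i = s'" if "Suc i = ?m" for i
      using ql that by (metis diff_Suc_1)
    have qS: "q ! i \<in> C" if "i < ?m" "i \<noteq> 0" "Suc i \<noteq> ?m" for i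
      using inner[of i] that by auto
    have sC: "s \<notin> C" "s' \<notin> C" using SC s by auto
    have dist: "distinct q"
      unfolding distinct_conv_nth
    proof (intro allI impI)
      \<comment> \<open>A repeated vertex lets the walk jump from its first occurrence to the
        successor of the second. That successor exists, since the repeated vertex lies in
        \<open>C\<close> and the final vertex does not.\<close>
      have *: False if ij: "i < j" "j < ?m" "q ! i = q ! j" for i j
      proof -
        have i0: "i \<noteq> 0"
        proof
          assume "i = 0"
          then have "q ! j = s" using ij(3) q0 by simp
          then have "Suc j = ?m" using qS[of j] sC ij by auto
          then have "q ! j = s'" using ql by (metis diff_Suc_1)
          then show False using \<open>q ! j = s\<close> s(3) by simp
        qed
        have "q ! i \<in> C" using qS[of i] i0 ij by simp
        then have jm: "Suc j < ?m" using sC(2) ij ql by (metis Suc_lessI diff_Suc_1)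
        have "{q ! i, q ! Suc j} \<in> E" using walk[of j] jm ij(3) by simp
        then show False using shortcut[of i "Suc j"] ij jm by simp
      qed
      fix i j assume "i < ?m" "j < ?m" "i \<noteq> j"
      then show "q ! i \<noteq> q ! j" using *[of i j] *[of j i] by (cases i j rule: linorder_cases) auto
    qed
    have "?m \<noteq> 2" using walk[of 0] q0 ql nadj by (auto simp: numeral_2_eq_2)
    then have m3: "?m \<ge> 3" using m2 by simp
    show False
    proof (rule chordal_no_induced_cycle[OF chordal loops succ dist m3, of x])
      fix i assume i: "i < ?m"
      have "{x, s} \<in> E" "{x, s'} \<in> E" using s by (auto simp: S_def)
      then show "{x, q ! i} \<in> E \<longleftrightarrow> i = 0 \<or> Suc i = ?m"
        using qS[OF i] xC(1)[of "q ! i"] q0 ql'[of i] by auto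
    next
      show "x \<notin> set q"
      proof
        assume "x \<in> set q"
        then obtain i where i: "i < ?m" "q ! i = x" by (auto simp: in_set_conv_nth)
        then have "x = s \<or> x = s' \<or> x \<in> C" using qS[of i] q0 ql'[of i] by auto
        then show False using s xC(2) loops by (auto simp: S_def)
      qed
    next
      fix i j assume "i < j" "j < ?m" "{q ! i, q ! j} \<in> E"
      then show "j = Suc i" using shortcut[of i j] by (cases "Suc i < j") auto
    qed
  qed
  have HW: "H \<subset> W" using CW xH less.prems(2) by (auto simp: H_def S_def)
  then have cardH: "card H < card W" and finH: "finite H"
    using less.prems(1) psubset_card_mono finite_subset by auto
  \<comment> \<open>All neighbours in \<open>W\<close> of a vertex of \<open>C\<close> lie in
    \<open>H\<close>, so for such a vertex being simplicial in \<open>H\<close> is the same as in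
    \<open>W\<close>.\<close>
  have lift: "u \<noteq> x \<and> {x, u} \<notin> E \<and> simplicial_vertex E W u"
    if u: "u \<in> C" "simplicial_vertex E H u" for u
    using u xC[OF u(1)] CW C_nbrs[OF u(1)] unfolding simplicial_vertex_def by auto
  \<comment> \<open>The vertex supplied by induction must not lie in \<open>S\<close>. If some
    \<open>s\<close> in \<open>S\<close> has a non-neighbour, induction starts at \<open>s\<close>
    and \<open>S\<close> being a clique excludes it; otherwise \<open>S\<close> is joined to all of
    \<open>H\<close>, and any non-adjacent pair can be used.\<close>
  consider "\<forall>a\<in>H. \<forall>b\<in>H. a \<noteq> b \<longrightarrow> {a, b} \<in> E"
    | s h where "s \<in> S" "h \<in> H" "h \<noteq> s" "{s, h} \<notin> E"
    | h h' where "h \<in> H" "h' \<in> H" "h' \<noteq> h" "{h, h'} \<notin> E" "\<forall>s\<in>S. \<forall>a\<in>H. a \<noteq> s \<longrightarrow> {s, a} \<in> E"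
    by metis
  then show ?case
  proof cases
    case 1
    then have "simplicial_vertex E H y"
      using yC unfolding simplicial_vertex_def H_def by simp
    then show ?thesis using lift[OF yC] by blast
  next
    case 2
    then have "s \<in> H" by (simp add: H_def)
    from less.hyps[OF cardH finH this 2(2,3,4)] obtain u
      where u: "u \<noteq> s" "{s, u} \<notin> E" "simplicial_vertex E H u" by blast
    then have "u \<notin> S" using S_clique[OF 2(1)] by auto
    then have "u \<in> C" using u(3) by (auto simp: simplicial_vertex_def H_def)
    then show ?thesis using lift u(3) by blast
  next
    case 3
    from less.hyps[OF cardH finH 3(1-4)] obtain u
      where u: "u \<noteq> h" "{h, u} \<notin> E" "simplicial_vertex E H u" by blast
    then have "u \<notin> S" using 3(1,5) by (metis insert_commute)
    then have "u \<in> C" using u(3) by (auto simp: simplicial_vertex_def H_def)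
    then show ?thesis using lift u(3) by blast
  qed
qed

text \<open>A simplicial vertex can be placed last, since all its neighbours in \<open>W\<close>
  form a clique; the remaining vertices are ordered by induction.\<close>

lemma chordal_perfect_elimination:
  assumes chordal: "chordal E" and loops: "\<And>v. {v} \<notin> E" and "finite W"
  shows "\<exists>pos :: nat \<Rightarrow> nat. inj_on pos W \<and> (\<forall>v\<in>W. \<forall>a\<in>W. \<forall>b\<in>W.
    pos a < pos v \<longrightarrow> pos b < pos v \<longrightarrow> {a, v} \<in> E \<longrightarrow> {b, v} \<in> E \<longrightarrow> a \<noteq> b \<longrightarrow> {a, b} \<in> E)"
  using \<open>finite W\<close>
proof (induction "card W" arbitrary: W)
  case 0
  then show ?case by auto
next
  case (Suc k)
  have "\<exists>u. simplicial_vertex E W u"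
  proof (cases "\<forall>x\<in>W. \<forall>y\<in>W. x \<noteq> y \<longrightarrow> {x, y} \<in> E")
    case True
    obtain u where "u \<in> W" using Suc.hyps(2) by fastforce
    then show ?thesis using True by (auto simp: simplicial_vertex_def)
  next
    case False
    then obtain x y where "x \<in> W" "y \<in> W" "y \<noteq> x" "{x, y} \<notin> E" by blast
    then show ?thesis using ex_simplicial_nonneighbour[OF chordal loops Suc.prems] by blast
  qed
  then obtain u where u: "simplicial_vertex E W u" ..
  let ?W = "W - {u}"
  have uW: "u \<in> W" using u by (simp add: simplicial_vertex_def)
  then have "k = card ?W" using Suc.hyps(2) Suc.prems by simp
  from Suc.hyps(1)[OF this] Suc.prems obtain pos :: "nat \<Rightarrow> nat" where pos: "inj_on pos ?W"
    "\<forall>v\<in>?W. \<forall>a\<in>?W. \<forall>b\<in>?W. pos a < pos v \<longrightarrow> pos b < pos v \<longrightarrow> {a, v} \<in> E \<longrightarrow> {b, v} \<in> E \<longrightarrow> a \<noteq> b \<longrightarrow> {a, b} \<in> E"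
    by auto
  \<comment> \<open>One more than the sum of all positions exceeds each of them.\<close>
  define p where "p = pos(u := Suc (\<Sum>w\<in>?W. pos w))"
  have less: "p a < p u" if "a \<in> ?W" for a
  proof -
    have "pos a \<le> (\<Sum>w\<in>?W. pos w)" using that Suc.prems by (intro member_le_sum) auto
    then show ?thesis using that by (simp add: p_def)
  qed
  have eq: "p a = pos a" if "a \<noteq> u" for a using that by (simp add: p_def)
  have "inj_on p W"
  proof (rule inj_onI)
    fix a b assume ab: "a \<in> W" "b \<in> W" "p a = p b"
    show "a = b"
    proof (cases "a = u \<or> b = u")
      case True
      show ?thesis
      proof (rule ccontr)
        assume "a \<noteq> b"
        then show False using True less[of a] less[of b] ab by auto
      qed
    next
      case False
      then show ?thesis using ab eq pos(1) by (auto dest: inj_onD)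
    qed
  qed
  moreover have "{a, b} \<in> E"
    if h: "v \<in> W" "a \<in> W" "b \<in> W" "p a < p v" "p b < p v" "{a, v} \<in> E" "{b, v} \<in> E" "a \<noteq> b" for v a b
  proof (cases "v = u")
    case True
    then show ?thesis using h u by (auto simp: simplicial_vertex_def insert_commute)
  next
    case False
    then have "a \<noteq> u" "b \<noteq> u" using less[of v] h by auto
    then show ?thesis using pos(2) h eq False by auto
  qed
  ultimately show ?case by blast
qed

section \<open>Counting faces and monomials\<close>

lemma monomial_dvd_iff: "(\<exists>k. m = g + k) \<longleftrightarrow> (\<forall>i. lookup g i \<le> lookup m i)"
  for m g :: "'v mon"
proof
  assume "\<forall>i. lookup g i \<le> lookup m i"
  then have "m = g + (m - g)"
    by (intro poly_mapping_eqI) (simp add: lookup_add lookup_minus)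
  then show "\<exists>k. m = g + k" ..
qed (auto simp: lookup_add)

lemma single_dvd:
  fixes m :: "'v mon"
  assumes "i \<in> keys m"
  obtains m' where "m = single i 1 + m'"
proof -
  have "\<exists>m'. m = single i 1 + m'"
    unfolding monomial_dvd_iff using assms
    by (auto simp: lookup_single when_def in_keys_iff Suc_le_eq)
  then show ?thesis using that by blast
qed

lemma keys_add_mon: "keys (a + b) = keys a \<union> keys b"
  for a b :: "'v mon"
  by (auto simp: in_keys_iff lookup_add)

definition mons_le :: "nat set \<Rightarrow> nat \<Rightarrow> nat mon set" where
  "mons_le V d = {m. keys m \<subseteq> V \<and> mon_deg m \<le> d}"

lemma mon_deg_eq_0_iff: "mon_deg m = 0 \<longleftrightarrow> m = 0"
  by (auto simp: mon_deg_def in_keys_iff intro: poly_mapping_eqI)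

lemma card_mons_le:
  assumes "finite V"
  shows "finite (mons_le V d) \<and> card (mons_le V d) = (card V + d) choose d"
  using assms
proof (induction V arbitrary: d rule: finite_induct)
  case empty
  have "mons_le {} d = {0}" by (auto simp: mons_le_def)
  then show ?case by simp
next
  case (insert v V)
  show ?case
  proof (induction d)
    case 0
    have "mons_le (insert v V) 0 = {0}" by (auto simp: mons_le_def mon_deg_eq_0_iff)
    then show ?case by simp
  next
    case (Suc d)
    let ?f = "(+) (single v 1) :: nat mon \<Rightarrow> _"
    \<comment> \<open>Either \<open>v\<close> does not occur or one factor of it can be removed. The
      count is then Pascal's rule.\<close>
    have split: "mons_le (insert v V) (Suc d) = mons_le V (Suc d) \<union> ?f ` mons_le (insert v V) d"
    proof
      show "mons_le (insert v V) (Suc d) \<subseteq> mons_le V (Suc d) \<union> ?f ` mons_le (insert v V) d"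
      proof
        fix m assume m: "m \<in> mons_le (insert v V) (Suc d)"
        show "m \<in> mons_le V (Suc d) \<union> ?f ` mons_le (insert v V) d"
        proof (cases "v \<in> keys m")
          case True
          then obtain m' where "m = single v 1 + m'" by (rule single_dvd)
          then show ?thesis using m by (auto simp: mons_le_def keys_add_mon)
        qed (use m in \<open>auto simp: mons_le_def\<close>)
      qed
      show "mons_le V (Suc d) \<union> ?f ` mons_le (insert v V) d \<subseteq> mons_le (insert v V) (Suc d)"
        by (auto simp: mons_le_def keys_add_mon)
    qed
    have "mons_le V (Suc d) \<inter> ?f ` mons_le (insert v V) d = {}"
      using insert.hyps(2) by (auto simp: mons_le_def keys_add_mon)
    then have "card (mons_le (insert v V) (Suc d)) = card (mons_le V (Suc d)) + card (mons_le (insert v V) d)"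
      unfolding split using insert.IH[of "Suc d"] Suc.IH
      by (subst card_Un_disjoint) (auto simp: card_image)
    moreover have "finite (mons_le (insert v V) (Suc d))"
      unfolding split using insert.IH[of "Suc d"] Suc.IH by simp
    ultimately show ?case
      using insert.IH[of "Suc d"] Suc.IH insert.hyps by simp
  qed
qed

text \<open>The relation \<open>R\<close> determines the pivot: two different pivots of one monomial
  would lie in each other's sets. A pivot may belong to its own set, since powers of it are
  allowed.\<close>

lemma card_monomials_by_pivot:
  fixes n :: nat and R :: "nat \<Rightarrow> nat set"
  assumes fin: "\<And>i. i < n \<Longrightarrow> finite (R i)"
    and asym: "\<And>i j. i < n \<Longrightarrow> j < n \<Longrightarrow> i \<noteq> j \<Longrightarrow> j \<in> R i \<Longrightarrow> i \<notin> R j"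
    and X: "\<And>m. m \<in> X \<longleftrightarrow> m = 0 \<or> (\<exists>i<n. \<exists>m'. keys m' \<subseteq> R i \<and> m = single i 1 + m')"
  shows "card {m \<in> X. mon_deg m \<le> Suc d} = Suc (\<Sum>i<n. (card (R i) + d) choose d)"
proof -
  define P where "P i = (+) (single i 1) ` mons_le (R i) d" for i
  have eq: "{m \<in> X. mon_deg m \<le> Suc d} = insert 0 (\<Union>i<n. P i)"
  proof
    show "{m \<in> X. mon_deg m \<le> Suc d} \<subseteq> insert 0 (\<Union>i<n. P i)"
      by (auto simp: X P_def mons_le_def)
    show "insert 0 (\<Union>i<n. P i) \<subseteq> {m \<in> X. mon_deg m \<le> Suc d}"
      unfolding P_def mons_le_def using X by auto
  qed
  have fP: "finite (P i)" "card (P i) = (card (R i) + d) choose d" if "i < n" for i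
    using card_mons_le[OF fin[OF that], of d] by (simp_all add: P_def card_image)
  have "P i \<inter> P j = {}" if ij: "i < n" "j < n" "i \<noteq> j" for i j
  proof (rule ccontr)
    assume "P i \<inter> P j \<noteq> {}"
    then obtain x where "x \<in> P i" "x \<in> P j" by blast
    then obtain a b where "a \<in> mons_le (R i) d" "x = single i 1 + a"
      "b \<in> mons_le (R j) d" "x = single j 1 + b"
      unfolding P_def by blast
    then have ab: "keys a \<subseteq> R i" "keys b \<subseteq> R j"
      "single i 1 + a = single j 1 + b"
      by (simp_all add: mons_le_def)
    from arg_cong[OF ab(3), of keys]
    have "insert i (keys a) = insert j (keys b)"
      by (simp add: keys_add_mon)
    then have "j \<in> R i" "i \<in> R j" using ab(1,2) ij(3) by auto
    then show False using asym[OF ij] by simp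
  qed
  then have "card (\<Union>i<n. P i) = (\<Sum>i<n. card (P i))"
    using fP by (intro card_UN_disjoint) auto
  moreover have "0 \<notin> (\<Union>i<n. P i)"
  proof
    assume "0 \<in> (\<Union>i<n. P i)"
    then obtain i a where "0 = single i 1 + (a :: nat mon)" by (auto simp: P_def)
    from arg_cong[OF this, of mon_deg] show False by simp
  qed
  ultimately show ?thesis
    unfolding eq using fP by (subst card_insert_disjoint) auto
qed

lemma card_subsets_le:
  assumes "finite A" shows "card {F. F \<subseteq> A \<and> card F \<le> k} = (\<Sum>r\<le>k. card A choose r)"
proof -
  have "{F. F \<subseteq> A \<and> card F \<le> k} = (\<Union>r\<le>k. {F. F \<subseteq> A \<and> card F = r})" by auto
  moreover have "card (\<Union>r\<le>k. {F. F \<subseteq> A \<and> card F = r}) = (\<Sum>r\<le>k. card {F. F \<subseteq> A \<and> card F = r})"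
    using assms by (intro card_UN_disjoint) auto
  ultimately show ?thesis using n_subsets[OF assms] by simp
qed

text \<open>The squarefree version of the pivot count; a vertex occurs once, so no pivot lies in its
  own set.\<close>

lemma card_faces_by_pivot:
  fixes n :: nat and R :: "nat \<Rightarrow> nat set"
  assumes fin: "\<And>i. i < n \<Longrightarrow> finite (R i)" and irrefl: "\<And>i. i < n \<Longrightarrow> i \<notin> R i"
    and asym: "\<And>i j. i < n \<Longrightarrow> j < n \<Longrightarrow> i \<noteq> j \<Longrightarrow> j \<in> R i \<Longrightarrow> i \<notin> R j"
    and X: "\<And>F. F \<in> X \<longleftrightarrow> F = {} \<or> (\<exists>i<n. \<exists>F'. F' \<subseteq> R i \<and> F = insert i F')"
  shows "card {F \<in> X. card F \<le> Suc k} = Suc (\<Sum>i<n. \<Sum>r\<le>k. card (R i) choose r)"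
proof -
  define P where "P i = insert i ` {F. F \<subseteq> R i \<and> card F \<le> k}" for i
  have card_ins: "card (insert i F) = Suc (card F)" if "i < n" "F \<subseteq> R i" for i F
    using fin[OF that(1)] irrefl[OF that(1)] that(2) finite_subset by (subst card_insert_disjoint) auto
  have eq: "{F \<in> X. card F \<le> Suc k} = insert {} (\<Union>i<n. P i)"
    by (auto simp: X P_def card_ins)
  have fP: "finite (P i)" "card (P i) = (\<Sum>r\<le>k. card (R i) choose r)" if "i < n" for i
  proof -
    have "inj_on (insert i) {F. F \<subseteq> R i \<and> card F \<le> k}"
      using irrefl[OF that] by (auto intro!: inj_onI)
    then show "card (P i) = (\<Sum>r\<le>k. card (R i) choose r)"
      using card_subsets_le[OF fin[OF that]] by (simp add: P_def card_image)
    show "finite (P i)" using fin[OF that] by (simp add: P_def)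
  qed
  have "P i \<inter> P j = {}" if ij: "i < n" "j < n" "i \<noteq> j" for i j
  proof (rule ccontr)
    assume "P i \<inter> P j \<noteq> {}"
    then obtain a b where ab: "a \<subseteq> R i" "b \<subseteq> R j" "insert i a = insert j b"
      by (auto simp: P_def)
    then have "j \<in> R i" "i \<in> R j" using ij(3) by auto
    then show False using asym[OF ij] by simp
  qed
  then have "card (\<Union>i<n. P i) = (\<Sum>i<n. card (P i))"
    using fP by (intro card_UN_disjoint) auto
  moreover have "{} \<notin> (\<Union>i<n. P i)" by (auto simp: P_def)
  ultimately show ?thesis
    unfolding eq using fP by (subst card_insert_disjoint) auto
qed

text \<open>Equal tail counts mean equal multisets of values. Writing \<open>\<phi> (e i)\<close> as
  a telescoping sum expresses the total through the tail counts alone.\<close>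

lemma sum_eq_if_tails_eq:
  fixes e f :: "nat \<Rightarrow> nat" and \<phi> :: "nat \<Rightarrow> nat"
  assumes "\<And>t. card {i. i < n \<and> t < e i} = card {i. i < n \<and> t < f i}"
  shows "(\<Sum>i<n. \<phi> (e i)) = (\<Sum>i<n. \<phi> (f i))"
proof -
  define M where "M = (\<Sum>i<n. e i) + (\<Sum>i<n. f i)"
  have "e i \<le> M" "f i \<le> M" if "i < n" for i
    using that member_le_sum[of i "{..<n}" e] member_le_sum[of i "{..<n}" f] by (auto simp: M_def)
  \<comment> \<open>The increments of \<open>\<phi>\<close> may be negative, hence the passage to
    integers.\<close>
  moreover have *: "int (\<Sum>i<n. \<phi> (g i)) = int n * int (\<phi> 0) +
      (\<Sum>t<M. int (card {i. i < n \<and> t < g i}) * (int (\<phi> (Suc t)) - int (\<phi> t)))"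
    if bound: "\<And>i. i < n \<Longrightarrow> g i \<le> M" for g
  proof -
    have "int (\<phi> (g i)) = int (\<phi> 0) + (\<Sum>t<M. if t < g i then int (\<phi> (Suc t)) - int (\<phi> t) else 0)"
      if i: "i < n" for i
    proof -
      have "(\<Sum>t<M. if t < g i then int (\<phi> (Suc t)) - int (\<phi> t) else 0) =
          (\<Sum>t<g i. int (\<phi> (Suc t)) - int (\<phi> t))"
        using bound[OF i] by (intro sum.mono_neutral_cong_right) auto
      also have "\<dots> = int (\<phi> (g i)) - int (\<phi> 0)"
        by (rule sum_lessThan_telescope)
      finally show ?thesis by simp
    qed
    then have "int (\<Sum>i<n. \<phi> (g i)) = (\<Sum>i<n. int (\<phi> 0) +
        (\<Sum>t<M. if t < g i then int (\<phi> (Suc t)) - int (\<phi> t) else 0))"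
      by simp
    also have "\<dots> = int n * int (\<phi> 0) +
        (\<Sum>t<M. \<Sum>i<n. if t < g i then int (\<phi> (Suc t)) - int (\<phi> t) else 0)"
      unfolding sum.distrib by (subst sum.swap) simp
    also have "(\<Sum>t<M. \<Sum>i<n. if t < g i then int (\<phi> (Suc t)) - int (\<phi> t) else 0) =
        (\<Sum>t<M. int (card {i. i < n \<and> t < g i}) * (int (\<phi> (Suc t)) - int (\<phi> t)))"
    proof (rule sum.cong[OF refl])
      fix t
      have "(\<Sum>i<n. if t < g i then int (\<phi> (Suc t)) - int (\<phi> t) else 0) =
          (\<Sum>i | i < n \<and> t < g i. int (\<phi> (Suc t)) - int (\<phi> t))"
        by (intro sum.mono_neutral_cong_right) auto
      then show "(\<Sum>i<n. if t < g i then int (\<phi> (Suc t)) - int (\<phi> t) else 0) =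
          int (card {i. i < n \<and> t < g i}) * (int (\<phi> (Suc t)) - int (\<phi> t))" by simp
    qed
    finally show ?thesis .
  qed
  ultimately have "int (\<Sum>i<n. \<phi> (e i)) = int (\<Sum>i<n. \<phi> (f i))"
    using *[of e] *[of f] assms by simp
  then show ?thesis by (simp only: of_nat_eq_iff)
qed

section \<open>The graph attached to a degree sequence and its face numbers\<close>

locale degree_sequence =
  fixes n :: nat and d :: "nat \<Rightarrow> nat"
  assumes occurs: "v < n \<Longrightarrow> t < d v \<Longrightarrow> \<exists>u<n. d u = t"
begin

definition tail :: "nat \<Rightarrow> nat" where
  "tail t = card {v. v < n \<and> t \<le> d v}"

text \<open>For \<open>i \<le> j\<close> the monomial \<open>x\<^sub>i x\<^sub>j\<close> is a generator of the symmetric generic initial ideal,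
  and \<open>e\<^sub>i e\<^bsub>j+1\<^esub>\<close> one of the exterior generic initial ideal, iff \<open>low i j\<close>.\<close>

definition low :: "nat \<Rightarrow> nat \<Rightarrow> bool" where
  "low i j \<longleftrightarrow> i + tail (n - 1 - j) \<le> j"

text \<open>The variables that may accompany \<open>x_i\<close> in a monomial outside the candidate
  ideal whose smallest index is \<open>i\<close>.\<close>

definition R :: "nat \<Rightarrow> nat set" where
  "R i = {j. i \<le> j \<and> j < n \<and> \<not> low i j}"

text \<open>Because of this monotonicity only the smallest index of a monomial or face has to be
  tested.\<close>

lemma low_mono: "low a b \<Longrightarrow> i \<le> a \<Longrightarrow> low i b"
  by (simp add: low_def)

lemma tail_0: "tail 0 = n"
  by (simp add: tail_def)

text \<open>No generator involves the last variable. This leaves room for the shift by one under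
  \<open>sigma\<close>, and it makes \<open>n - 1\<close> an element of every
  \<open>R i\<close>.\<close>

lemma not_low_last: "j = n - 1 \<Longrightarrow> j < n \<Longrightarrow> \<not> low i j"
  by (simp add: low_def tail_0)

text \<open>A value above \<open>t\<close> forces \<open>t\<close> to be a value too, by
  \<open>occurs\<close>, so the two counted sets differ.\<close>

lemma tail_strict:
  assumes "tail (Suc t) > 0" shows "tail (Suc t) < tail t"
proof -
  have "{v. v < n \<and> Suc t \<le> d v} \<noteq> {}"
    using assms by (auto simp: tail_def card_gt_0_iff)
  then obtain v where "v < n" "t < d v" by auto
  then obtain u where "u < n" "d u = t" using occurs by blast
  then have "u \<in> {v. v < n \<and> t \<le> d v}" "u \<notin> {v. v < n \<and> Suc t \<le> d v}" by simp_all
  moreover have "{v. v < n \<and> Suc t \<le> d v} \<subseteq> {v. v < n \<and> t \<le> d v}" by auto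
  ultimately have "{v. v < n \<and> Suc t \<le> d v} \<subset> {v. v < n \<and> t \<le> d v}" by blast
  then show ?thesis unfolding tail_def by (intro psubset_card_mono) auto
qed

lemma tail_le: "tail t > 0 \<Longrightarrow> tail t + t \<le> n"
proof (induction t)
  case (Suc t)
  then have "tail (Suc t) < tail t" by (intro tail_strict)
  then show ?case using Suc.IH by simp
qed (simp add: tail_0)

text \<open>Reversal \<open>j \<mapsto> n - 1 - j\<close> sends \<open>R i\<close> to a set of
  numbers that is closed downwards because \<open>tail\<close> drops strictly. Such a set is an
  initial segment, so its size is tested by membership.\<close>

lemma card_R_gt: "i < n \<Longrightarrow> t < card (R i) \<longleftrightarrow> t + i < n \<and> n \<le> tail t + t + i"
proof -
  assume i: "i < n"
  define Q where "Q = {t. t + i < n \<and> n \<le> tail t + t + i}"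
  have "bij_betw (\<lambda>j. n - 1 - j) (R i) Q"
    by (rule bij_betw_byWitness[of _ "\<lambda>t. n - 1 - t"]) (auto simp: R_def Q_def low_def)
  then have cQ: "card (R i) = card Q" by (rule bij_betw_same_card)
  have down: "t \<in> Q" if "Suc t \<in> Q" for t
  proof -
    have "tail (Suc t) > 0" using that by (auto simp: Q_def)
    then have "tail (Suc t) < tail t" by (rule tail_strict)
    then show ?thesis using that by (auto simp: Q_def)
  qed
  have down': "a \<in> Q" if "b \<in> Q" "a \<le> b" for a b
    using that(2,1) by (induction rule: inc_induct) (auto intro: down)
  have finQ: "finite Q" by (rule finite_subset[of _ "{..<n}"]) (auto simp: Q_def)
  have "Q = {..<card Q}"
  proof -
    have "a < card Q" if "a \<in> Q" for a
    proof -
      have "{..a} \<subseteq> Q" using down' that by auto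
      then have "card {..a} \<le> card Q" by (rule card_mono[OF finQ])
      then show ?thesis by simp
    qed
    then have "Q \<subseteq> {..<card Q}" by auto
    then show ?thesis by (intro card_subset_eq) auto
  qed
  then show ?thesis using cQ by (auto simp: Q_def)
qed

text \<open>For fixed \<open>t\<close> the indices with \<open>t < card (R i)\<close> form an
  interval of length \<open>tail t\<close>, which is also the number of \<open>v\<close> with
  \<open>t < Suc (d v)\<close>.\<close>

lemma sum_R: "(\<Sum>i<n. \<phi> (card (R i))) = (\<Sum>v<n. \<phi> (Suc (d v)))" for \<phi> :: "nat \<Rightarrow> nat"
proof (rule sum_eq_if_tails_eq[where e = "\<lambda>i. card (R i)" and f = "\<lambda>v. Suc (d v)"])
  fix t
  have "{i. i < n \<and> t < card (R i)} = {i. t + i < n \<and> n \<le> tail t + t + i}"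
    using card_R_gt by auto
  also have "\<dots> = {n - t - tail t..<n - t}" by auto
  also have "card \<dots> = tail t"
    using tail_le[of t] by (cases "tail t = 0") auto
  also have "tail t = card {v. v < n \<and> t < Suc (d v)}"
    by (simp add: tail_def less_Suc_eq_le)
  finally show "card {i. i < n \<and> t < card (R i)} = card {v. v < n \<and> t < Suc (d v)}" .
qed

definition sym_gens :: "nat mon set" where
  "sym_gens = {single i 1 + single j 1 | i j. i \<le> j \<and> j < n \<and> low i j}"

definition sym_mons :: "nat mon set" where
  "sym_mons = {m. keys m \<subseteq> {..<n} \<and> (\<exists>g\<in>sym_gens. \<exists>k. m = g + k)}"

definition ext_gens :: "nat set set" where
  "ext_gens = {{i, j} | i j. i < j \<and> j < n \<and> low i (j - 1)}"

definition shifted :: "nat set set" where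
  "shifted = {F. F \<subseteq> {..<n} \<and> (\<forall>i\<in>F. \<forall>j\<in>F. i < j \<longrightarrow> \<not> low i (j - 1))}"

lemma shifted_iff: "F \<subseteq> {..<n} \<Longrightarrow> F \<notin> shifted \<longleftrightarrow> (\<exists>g\<in>ext_gens. g \<subseteq> F)"
proof -
  assume F: "F \<subseteq> {..<n}"
  then have "F \<notin> shifted \<longleftrightarrow> (\<exists>i\<in>F. \<exists>j\<in>F. i < j \<and> low i (j - 1))"
    by (simp add: shifted_def)
  also have "\<dots> \<longleftrightarrow> (\<exists>g\<in>ext_gens. g \<subseteq> F)"
  proof
    assume "\<exists>i\<in>F. \<exists>j\<in>F. i < j \<and> low i (j - 1)"
    then obtain i j where ij: "i \<in> F" "j \<in> F" "i < j" "low i (j - 1)" by auto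
    then have "{i, j} \<in> ext_gens" using F by (auto simp: ext_gens_def)
    then show "\<exists>g\<in>ext_gens. g \<subseteq> F" using ij by (intro bexI[of _ "{i, j}"]) auto
  next
    assume "\<exists>g\<in>ext_gens. g \<subseteq> F"
    then obtain i j where "{i, j} \<subseteq> F" "i < j" "low i (j - 1)" by (auto simp: ext_gens_def)
    then show "\<exists>i\<in>F. \<exists>j\<in>F. i < j \<and> low i (j - 1)" by (intro bexI[of _ i] bexI[of _ j]) auto
  qed
  finally show ?thesis .
qed

text \<open>Taking the pivot out first treats squares and mixed products alike: for
  \<open>i = j\<close> a second copy must still occur in \<open>m\<close>.\<close>

lemma pair_dvd_iff:
  fixes m :: "nat mon"
  shows "(\<exists>k. single i 1 + m = single i 1 + single j 1 + k) \<longleftrightarrow>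
    j \<in> keys m"
proof -
  have "(\<exists>k. single i 1 + m = single i 1 + single j 1 + k) \<longleftrightarrow>
      (\<exists>k. m = single j 1 + k)"
    by (simp add: add.assoc)
  also have "\<dots> \<longleftrightarrow> j \<in> keys m"
    unfolding monomial_dvd_iff by (auto simp: lookup_single when_def in_keys_iff Suc_le_eq)
  finally show ?thesis .
qed

lemma card_not_sym_mons:
  "card {m. keys m \<subseteq> {..<n} \<and> m \<notin> sym_mons \<and> mon_deg m \<le> Suc k} =
    Suc (\<Sum>v<n. (Suc (d v) + k) choose k)"
proof -
  let ?X = "{m. keys m \<subseteq> {..<n} \<and> m \<notin> sym_mons}"
  have finR: "finite (R i)" for i by (rule finite_subset[of _ "{..<n}"]) (auto simp: R_def)
  have "m \<in> ?X \<longleftrightarrow> m = 0 \<or> (\<exists>i<n. \<exists>m'. keys m' \<subseteq> R i \<and> m = single i 1 + m')" for m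
  proof
    assume m: "m \<in> ?X"
    show "m = 0 \<or> (\<exists>i<n. \<exists>m'. keys m' \<subseteq> R i \<and> m = single i 1 + m')"
    proof (cases "m = 0")
      case False
      then have ne: "keys m \<noteq> {}" by simp
      define i where "i = Min (keys m)"
      have i: "i \<in> keys m" using ne by (simp add: i_def)
      then obtain m' where m': "m = single i 1 + m'" by (rule single_dvd)
      have "j \<in> R i" if j: "j \<in> keys m'" for j
      proof -
        have jm: "j \<in> keys m" using j m' by (simp add: keys_add_mon)
        then have "i \<le> j" by (simp add: i_def)
        moreover have jn: "j < n" using jm m by auto
        moreover have "\<not> low i j"
        proof
          assume "low i j"
          then have "single i 1 + single j 1 \<in> sym_gens"
            using \<open>i \<le> j\<close> jn unfolding sym_gens_def by blast
          moreover have "\<exists>k. m = single i 1 + single j 1 + k"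
            using j unfolding m' pair_dvd_iff .
          ultimately show False using m by (auto simp: sym_mons_def)
        qed
        ultimately show ?thesis by (simp add: R_def)
      qed
      then have "keys m' \<subseteq> R i" by blast
      moreover have "i < n" using i m by auto
      ultimately show ?thesis using m' by blast
    qed simp
  next
    assume "m = 0 \<or> (\<exists>i<n. \<exists>m'. keys m' \<subseteq> R i \<and> m = single i 1 + m')"
    then show "m \<in> ?X"
    proof
      assume "m = 0"
      moreover have "0 \<noteq> single a 1 + single b 1 + k" for a b :: nat and k :: "nat mon"
      proof
        assume "0 = single a 1 + single b 1 + k"
        from arg_cong[OF this, of mon_deg] show False by simp
      qed
      ultimately show ?thesis by (auto simp: sym_mons_def sym_gens_def)
    next
      assume "\<exists>i<n. \<exists>m'. keys m' \<subseteq> R i \<and> m = single i 1 + m'"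
      then obtain i m' where i: "i < n" "keys m' \<subseteq> R i" "m = single i 1 + m'" by blast
      have keys: "keys m = insert i (keys m')" by (simp add: i(3) keys_add_mon)
      have "m \<notin> sym_mons"
      proof
        assume "m \<in> sym_mons"
        then obtain a b k where ab: "a \<le> b" "b < n" "low a b" and
          k: "m = single a 1 + single b 1 + k"
          unfolding sym_mons_def sym_gens_def by blast
        have akm: "a \<in> keys m" "b \<in> keys m" by (auto simp: k keys_add_mon)
        have "b \<in> R i \<or> b = i"
          using akm keys i(2) by auto
        moreover have "i \<le> a" using akm(1) keys i(2) by (auto simp: R_def)
        \<comment> \<open>The generator is then the square of the pivot, so the pivot survives in
          \<open>m'\<close> and lies in its own set.\<close>
        moreover have "b \<in> R i" if "b = i"
        proof -
          have "a = i" using ab(1) that \<open>i \<le> a\<close> by simp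
          then have "\<exists>k. single i 1 + m' = single i 1 + single b 1 + k"
            using k i(3) by metis
          then have "b \<in> keys m'" unfolding pair_dvd_iff .
          then show ?thesis using i(2) by auto
        qed
        ultimately have "\<not> low i b" by (auto simp: R_def)
        then show False using low_mono[OF ab(3) \<open>i \<le> a\<close>] by simp
      qed
      moreover have "keys m \<subseteq> {..<n}" using keys i(1,2) by (auto simp: R_def)
      ultimately show ?thesis by simp
    qed
  qed
  from card_monomials_by_pivot[OF finR _ this, of k]
  have "card {m \<in> ?X. mon_deg m \<le> Suc k} = Suc (\<Sum>i<n. (card (R i) + k) choose k)"
    by (auto simp: R_def)
  also have "(\<Sum>i<n. (card (R i) + k) choose k) = (\<Sum>v<n. (Suc (d v) + k) choose k)"
    using sum_R[of "\<lambda>e. (e + k) choose k"] .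
  finally show ?thesis by simp
qed

text \<open>The pivot is the smallest vertex of a face; the vertices allowed with it are one fewer
  than in \<open>R i\<close>, which turns \<open>Suc (d v)\<close> into \<open>d v\<close>.\<close>

lemma card_shifted_le:
  "card {F \<in> shifted. card F \<le> Suc k} = Suc (\<Sum>v<n. \<Sum>r\<le>k. d v choose r)"
proof -
  define R' where "R' i = {j. i < j \<and> j < n \<and> \<not> low i (j - 1)}" for i
  have finR': "finite (R' i)" for i by (rule finite_subset[of _ "{..<n}"]) (auto simp: R'_def)
  have "F \<in> shifted \<longleftrightarrow> F = {} \<or> (\<exists>i<n. \<exists>F'. F' \<subseteq> R' i \<and> F = insert i F')" for F
  proof
    assume F: "F \<in> shifted"
    show "F = {} \<or> (\<exists>i<n. \<exists>F'. F' \<subseteq> R' i \<and> F = insert i F')"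
    proof (cases "F = {}")
      case False
      have fF: "finite F" using F finite_subset by (auto simp: shifted_def)
      define i where "i = Min F"
      have i: "i \<in> F" "\<And>j. j \<in> F \<Longrightarrow> i \<le> j" using fF False by (auto simp: i_def)
      have "F - {i} \<subseteq> R' i"
      proof
        fix j assume j: "j \<in> F - {i}"
        then have "i < j" using i(2)[of j] by auto
        then show "j \<in> R' i" using F i(1) j by (auto simp: R'_def shifted_def)
      qed
      moreover have "F = insert i (F - {i})" "i < n" using i(1) F by (auto simp: shifted_def)
      ultimately show ?thesis by blast
    qed simp
  next
    assume "F = {} \<or> (\<exists>i<n. \<exists>F'. F' \<subseteq> R' i \<and> F = insert i F')"
    then show "F \<in> shifted"
    proof
      assume "\<exists>i<n. \<exists>F'. F' \<subseteq> R' i \<and> F = insert i F'"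
      then obtain i F' where i: "i < n" "F' \<subseteq> R' i" "F = insert i F'" by blast
      have "\<not> low a (b - 1)" if ab: "a \<in> F" "b \<in> F" "a < b" for a b
      proof -
        have "i \<le> a" using ab(1) i(2,3) by (auto simp: R'_def)
        then have "b \<in> R' i" using ab i(2,3) by auto
        then have "\<not> low i (b - 1)" by (simp add: R'_def)
        then show ?thesis using low_mono \<open>i \<le> a\<close> by blast
      qed
      moreover have "F \<subseteq> {..<n}" using i by (auto simp: R'_def)
      ultimately show ?thesis by (simp add: shifted_def)
    qed (simp add: shifted_def)
  qed
  from card_faces_by_pivot[OF finR' _ _ this, of k]
  have "card {F \<in> shifted. card F \<le> Suc k} = Suc (\<Sum>i<n. \<Sum>r\<le>k. card (R' i) choose r)"
    by (auto simp: R'_def)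
  also have "(\<Sum>i<n. \<Sum>r\<le>k. card (R' i) choose r) = (\<Sum>i<n. \<Sum>r\<le>k. (card (R i) - 1) choose r)"
  proof (intro sum.cong refl)
    fix i r assume "i \<in> {..<n}"
    then have "i < n" by simp
    \<comment> \<open>Lowering the indices by one maps \<open>R' i\<close> onto all of
      \<open>R i\<close> except the element \<open>n - 1\<close>.\<close>
    then have "R i = insert (n - 1) ((\<lambda>j. j - 1) ` R' i)"
    proof (intro equalityI subsetI)
      fix j assume "j \<in> R i"
      then show "j \<in> insert (n - 1) ((\<lambda>j. j - 1) ` R' i)"
        by (cases "j = n - 1") (auto simp: R_def R'_def intro!: image_eqI[of _ _ "Suc j"])
    next
      fix j assume "j \<in> insert (n - 1) ((\<lambda>j. j - 1) ` R' i)"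
      then show "j \<in> R i"
        using \<open>i < n\<close> not_low_last[of j i] by (auto simp: R_def R'_def)
    qed
    moreover have "n - 1 \<notin> (\<lambda>j. j - 1) ` R' i" by (auto simp: R'_def)
    moreover have "inj_on (\<lambda>j. j - 1) (R' i)" by (auto simp: R'_def intro!: inj_onI)
    ultimately have "card (R i) = Suc (card (R' i))"
      using finR' by (simp add: card_image)
    then show "card (R' i) choose r = (card (R i) - 1) choose r" by simp
  qed
  also have "\<dots> = (\<Sum>v<n. \<Sum>r\<le>k. d v choose r)"
    using sum_R[of "\<lambda>e. \<Sum>r\<le>k. (e - 1) choose r"] by simp
  finally show ?thesis by simp
qed

end

section \<open>Degree sequences and face numbers of perfect elimination orders\<close>

locale elimination_order =
  fixes n :: nat and E :: "nat set set" and pos :: "nat \<Rightarrow> nat"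
  assumes simple: "simple_graph n E"
    and inj: "inj_on pos {..<n}"
    and clique: "v < n \<Longrightarrow> a < n \<Longrightarrow> b < n \<Longrightarrow> pos a < pos v \<Longrightarrow> pos b < pos v \<Longrightarrow>
      {a, v} \<in> E \<Longrightarrow> {b, v} \<in> E \<Longrightarrow> a \<noteq> b \<Longrightarrow> {a, b} \<in> E"
begin

definition earlier :: "nat \<Rightarrow> nat set" where
  "earlier v = {u. u < n \<and> pos u < pos v \<and> {u, v} \<in> E}"

definition deg :: "nat \<Rightarrow> nat" where
  "deg v = card (earlier v)"

lemma finite_earlier: "finite (earlier v)"
  by (rule finite_subset[of _ "{..<n}"]) (auto simp: earlier_def)

text \<open>Take the first \<open>p\<close> with \<open>deg p > t\<close> and its latest earlier
  neighbour \<open>q\<close>. The other earlier neighbours of \<open>p\<close> are adjacent to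
  \<open>q\<close> and precede it, so \<open>deg q \<ge> t\<close>; by the choice of
  \<open>p\<close> equality holds.\<close>

lemma degree_sequence: "degree_sequence n deg"
proof
  fix v t assume "v < n" "t < deg v"
  define B where "B = {p. p < n \<and> t < deg p}"
  have "finite B" "B \<noteq> {}" using \<open>v < n\<close> \<open>t < deg v\<close> by (auto simp: B_def)
  then have "Min (pos ` B) \<in> pos ` B" by (intro Min_in) auto
  then obtain p where p: "p \<in> B" "pos p = Min (pos ` B)" by auto
  have p_min: "pos p \<le> pos q" if "q \<in> B" for q
    using p(2) \<open>finite B\<close> that by simp
  have pn: "p < n" "t < deg p" using p by (auto simp: B_def)
  then have "earlier p \<noteq> {}" by (auto simp: deg_def)
  then have "Max (pos ` earlier p) \<in> pos ` earlier p" using finite_earlier by (intro Max_in) auto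
  then obtain q where q: "q \<in> earlier p" "pos q = Max (pos ` earlier p)" by auto
  have q_max: "pos u \<le> pos q" if "u \<in> earlier p" for u
    using q(2) finite_earlier that by simp
  have qn: "q < n" "pos q < pos p" "{q, p} \<in> E" using q(1) by (auto simp: earlier_def)
  have "earlier p - {q} \<subseteq> earlier q"
  proof
    fix u assume u: "u \<in> earlier p - {q}"
    then have un: "u < n" "pos u < pos p" "{u, p} \<in> E" by (auto simp: earlier_def)
    then have "{u, q} \<in> E" using clique[of p u q] pn(1) qn u by auto
    moreover have "pos u \<noteq> pos q" using inj_onD[OF inj, of u q] un qn u by auto
    then have "pos u < pos q" using q_max[of u] u by auto
    ultimately show "u \<in> earlier q" using un by (simp add: earlier_def)
  qed
  then have "card (earlier p - {q}) \<le> deg q"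
    unfolding deg_def by (rule card_mono[OF finite_earlier])
  then have "t \<le> deg q" using pn(2) q(1) by (simp add: deg_def finite_earlier)
  moreover have "\<not> t < deg q" using p_min[of q] qn by (auto simp: B_def)
  ultimately show "\<exists>u<n. deg u = t" using qn(1) by (intro exI[of _ q]) simp
qed

lemma clique_iff:
  "F \<in> clique_complex n E \<longleftrightarrow> F = {} \<or> (\<exists>v<n. \<exists>F'. F' \<subseteq> earlier v \<and> F = insert v F')"
proof
  assume F: "F \<in> clique_complex n E"
  show "F = {} \<or> (\<exists>v<n. \<exists>F'. F' \<subseteq> earlier v \<and> F = insert v F')"
  proof (cases "F = {}")
    case False
    have Fn: "F \<subseteq> {..<n}" using F by (simp add: clique_complex_def)
    then have fF: "finite F" using finite_subset by auto
    then have "Max (pos ` F) \<in> pos ` F" using False by (intro Max_in) auto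
    then obtain v where v: "v \<in> F" "pos v = Max (pos ` F)" by auto
    have "F - {v} \<subseteq> earlier v"
    proof
      fix u assume u: "u \<in> F - {v}"
      then have "pos u \<le> pos v" using v(2) fF by simp
      moreover have "pos u \<noteq> pos v" using inj_onD[OF inj, of u v] u v(1) Fn by auto
      moreover have "{u, v} \<in> E" using F u v(1) by (auto simp: clique_complex_def)
      ultimately show "u \<in> earlier v" using u Fn by (auto simp: earlier_def)
    qed
    moreover have "F = insert v (F - {v})" "v < n" using v(1) Fn by auto
    ultimately show ?thesis by blast
  qed simp
next
  assume "F = {} \<or> (\<exists>v<n. \<exists>F'. F' \<subseteq> earlier v \<and> F = insert v F')"
  then show "F \<in> clique_complex n E"
  proof
    assume "\<exists>v<n. \<exists>F'. F' \<subseteq> earlier v \<and> F = insert v F'"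
    then obtain v F' where v: "v < n" "F' \<subseteq> earlier v" "F = insert v F'" by blast
    have e: "u < n" "pos u < pos v" "{u, v} \<in> E" "{v, u} \<in> E" if "u \<in> F'" for u
      using v(2) that by (auto simp: earlier_def insert_commute)
    have "{a, b} \<in> E" if ab: "a \<in> F" "b \<in> F" "a \<noteq> b" for a b
    proof -
      consider "a = v" "b \<in> F'" | "b = v" "a \<in> F'" | "a \<in> F'" "b \<in> F'" using ab v(3) by blast
      then show ?thesis
        by cases (use e clique[OF v(1)] ab(3) in auto)
    qed
    moreover have "F \<subseteq> {..<n}" using v e by auto
    ultimately show ?thesis by (simp add: clique_complex_def)
  qed (simp add: clique_complex_def)
qed

lemma card_cliques_le:
  "card {F \<in> clique_complex n E. card F \<le> Suc k} = Suc (\<Sum>v<n. \<Sum>r\<le>k. deg v choose r)"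
  unfolding deg_def
  by (rule card_faces_by_pivot[OF finite_earlier _ _ clique_iff]) (auto simp: earlier_def)

text \<open>Here the last vertex of the support is the pivot, and it may be repeated, so
  \<open>Suc (deg v)\<close> variables remain available.\<close>

lemma card_clique_mons_le:
  "card {m. keys m \<in> clique_complex n E \<and> mon_deg m \<le> Suc k} =
    Suc (\<Sum>v<n. (Suc (deg v) + k) choose k)"
proof -
  let ?X = "{m :: nat mon. keys m \<in> clique_complex n E}"
  have "m \<in> ?X \<longleftrightarrow> m = 0 \<or>
    (\<exists>i<n. \<exists>m'. keys m' \<subseteq> insert i (earlier i) \<and> m = single i 1 + m')" for m
  proof
    assume m: "m \<in> ?X"
    show "m = 0 \<or> (\<exists>i<n. \<exists>m'. keys m' \<subseteq> insert i (earlier i) \<and> m = single i 1 + m')"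
    proof (cases "m = 0")
      case False
      then obtain v F' where v: "v < n" "F' \<subseteq> earlier v" "keys m = insert v F'"
        using m clique_iff by auto
      then have "v \<in> keys m" by simp
      then obtain m' where m': "m = single v 1 + m'" by (rule single_dvd)
      then have "keys m' \<subseteq> keys m" by (auto simp: keys_add_mon)
      then show ?thesis using v m' by blast
    qed simp
  next
    assume "m = 0 \<or> (\<exists>i<n. \<exists>m'. keys m' \<subseteq> insert i (earlier i) \<and> m = single i 1 + m')"
    then show "m \<in> ?X"
    proof
      assume "\<exists>i<n. \<exists>m'. keys m' \<subseteq> insert i (earlier i) \<and> m = single i 1 + m'"
      then obtain i m' where i: "i < n" "keys m' \<subseteq> insert i (earlier i)"
        "m = single i 1 + m'" by blast
      then have "keys m = insert i (keys m' - {i})"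
        by (auto simp: keys_add_mon)
      moreover have "keys m' - {i} \<subseteq> earlier i" using i(2) by auto
      ultimately show ?thesis using clique_iff i(1) by blast
    qed (simp add: clique_complex_def)
  qed
  from card_monomials_by_pivot[OF _ _ this, of k]
  have "card {m \<in> ?X. mon_deg m \<le> Suc k} = Suc (\<Sum>i<n. (card (insert i (earlier i)) + k) choose k)"
    by (auto simp: finite_earlier earlier_def)
  moreover have "card (insert i (earlier i)) = Suc (deg i)" for i
    unfolding deg_def using finite_earlier by (subst card_insert_disjoint) (auto simp: earlier_def)
  ultimately show ?thesis by simp
qed

end

section \<open>Leading monomials of degree two\<close>

text \<open>Counting degree by degree turns inclusions into equalities: first in degree at most 2, then, by
  \<open>lower\<close>, in all degrees.\<close>

lemma (in term_order) leading_set_eqI: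
  fixes \<phi> :: "('m \<Rightarrow>\<^sub>0 'k::field) \<Rightarrow> ('m \<Rightarrow>\<^sub>0 'k)" and dg :: "'m \<Rightarrow> nat"
  defines "lead X \<equiv> {leading lt (\<phi> f) | f. keys f \<subseteq> X \<and> f \<noteq> 0}"
  assumes add: "\<And>f g. \<phi> (f + g) = \<phi> f + \<phi> g"
    and scale: "\<And>c f. \<phi> (pm_scale c f) = pm_scale c (\<phi> f)"
    and keysM: "\<And>f. keys f \<subseteq> X \<Longrightarrow> keys (\<phi> f) \<subseteq> M"
    and inj: "\<And>f. keys f \<subseteq> X \<Longrightarrow> \<phi> f = 0 \<Longrightarrow> f = 0"
    and dg: "\<And>f d. keys f \<subseteq> X \<Longrightarrow>
      (\<forall>m\<in>keys (\<phi> f). dg m \<le> d) \<longleftrightarrow> (\<forall>m\<in>keys f. dg m \<le> d)"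
    and lt_dg: "\<And>a b. lt a b \<Longrightarrow> dg a \<le> dg b"
    and fin: "\<And>d. finite {x \<in> X. dg x \<le> Suc d}" "\<And>d. finite {x \<in> Vs. dg x \<le> Suc d}"
    and count: "\<And>d. card {x \<in> X. dg x \<le> Suc d} = card {x \<in> Vs. dg x \<le> Suc d}"
    and upper: "\<And>m. m \<in> lead X \<Longrightarrow> dg m \<le> 2 \<Longrightarrow> m \<in> Vs"
    and lower: "{x \<in> Vs. dg x \<le> 2} \<subseteq> lead X \<Longrightarrow> Vs \<subseteq> lead X"
  shows "lead X = Vs"
proof -
  \<comment> \<open>The map preserves degrees and the order refines them, so leading monomials of
    degree at most \<open>d\<close> come exactly from arguments of degree at most
    \<open>d\<close>.\<close>
  have slice: "{l \<in> lead X. dg l \<le> d} = lead {x \<in> X. dg x \<le> d}" for d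
  proof (intro equalityI subsetI)
    fix l assume "l \<in> {l \<in> lead X. dg l \<le> d}"
    then obtain f where f: "l = leading lt (\<phi> f)" "keys f \<subseteq> X" "f \<noteq> 0" "dg l \<le> d"
      unfolding lead_def by blast
    have "\<phi> f \<noteq> 0" using inj f(2,3) by blast
    then have "\<forall>m\<in>keys (\<phi> f). dg m \<le> d"
      using leading(2)[OF keysM[OF f(2)]] lt_dg f(1,4) by (metis order_trans)
    then have "keys f \<subseteq> {x \<in> X. dg x \<le> d}"
      using dg[OF f(2)] f(2) by blast
    then show "l \<in> lead {x \<in> X. dg x \<le> d}" using f(1,3) unfolding lead_def by blast
  next
    fix l assume "l \<in> lead {x \<in> X. dg x \<le> d}"
    then obtain f where f: "l = leading lt (\<phi> f)" "keys f \<subseteq> {x \<in> X. dg x \<le> d}" "f \<noteq> 0"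
      unfolding lead_def by blast
    then have fX: "keys f \<subseteq> X" by blast
    have "\<phi> f \<noteq> 0" using inj fX f(3) by blast
    then have "l \<in> keys (\<phi> f)" using leading(1)[OF keysM[OF fX]] f(1) by simp
    moreover have "\<forall>m\<in>keys (\<phi> f). dg m \<le> d" using dg[OF fX] f(2) by blast
    ultimately show "l \<in> {l \<in> lead X. dg l \<le> d}" using f(1,3) fX unfolding lead_def by blast
  qed
  have card_slice: "finite {l \<in> lead X. dg l \<le> Suc d}" "card {l \<in> lead X. dg l \<le> Suc d} = card {x \<in> Vs. dg x \<le> Suc d}" for d
  proof -
    have keysM': "keys (\<phi> f) \<subseteq> M" if "keys f \<subseteq> {x \<in> X. dg x \<le> Suc d}" for f
      by (rule keysM) (use that in blast)
    have inj': "f = 0" if "keys f \<subseteq> {x \<in> X. dg x \<le> Suc d}" "\<phi> f = 0" for f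
      by (rule inj) (use that in blast)+
    have "finite (lead {x \<in> X. dg x \<le> Suc d})"
      unfolding lead_def by (rule card_leading(1)[OF fin(1) add scale keysM' inj'])
    moreover have "card (lead {x \<in> X. dg x \<le> Suc d}) = card {x \<in> X. dg x \<le> Suc d}"
      unfolding lead_def by (rule card_leading(2)[OF fin(1) add scale keysM' inj'])
    ultimately show "finite {l \<in> lead X. dg l \<le> Suc d}"
      "card {l \<in> lead X. dg l \<le> Suc d} = card {x \<in> Vs. dg x \<le> Suc d}"
      by (simp_all only: slice count)
  qed
  have "{l \<in> lead X. dg l \<le> Suc 1} \<subseteq> {x \<in> Vs. dg x \<le> Suc 1}"
    using upper by auto
  then have "{l \<in> lead X. dg l \<le> Suc 1} = {x \<in> Vs. dg x \<le> Suc 1}"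
    using card_slice by (intro card_subset_eq fin) auto
  then have "{x \<in> Vs. dg x \<le> 2} \<subseteq> lead X" by (auto simp: numeral_2_eq_2)
  then have sub: "Vs \<subseteq> lead X" by (rule lower)
  have "{x \<in> Vs. dg x \<le> Suc d} = {l \<in> lead X. dg l \<le> Suc d}" for d
    using sub card_slice[of d] by (intro card_subset_eq) auto
  then have "lead X \<subseteq> Vs" by (metis (mono_tags, lifting) mem_Collect_eq subsetI le_SucI order_refl)
  with sub show ?thesis by blast
qed

lemma lookup_monomial_mult:
  "lookup (monomial k * h) (k + m) = (lookup h m :: 'k::field)"
  for k m :: "nat mon"
  using subset_UNIV[of "keys h"]
  by (induction h rule: poly_mapping_induct_on)
     (simp_all add: distrib_left lookup_add mult_single lookup_single when_def)

lemma leading_monomial_mult: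
  fixes h :: "(nat, 'k::field) mpoly"
  assumes "h \<noteq> 0"
  shows "leading revlex_less (monomial k * h) = k + leading revlex_less h"
proof -
  interpret R: term_order revlex_less UNIV by (rule revlex_term_order)
  note lead = R.leading[OF subset_UNIV assms]
  show ?thesis
  proof (rule R.leading_eqI[OF subset_UNIV])
    show "k + leading revlex_less h \<in> keys (monomial k * h)"
      using lead(1) by (simp add: in_keys_iff lookup_monomial_mult)
  next
    fix m assume "m \<in> keys (monomial k * h)" and neq: "m \<noteq> k + leading revlex_less h"
    then obtain a b where "m = a + b" "a \<in> keys (monomial k :: (nat, 'k) mpoly)"
      "b \<in> keys h" using keys_mult by blast
    then have m: "m = k + b" "b \<in> keys h" by (auto split: if_splits)
    then have "revlex_less b (leading revlex_less h)" using lead(2) neq by blast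
    then show "revlex_less m (k + leading revlex_less h)" unfolding m(1) by (rule revlex_less_add)
  qed
qed

text \<open>Disjointness keeps the leading term alive. The other terms either vanish or stay below
  it, and different sets disjoint from \<open>H\<close> cannot produce the same union, so nothing
  cancels.\<close>

lemma leading_wedge_monomial:
  fixes h :: "'k::field ext"
  assumes h: "h \<in> carrier (ext_ring n)" "h \<noteq> 0" and H: "finite H" "H \<inter> leading ext_less h = {}"
  shows "wedge (ext_monomial H) h \<noteq> 0"
    and "leading ext_less (wedge (ext_monomial H) h) = H \<union> leading ext_less h"
proof -
  interpret R: term_order ext_less "{F. finite F}" by (rule ext_term_order)
  have fin: "keys h \<subseteq> {F. finite F}"
    using h(1) finite_subset[OF _ finite_lessThan] by (auto simp: ext_carrier_iff)
  note lead = R.leading[OF fin h(2)]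
  define l where "l = leading ext_less h"
  have l: "l \<in> keys h" "finite l" "H \<inter> l = {}"
    using lead(1) fin H(2) by (auto simp: l_def)
  have "lookup (wedge (ext_monomial H) h) (H \<union> l) =
      (\<Sum>G\<in>keys h. lookup (ext_term H G (lookup h G)) (H \<union> l))"
    by (simp add: wedge_superset[where A = "{H}" and B = "keys h"] lookup_sum)
  also have "\<dots> = (\<Sum>G\<in>keys h. if G = l then ext_sign H l * lookup h l else 0)"
  proof (rule sum.cong[OF refl])
    fix G
    have "H \<inter> G = {} \<Longrightarrow> H \<union> G = H \<union> l \<Longrightarrow> G = l" using l(3) by blast
    then show "lookup (ext_term H G (lookup h G)) (H \<union> l) =
        (if G = l then ext_sign H l * lookup h l else 0)"
      using l(3) by (auto simp: ext_term_def lookup_single when_def)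
  qed
  also have "\<dots> = ext_sign H l * lookup h l" using l(1) by simp
  also have "\<dots> \<noteq> 0" using l(1) by (simp add: in_keys_iff ext_sign_def)
  finally have key: "H \<union> l \<in> keys (wedge (ext_monomial H) h)" by (simp add: in_keys_iff)
  then show "wedge (ext_monomial H) h \<noteq> 0" by auto
  have form: "\<exists>G\<in>keys h. H \<inter> G = {} \<and> m = H \<union> G" if "m \<in> keys (wedge (ext_monomial H) h)" for m
    using keys_wedge[OF that] by simp
  have "leading ext_less (wedge (ext_monomial H) h) = H \<union> l"
  proof (rule R.leading_eqI[OF _ key])
    show "keys (wedge (ext_monomial H) h) \<subseteq> {F. finite F}"
    proof
      fix m assume "m \<in> keys (wedge (ext_monomial H) h)"
      from form[OF this] show "m \<in> {F. finite F}" using fin H(1) by auto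
    qed
    fix m assume "m \<in> keys (wedge (ext_monomial H) h)" and neq: "m \<noteq> H \<union> l"
    from form[OF this(1)] obtain G where G: "G \<in> keys h" "H \<inter> G = {}" "m = H \<union> G" by blast
    then have "ext_less G l" using lead(2)[of G] neq by (auto simp: l_def)
    then show "ext_less m (H \<union> l)"
      unfolding G(3) using ext_less_union[of G l H] G fin H(1) l by (auto simp: Int_commute)
  qed
  then show "leading ext_less (wedge (ext_monomial H) h) = H \<union> leading ext_less h" by (simp add: l_def)
qed

lemma mon_deg_1_form:
  assumes "mon_deg m = 1" obtains i where "m = single i 1"
proof -
  have "m \<noteq> 0" using assms by auto
  then obtain i where "i \<in> keys m" by (meson all_not_in_conv keys_eq_empty)
  then obtain m' where m': "m = single i 1 + m'" by (rule single_dvd)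
  then have "mon_deg m' = 0" using assms by simp
  then have "m = single i 1" using m' by (simp add: mon_deg_eq_0_iff)
  then show ?thesis by (rule that)
qed

lemma mon_deg_2_form:
  assumes "mon_deg m = 2" "j \<in> keys m"
  obtains a where "m = single a 1 + single j 1"
proof -
  obtain m' where m': "m = single j 1 + m'" using assms(2) by (rule single_dvd)
  then have "mon_deg m' = 1" using assms(1) by simp
  then obtain a where "m' = single a 1" by (rule mon_deg_1_form)
  then have "m = single a 1 + single j 1" using m' by (simp add: add.commute)
  then show ?thesis by (rule that)
qed

lemma lookup_pair: "lookup (single a 1 + single b 1 :: nat mon) k =
    (if k = a then 1 else 0) + (if k = b then 1 else 0)"
  by (simp add: lookup_add lookup_single when_def)

text \<open>In reverse lexicographic order a smaller monomial has the higher exponent at the last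
  difference. If no variable beyond \<open>x_j\<close> is allowed, it must contain
  \<open>x_j\<close>, and its other factor cannot come before \<open>x_i\<close>.\<close>

lemma revlex_below_pair:
  assumes ij: "i \<le> j" and m: "mon_deg m = 2" "revlex_less m (single i 1 + single j 1)"
    and keys: "\<And>b. b \<in> keys m \<Longrightarrow> b \<le> j"
  obtains a where "i \<le> a" "a \<le> j" "m = single a 1 + single j 1"
proof -
  let ?p = "single i 1 + single j 1 :: nat mon"
  obtain k where k: "lookup m k > lookup ?p k"
    "\<And>l. l > k \<Longrightarrow> lookup m l = lookup ?p l"
    using m by (auto simp: revlex_less_def)
  have "k \<in> keys m" using k(1) by (simp add: in_keys_iff)
  then have "k \<le> j" by (rule keys)
  have "j \<in> keys m"
  proof (cases "k = j")
    case False
    then have "lookup m j = lookup ?p j" using k(2) \<open>k \<le> j\<close> by simp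
    then show ?thesis by (simp add: in_keys_iff lookup_add lookup_single when_def)
  qed (use \<open>k \<in> _\<close> in simp)
  with m(1) obtain a where a: "m = single a 1 + single j 1" by (rule mon_deg_2_form)
  have "a \<in> keys m" by (simp add: a in_keys_iff lookup_add lookup_single when_def)
  then have "a \<le> j" by (rule keys)
  moreover have "i \<le> a"
  proof (rule ccontr)
    assume "\<not> i \<le> a"
    then have "a < i" by simp
    have "k = a"
      using k(1) ij \<open>a < i\<close> unfolding a lookup_pair by (auto split: if_splits)
    then have "lookup m i = lookup ?p i" using k(2) \<open>a < i\<close> by simp
    then show False using \<open>a < i\<close> unfolding a lookup_pair by (auto split: if_splits)
  qed
  ultimately show ?thesis using that a by blast
qed

lemma eval_at_eq_0:
  assumes "\<And>m. m \<in> keys p \<Longrightarrow> \<exists>v\<in>keys m. y v = 0"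
  shows "eval_at y p = 0"
  unfolding eval_mpoly_def
proof (rule sum.neutral, rule ballI)
  fix m assume "m \<in> keys p"
  then obtain v where "v \<in> keys m" "y v = 0" using assms by blast
  then have "(\<Prod>v\<in>keys m. y v ^ lookup m v) = 0"
    by (intro prod_zero) (auto simp: in_keys_iff)
  then show "lookup p m * (\<Prod>v\<in>keys m. y v ^ lookup m v) = 0" by simp
qed

lemma ext_pair_eq_0:
  assumes "\<And>F. F \<in> keys p \<Longrightarrow> \<exists>v\<in>F. y v = 0 \<and> y' v = 0"
  shows "ext_pair y y' p = 0"
  unfolding ext_pair_def
proof (rule sum.neutral, rule ballI)
  fix F assume "F \<in> keys p"
  then obtain v where v: "v \<in> F" "y v = 0" "y' v = 0" using assms by blast
  have "alt_form y y' F = 0"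
  proof (cases "card F = 2")
    case True
    then obtain a b where "F = {a, b}" by (auto simp: card_2_iff)
    then show ?thesis using v by (auto simp: alt_form_def min_def max_def)
  qed (simp add: alt_form_def)
  then show "lookup p F * alt_form y y' F = 0" by simp
qed

lemma sum_lessThan_eq:
  fixes f :: "nat \<Rightarrow> 'a::comm_monoid_add"
  assumes "k \<le> n" "\<And>i. k \<le> i \<Longrightarrow> f i = 0" shows "(\<Sum>i<n. f i) = (\<Sum>i<k. f i)"
  by (rule sum.mono_neutral_right) (use assms in auto)

text \<open>The genericity needed in degree 2. For each \<open>j\<close> the vectors \<open>z v\<close> lie in \<open>K\<^bsup>j+1\<^esup>\<close>, and \<open>A\<^sup>T\<close>
  maps them to vectors supported on faces; polynomials vanishing on those faces therefore vanish
  at \<open>z v\<close> after the change of coordinates.\<close>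

definition adapted :: "nat \<Rightarrow> nat set set \<Rightarrow> 'k::field mat \<Rightarrow> nat \<Rightarrow> nat \<Rightarrow> bool" where
  "adapted n \<Delta> A j s \<longleftrightarrow> (\<exists>(S :: nat set) z z'.
     (\<forall>v\<in>S. z v j \<noteq> 0 \<and> (\<exists>G\<in>\<Delta>.
        (\<forall>a<n. a \<notin> G \<longrightarrow> (\<Sum>k<Suc j. A $$ (k, a) * z v k) = 0) \<and>
        (\<forall>a<n. a \<notin> G \<longrightarrow> (\<Sum>k<j. A $$ (k, a) * z' v k) = - A $$ (Suc j, a)))) \<and>
     (\<forall>\<alpha>. (\<forall>v\<in>S. (\<Sum>k\<in>{Suc j - s..j}. \<alpha> k * z v k) = 0) \<longrightarrow> (\<forall>k\<in>{Suc j - s..j}. \<alpha> k = 0)))"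

sublocale elimination_order \<subseteq> degree_sequence n deg
  by (rule degree_sequence)

section \<open>Generic vectors from the cliques and the upper bounds in degree 2\<close>

context elimination_order
begin

abbreviation cliques :: "nat set set" where
  "cliques \<equiv> clique_complex n E"

lemma generic_adapted_single:
  assumes j: "j < n"
  shows "\<exists>\<phi>. nonzero_polyfun n \<phi> \<and> (\<forall>A :: 'k::field_char_0 mat. \<phi> A \<noteq> 0 \<longrightarrow> adapted n cliques A j (tail (n - Suc j)))"
proof -
  define t where "t = n - Suc j"
  define S where "S = {v. v < n \<and> t \<le> deg v}"
  have S: "S \<subseteq> {..<n}" "card S = tail t" by (auto simp: S_def tail_def)
  have tle: "tail t \<le> Suc j" using tail_le[of t] j by (cases "tail t = 0") (auto simp: t_def)
  have "\<exists>N. N \<subseteq> earlier v \<and> card N = t" if "v \<in> S" for v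
    using that obtain_subset_with_card_n[of t "earlier v"] by (auto simp: S_def deg_def)
  then obtain N where N: "\<And>v. v \<in> S \<Longrightarrow> N v \<subseteq> earlier v" "\<And>v. v \<in> S \<Longrightarrow> card (N v) = t" by metis
  \<comment> \<open>Any \<open>t\<close> earlier neighbours together with \<open>v\<close> form a
    clique of size \<open>n - j\<close>, the size that leaves \<open>j\<close> equations in
    \<open>j + 1\<close> unknowns.\<close>
  define F where "F v = insert v (N v)" for v
  have F: "v \<in> F v \<and> F v \<subseteq> {..<n} \<and> card (F v) = n - j" "F v \<in> cliques" if v: "v \<in> S" for v
  proof -
    have "finite (N v)" using N(1)[OF v] finite_earlier finite_subset by blast
    moreover have "v \<notin> N v" using N(1)[OF v] by (auto simp: earlier_def)
    moreover have "N v \<subseteq> {..<n}" using N(1)[OF v] by (auto simp: earlier_def)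
    ultimately show "v \<in> F v \<and> F v \<subseteq> {..<n} \<and> card (F v) = n - j"
      using N(2)[OF v] v j by (auto simp: F_def S_def t_def)
    show "F v \<in> cliques"
      unfolding clique_iff using N(1)[OF v] v by (auto simp: F_def S_def)
  qed
  have posF: "pos a < pos v" if "v \<in> S" "a \<in> F v" "a \<noteq> v" for v a
    using N(1)[OF that(1)] that(2,3) by (auto simp: F_def earlier_def)
  have "\<exists>\<phi>. nonzero_polyfun n \<phi> \<and> (\<forall>A::'k mat. \<phi> A \<noteq> 0 \<longrightarrow> (\<exists>z. kernel_family n j S F A z))"
  proof (rule generic_kernel_vectors[OF j S(1) _ _ inj])
    fix v assume "v \<in> S"
    then show "v \<in> F v \<and> F v \<subseteq> {..<n} \<and> card (F v) = n - j" by (rule F(1))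
  next
    fix v a assume "v \<in> S" "a \<in> F v" "a \<noteq> v"
    then show "pos a < pos v" by (rule posF)
  qed (use S(2) tle in simp)
  then obtain \<phi>1 where \<phi>1: "nonzero_polyfun n \<phi>1"
    "\<And>A::'k mat. \<phi>1 A \<noteq> 0 \<Longrightarrow> \<exists>z. kernel_family n j S F A z" by blast
  have "\<exists>\<phi>. nonzero_polyfun n \<phi> \<and> (\<forall>A::'k mat. \<phi> A \<noteq> 0 \<longrightarrow> regular_rows n j (F v) A)" if "v \<in> S" for v
    using F(1)[OF that] j by (intro generic_minor) auto
  then obtain \<phi>2 where \<phi>2: "\<And>v. v \<in> S \<Longrightarrow> nonzero_polyfun n (\<phi>2 v)"
    "\<And>v A. v \<in> S \<Longrightarrow> \<phi>2 v (A :: 'k mat) \<noteq> 0 \<Longrightarrow> regular_rows n j (F v) A"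
    by metis
  define \<phi> where "\<phi> A = \<phi>1 A * (\<Prod>v\<in>S. \<phi>2 v A)" for A
  have "nonzero_polyfun n \<phi>"
    unfolding \<phi>_def by (intro nonzero_polyfun_mult nonzero_polyfun_prod \<phi>1(1) \<phi>2(1))
  moreover have "adapted n cliques A j (tail t)" if A: "\<phi> A \<noteq> 0" for A
  proof -
    have finS: "finite S" using S(1) finite_subset by blast
    have nz: "\<phi>1 A \<noteq> 0" "\<And>v. v \<in> S \<Longrightarrow> \<phi>2 v A \<noteq> 0"
      using A finS by (auto simp: \<phi>_def)
    obtain z where "kernel_family n j S F A z" using \<phi>1(2) nz(1) by blast
    note z = this[unfolded kernel_family_def S(2)]
    note z1 = z[THEN conjunct1] and z2 = z[THEN conjunct2, THEN conjunct1]
      and z3 = z[THEN conjunct2, THEN conjunct2]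
    have rows: "\<forall>w. (\<forall>a<n. a \<notin> F v \<longrightarrow> (\<Sum>k<j. A $$ (k, a) * w k) = 0) \<longrightarrow> (\<forall>k<j. w k = 0)"
      and rows': "\<forall>b. \<exists>w. \<forall>a<n. a \<notin> F v \<longrightarrow> (\<Sum>k<j. A $$ (k, a) * w k) = b a" if v: "v \<in> S" for v
      by (rule \<phi>2(2)[OF v nz(2)[OF v], unfolded regular_rows_def, THEN conjunct1])
         (rule \<phi>2(2)[OF v nz(2)[OF v], unfolded regular_rows_def, THEN conjunct2])
    \<comment> \<open>The solution, continued by 0 at \<open>j\<close> and 1 at
      \<open>j + 1\<close>, is to be sent to a vector supported on \<open>F v\<close>. Solvability
      holds for every right-hand side, so the row index outside the matrix at
      \<open>j = n - 1\<close> does no harm.\<close>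
    have "\<forall>v\<in>S. \<exists>w. \<forall>a<n. a \<notin> F v \<longrightarrow> (\<Sum>k<j. A $$ (k, a) * w k) = - A $$ (Suc j, a)"
      by (rule ballI) (rule spec[OF rows'])
    from bchoice[OF this] obtain z' where z': "\<forall>v\<in>S. \<forall>a<n. a \<notin> F v \<longrightarrow>
        (\<Sum>k<j. A $$ (k, a) * z' v k) = - A $$ (Suc j, a)" ..
    \<comment> \<open>With last coordinate 0 the vector would lie in the kernel of the invertible
      block of the first \<open>j\<close> rows and hence be 0.\<close>
    have zj: "z v j \<noteq> 0" if v: "v \<in> S" for v
    proof
      assume zero: "z v j = 0"
      then have "\<forall>a<n. a \<notin> F v \<longrightarrow> (\<Sum>k<j. A $$ (k, a) * z v k) = 0"
        using bspec[OF z1 v] by simp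
      then have "\<forall>k<j. z v k = 0" by (rule mp[OF spec[OF rows[OF v]]])
      then show False using bspec[OF z2 v] zero by (auto simp: less_Suc_eq)
    qed
    have z_indep: "\<forall>k\<in>{Suc j - tail t..j}. \<alpha> k = 0" if \<alpha>: "\<forall>v\<in>S. (\<Sum>k\<in>{Suc j - tail t..j}. \<alpha> k * z v k) = 0" for \<alpha>
    proof -
      have shift: "(\<Sum>k\<in>{Suc j - tail t..j}. g k) = (\<Sum>k<tail t. g (Suc j - tail t + k))" for g :: "nat \<Rightarrow> 'k"
        using tle by (intro sum.reindex_bij_witness[of _ "\<lambda>k. Suc j - tail t + k" "\<lambda>k. k - (Suc j - tail t)"]) auto
      have "\<forall>k<tail t. \<alpha> (Suc j - tail t + k) = 0"
        using \<alpha> unfolding shift by (rule spec[OF z3, THEN mp])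
      then show ?thesis
      proof (intro ballI)
        fix k assume "\<forall>k<tail t. \<alpha> (Suc j - tail t + k) = 0" "k \<in> {Suc j - tail t..j}"
        then show "\<alpha> k = 0" using tle by (auto dest!: spec[of _ "k - (Suc j - tail t)"])
      qed
    qed
    show ?thesis
      unfolding adapted_def
    proof (rule exI[of _ S], rule exI[of _ z], rule exI[of _ z'], intro conjI ballI allI impI)
      fix v assume v: "v \<in> S"
      show "z v j \<noteq> 0" by (rule zj[OF v])
      show "\<exists>G\<in>cliques. (\<forall>a<n. a \<notin> G \<longrightarrow> (\<Sum>k<Suc j. A $$ (k, a) * z v k) = 0) \<and>
          (\<forall>a<n. a \<notin> G \<longrightarrow> (\<Sum>k<j. A $$ (k, a) * z' v k) = - A $$ (Suc j, a))"
        using F(2)[OF v] bspec[OF z1 v] bspec[OF z' v] by (intro bexI[of _ "F v"] conjI)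
    next
      fix \<alpha> k assume "\<forall>v\<in>S. (\<Sum>k\<in>{Suc j - tail t..j}. \<alpha> k * z v k) = 0" "k \<in> {Suc j - tail t..j}"
      then show "\<alpha> k = 0" using z_indep[of \<alpha>] by simp
    qed
  qed
  ultimately show ?thesis unfolding t_def by blast
qed

lemma generic_adapted:
  obtains \<phi> where "nonzero_polyfun n \<phi>"
    "\<And>A j. \<phi> A \<noteq> 0 \<Longrightarrow> j < n \<Longrightarrow> adapted n cliques (A :: 'k::field_char_0 mat) j (tail (n - Suc j))"
proof -
  have "\<forall>j\<in>{..<n}. \<exists>\<phi>. nonzero_polyfun n \<phi> \<and>
      (\<forall>A :: 'k mat. \<phi> A \<noteq> 0 \<longrightarrow> adapted n cliques A j (tail (n - Suc j)))"
    by (intro ballI generic_adapted_single) simp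
  then obtain \<phi> where \<phi>: "\<And>j. j \<in> {..<n} \<Longrightarrow> nonzero_polyfun n (\<phi> j)"
    "\<And>j A. j \<in> {..<n} \<Longrightarrow> \<phi> j (A :: 'k mat) \<noteq> 0 \<Longrightarrow> adapted n cliques A j (tail (n - Suc j))"
    by metis
  show ?thesis
  proof (rule that[of "\<lambda>A. \<Prod>j<n. \<phi> j A"])
    show "nonzero_polyfun n (\<lambda>A. \<Prod>j<n. \<phi> j A)" by (intro nonzero_polyfun_prod \<phi>(1))
    fix A j assume "(\<Prod>j<n. \<phi> j A) \<noteq> 0" "j < n"
    then show "adapted n cliques A j (tail (n - Suc j))" using \<phi>(2)[of j A] by auto
  qed
qed

lemma singleton_clique: "v < n \<Longrightarrow> {v} \<in> cliques" and empty_clique: "{} \<in> cliques"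
  by (auto simp: clique_complex_def)

lemma cliques_subset: "F \<in> cliques \<Longrightarrow> G \<subseteq> F \<Longrightarrow> G \<in> cliques"
  by (auto simp: clique_complex_def)

lemma card_nonclique:
  assumes "F \<subseteq> {..<n}" "F \<notin> cliques" shows "2 \<le> card F"
proof (rule ccontr)
  assume "\<not> 2 \<le> card F"
  moreover have "finite F" using assms(1) finite_subset by blast
  ultimately consider "F = {}" | v where "F = {v}"
    using card_1_singleton_iff[of F] by (cases "card F") (auto simp: card_Suc_eq)
  then show False
    using assms singleton_clique empty_clique by cases auto
qed

definition nonface_mons :: "nat mon set" where
  "nonface_mons = {m. keys m \<subseteq> {..<n} \<and> keys m \<notin> cliques}"

lemma nonface_mon_deg:
  assumes "m \<in> nonface_mons" shows "2 \<le> mon_deg m"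
proof -
  have "card (keys m) = (\<Sum>i\<in>keys m. 1)" by simp
  also have "\<dots> \<le> mon_deg m"
    unfolding mon_deg_def by (rule sum_mono) (auto simp: in_keys_iff Suc_le_eq)
  finally show ?thesis using assms card_nonclique[of "keys m"] by (simp add: nonface_mons_def)
qed

lemma sym_upper:
  fixes A :: "'k::field_char_0 mat"
  assumes adapted: "\<And>j. j < n \<Longrightarrow> adapted n cliques A j (tail (n - Suc j))"
    and f: "keys f \<subseteq> nonface_mons" "f \<noteq> 0" "\<And>m. m \<in> keys f \<Longrightarrow> mon_deg m \<le> 2"
    and nonzero: "poly_act n A f \<noteq> 0"
  shows "leading revlex_less (poly_act n A f) \<in> sym_mons"
proof (rule ccontr)
  interpret R: term_order revlex_less UNIV by (rule revlex_term_order)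
  define g where "g = poly_act n A f"
  define m where "m = leading revlex_less g"
  assume "leading revlex_less (poly_act n A f) \<notin> sym_mons"
  then have m_not: "m \<notin> sym_mons" by (simp add: m_def g_def)
  have m_key: "m \<in> keys g" and m_lead: "\<And>m'. m' \<in> keys g \<Longrightarrow> m' \<noteq> m \<Longrightarrow> revlex_less m' m"
    using R.leading[OF subset_UNIV nonzero] by (auto simp: m_def g_def)
  have deg2: "mon_deg m' = 2" if "m' \<in> keys g" for m'
  proof -
    obtain m0 where "m0 \<in> keys f" "mon_deg m' = mon_deg m0"
      using mon_deg_keys_poly_act \<open>m' \<in> _\<close> unfolding g_def by blast
    then show ?thesis using f(1,3) nonface_mon_deg[of m0] by fastforce
  qed
  have "g \<in> polys {..<n}" unfolding g_def by (rule poly_act_polys)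
  then have m_vars: "keys m \<subseteq> {..<n}" using m_key by (auto simp: polys_def)
  have "m \<noteq> 0" using deg2[OF m_key] by auto
  define j where "j = Max (keys m)"
  have j_key: "j \<in> keys m" using \<open>m \<noteq> 0\<close> by (simp add: j_def)
  obtain i where m: "m = single i 1 + single j 1"
    by (rule mon_deg_2_form[OF deg2[OF m_key] j_key])
  have "i \<in> keys m" by (simp add: m in_keys_iff lookup_add lookup_single when_def)
  then have ij: "i \<le> j" by (simp add: j_def)
  have jn: "j < n" using j_key m_vars by auto
  have not_low: "\<not> low i j"
  proof
    assume "low i j"
    then have "m \<in> sym_gens" using ij jn m unfolding sym_gens_def by blast
    then have "m \<in> sym_mons" unfolding sym_mons_def using m_vars by (auto intro!: bexI[of _ m] exI[of _ 0])
    then show False using m_not by simp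
  qed
  define s where "s = tail (n - Suc j)"
  \<comment> \<open>Failure of \<open>low\<close> places \<open>i\<close> among the last
    \<open>s\<close> of the coordinates \<open>0, ..., j\<close>, precisely where the kernel vectors
    are independent.\<close>
  have ci: "Suc j - s \<le> i" using not_low jn by (simp add: low_def s_def)
  obtain S :: "nat set" and z z' :: "nat \<Rightarrow> nat \<Rightarrow> 'k" where
    adapted_S: "\<forall>v\<in>S. z v j \<noteq> 0 \<and> (\<exists>G\<in>cliques.
        (\<forall>a<n. a \<notin> G \<longrightarrow> (\<Sum>k<Suc j. A $$ (k, a) * z v k) = 0) \<and>
        (\<forall>a<n. a \<notin> G \<longrightarrow> (\<Sum>k<j. A $$ (k, a) * z' v k) = - A $$ (Suc j, a)))"
    and indep: "\<forall>\<alpha>. (\<forall>v\<in>S. (\<Sum>k\<in>{Suc j - s..j}. \<alpha> k * z v k) = 0) \<longrightarrow> (\<forall>k\<in>{Suc j - s..j}. \<alpha> k = 0)"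
    using adapted[OF jn] unfolding adapted_def s_def[symmetric] by (elim exE conjE)
  define \<beta> where "\<beta> a = lookup g (single a 1 + single j 1)" for a
  define \<alpha> where "\<alpha> k = (if i \<le> k then \<beta> k else 0)" for k
  have "(\<Sum>k\<in>{Suc j - s..j}. \<alpha> k * z v k) = 0" if v: "v \<in> S" for v
  proof -
    \<comment> \<open>Filling up with zeros kills every monomial that contains a variable after
      \<open>x_j\<close>.\<close>
    define x where "x k = (if k \<le> j then z v k else 0)" for k
    have zj: "z v j \<noteq> 0" using adapted_S v by simp
    obtain G where G: "G \<in> cliques" "\<forall>a<n. a \<notin> G \<longrightarrow> (\<Sum>k<Suc j. A $$ (k, a) * z v k) = 0"
      using bspec[OF adapted_S v] by (elim conjE bexE)
    have y0: "(\<Sum>k<n. A $$ (k, a) * x k) = 0" if "a < n" "a \<notin> G" for a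
    proof -
      have "(\<Sum>k<n. A $$ (k, a) * x k) = (\<Sum>k<Suc j. A $$ (k, a) * x k)"
        using jn by (intro sum_lessThan_eq) (auto simp: x_def)
      also have "\<dots> = (\<Sum>k<Suc j. A $$ (k, a) * z v k)" by (intro sum.cong) (auto simp: x_def)
      finally show ?thesis using G(2) that by simp
    qed
    have "eval_at x g = eval_at (\<lambda>a. \<Sum>k<n. A $$ (k, a) * x k) f"
      unfolding g_def by (rule eval_at_poly_act)
    also have "\<dots> = 0"
    proof (rule eval_at_eq_0)
      fix m' assume "m' \<in> keys f"
      then have "m' \<in> nonface_mons" using f(1) by blast
      then have m': "keys m' \<subseteq> {..<n}" "keys m' \<notin> cliques"
        by (simp_all add: nonface_mons_def)
      then obtain a where "a \<in> keys m'" "a \<notin> G" using cliques_subset[OF G(1)] by blast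
      then show "\<exists>a\<in>keys m'. (\<Sum>k<n. A $$ (k, a) * x k) = 0" using y0 m'(1) by blast
    qed
    finally have eval0: "(\<Sum>m'\<in>keys g. lookup g m' * mon_val x m') = 0"
      by (simp add: eval_mpoly_def mon_val_def)
    define p where "p a = (single a 1 + single j 1 :: nat mon)" for a
    have p_inj: "inj_on p {i..j}"
    proof (rule inj_onI)
      fix a b assume "p a = p b"
      then have "single a 1 = (single b 1 :: nat mon)" by (simp add: p_def)
      from arg_cong[OF this, of keys] show "a = b" by simp
    qed
    \<comment> \<open>Every monomial of \<open>g\<close> is at most \<open>m\<close>, so without a
      later variable it has the form \<open>x_a x_j\<close> with
      \<open>i \<le> a \<le> j\<close>.\<close>
    have out: "mon_val x m' = 0" if m': "m' \<in> keys g" "m' \<notin> p ` {i..j}" for m'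
    proof -
      have "\<exists>b\<in>keys m'. b > j"
      proof (rule ccontr)
        assume "\<not> (\<exists>b\<in>keys m'. b > j)"
        then have le: "\<And>b. b \<in> keys m' \<Longrightarrow> b \<le> j" by auto
        have "m' \<noteq> m" using m'(2) ij m by (auto simp: p_def)
        then have "revlex_less m' (single i 1 + single j 1)"
          using m_lead[OF m'(1)] m by simp
        then obtain a where "i \<le> a" "a \<le> j" "m' = single a 1 + single j 1"
          by (rule revlex_below_pair[OF ij deg2[OF m'(1)] _ le])
        then show False using m'(2) by (auto simp: p_def)
      qed
      then obtain b where b: "b \<in> keys m'" "b > j" by blast
      then have "x b ^ lookup m' b = 0" by (simp add: x_def in_keys_iff)
      then show ?thesis unfolding mon_val_def using b(1) by (intro prod_zero) auto
    qed
    have "(\<Sum>m'\<in>keys g. lookup g m' * mon_val x m') =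
        (\<Sum>m'\<in>p ` {i..j}. lookup g m' * mon_val x m')"
      by (rule sum.mono_neutral_cong) (auto simp: in_keys_iff[symmetric] out dest: not_in_keys_iff_lookup_eq_zero[THEN iffD1])
    also have "\<dots> = (\<Sum>a\<in>{i..j}. \<beta> a * (z v a * z v j))"
      unfolding sum.reindex[OF p_inj] by (intro sum.cong refl) (simp add: p_def \<beta>_def mon_val_add x_def)
    also have "\<dots> = (\<Sum>a\<in>{i..j}. \<beta> a * z v a) * z v j" by (simp add: sum_distrib_right mult.assoc)
    \<comment> \<open>The common factor \<open>z v j\<close> is nonzero and cancels; a linear
      relation remains.\<close>
    finally have "(\<Sum>a\<in>{i..j}. \<beta> a * z v a) = 0" using eval0 zj by simp
    moreover have "(\<Sum>k\<in>{Suc j - s..j}. \<alpha> k * z v k) = (\<Sum>a\<in>{i..j}. \<beta> a * z v a)"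
      using ci by (intro sum.mono_neutral_cong_right) (auto simp: \<alpha>_def)
    ultimately show ?thesis by simp
  qed
  then have "\<forall>k\<in>{Suc j - s..j}. \<alpha> k = 0" by (intro spec[OF indep, THEN mp] ballI)
  then have "\<alpha> i = 0" using ci ij by simp
  then have "lookup g m = 0" by (simp add: \<alpha>_def \<beta>_def m)
  then show False using m_key by (simp add: in_keys_iff)
qed

definition nonfaces :: "nat set set" where
  "nonfaces = {F. F \<subseteq> {..<n} \<and> F \<notin> cliques}"

lemma ext_upper:
  fixes A :: "'k::field_char_0 mat"
  assumes adapted: "\<And>j. j < n \<Longrightarrow> adapted n cliques A j (tail (n - Suc j))"
    and f: "keys f \<subseteq> nonfaces" "f \<noteq> 0" "\<And>F. F \<in> keys f \<Longrightarrow> card F \<le> 2"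
    and nonzero: "ext_act n A f \<noteq> 0"
  shows "leading ext_less (ext_act n A f) \<subseteq> {..<n} \<and> leading ext_less (ext_act n A f) \<notin> shifted"
proof (rule ccontr)
  interpret R: term_order ext_less "{F. finite F}" by (rule ext_term_order)
  define g where "g = ext_act n A f"
  define F0 where "F0 = leading ext_less g"
  assume contra: "\<not> (leading ext_less (ext_act n A f) \<subseteq> {..<n} \<and> leading ext_less (ext_act n A f) \<notin> shifted)"
  have g_sub: "F \<subseteq> {..<n}" if "F \<in> keys g" for F
    using ext_act_closed[of n A f] that by (simp add: g_def ext_carrier_iff)
  then have g_fin: "keys g \<subseteq> {F. finite F}" using finite_subset[OF _ finite_lessThan] by blast
  have F0_key: "F0 \<in> keys g" and F0_lead: "\<And>F. F \<in> keys g \<Longrightarrow> F \<noteq> F0 \<Longrightarrow> ext_less F F0"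
    using R.leading[OF g_fin] nonzero by (auto simp: F0_def g_def)
  have f2: "card F = 2" if "F \<in> keys f" for F
    using f(1) f(3)[OF that] that card_nonclique[of F] by (force simp: nonfaces_def)
  have card2: "card F = 2" if "F \<in> keys g" for F
  proof -
    have "finite F'" if "F' \<in> keys f" for F' using f2[OF that] card.infinite by fastforce
    then show ?thesis using card_keys_ext_act[of f F n A] f2 that by (auto simp: g_def)
  qed
  have F0_shifted: "F0 \<in> shifted" using contra g_sub[OF F0_key] by (simp add: F0_def g_def)
  obtain i j where F0: "F0 = {i, j}" "i < j"
    using card2[OF F0_key] by (metis card_2_iff insert_commute linorder_neqE_nat)
  have jn: "j < n" using g_sub[OF F0_key] F0(1) by simp
  have not_low: "\<not> low i (j - 1)" using F0_shifted F0 by (simp add: shifted_def)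
  \<comment> \<open>The vectors adapted to \<open>h\<close> live in one dimension less than those
    needed for \<open>j\<close>; this is the index shift between the two algebras.\<close>
  define h where "h = j - 1"
  have j: "j = Suc h" "i \<le> h" "h < n" using F0(2) jn by (auto simp: h_def)
  define s where "s = tail (n - Suc h)"
  have ci: "Suc h - s \<le> i" using not_low j by (simp add: low_def s_def)
  obtain S :: "nat set" and z z' :: "nat \<Rightarrow> nat \<Rightarrow> 'k" where
    adapted_S: "\<forall>v\<in>S. z v h \<noteq> 0 \<and> (\<exists>G\<in>cliques.
        (\<forall>a<n. a \<notin> G \<longrightarrow> (\<Sum>k<Suc h. A $$ (k, a) * z v k) = 0) \<and>
        (\<forall>a<n. a \<notin> G \<longrightarrow> (\<Sum>k<h. A $$ (k, a) * z' v k) = - A $$ (Suc h, a)))"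
    and indep: "\<forall>\<alpha>. (\<forall>v\<in>S. (\<Sum>k\<in>{Suc h - s..h}. \<alpha> k * z v k) = 0) \<longrightarrow> (\<forall>k\<in>{Suc h - s..h}. \<alpha> k = 0)"
    using adapted[OF j(3)] unfolding adapted_def s_def[symmetric] by (elim exE conjE)
  define \<beta> where "\<beta> a = lookup g {a, j}" for a
  define \<alpha> where "\<alpha> k = (if i \<le> k then \<beta> k else 0)" for k
  have "(\<Sum>k\<in>{Suc h - s..h}. \<alpha> k * z v k) = 0" if v: "v \<in> S" for v
  proof -
    define x where "x k = (if k \<le> h then z v k else 0)" for k
    \<comment> \<open>The entry 1 at \<open>j\<close> and the entry 0 at \<open>h\<close> together
      with \<open>z'\<close> make \<open>A^T x'\<close> supported on the same clique
      \<open>G\<close> as \<open>A^T x\<close>.\<close>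
    define x' where "x' k = (if k < h then z' v k else if k = j then 1 else 0)" for k
    obtain G where G: "G \<in> cliques" "\<forall>a<n. a \<notin> G \<longrightarrow> (\<Sum>k<Suc h. A $$ (k, a) * z v k) = 0"
      "\<forall>a<n. a \<notin> G \<longrightarrow> (\<Sum>k<h. A $$ (k, a) * z' v k) = - A $$ (Suc h, a)"
      using bspec[OF adapted_S v] by (elim conjE bexE)
    have y0: "(\<Sum>k<n. A $$ (k, a) * x k) = 0" if "a < n" "a \<notin> G" for a
    proof -
      have "(\<Sum>k<n. A $$ (k, a) * x k) = (\<Sum>k<Suc h. A $$ (k, a) * x k)"
        using j(3) by (intro sum_lessThan_eq) (auto simp: x_def)
      also have "\<dots> = (\<Sum>k<Suc h. A $$ (k, a) * z v k)" by (intro sum.cong) (auto simp: x_def)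
      finally show ?thesis using G(2) that by simp
    qed
    have y0': "(\<Sum>k<n. A $$ (k, a) * x' k) = 0" if "a < n" "a \<notin> G" for a
    proof -
      have "(\<Sum>k<n. A $$ (k, a) * x' k) = (\<Sum>k<Suc j. A $$ (k, a) * x' k)"
        using jn j(1) by (intro sum_lessThan_eq) (auto simp: x'_def)
      also have "\<dots> = (\<Sum>k<h. A $$ (k, a) * x' k) + A $$ (j, a)"
        by (simp add: j(1) x'_def)
      also have "(\<Sum>k<h. A $$ (k, a) * x' k) = (\<Sum>k<h. A $$ (k, a) * z' v k)"
        by (intro sum.cong) (auto simp: x'_def)
      finally show ?thesis using G(3) that j(1) by simp
    qed
    have "ext_pair x x' g = ext_pair (\<lambda>a. \<Sum>k<n. A $$ (k, a) * x k) (\<lambda>a. \<Sum>k<n. A $$ (k, a) * x' k) f"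
      unfolding g_def by (rule ext_pair_act[OF f2])
    also have "\<dots> = 0"
    proof (rule ext_pair_eq_0)
      fix F assume "F \<in> keys f"
      then have F: "F \<subseteq> {..<n}" "F \<notin> cliques" using f(1) by (auto simp: nonfaces_def)
      then obtain a where "a \<in> F" "a \<notin> G" using cliques_subset[OF G(1)] by blast
      then show "\<exists>a\<in>F. (\<Sum>k<n. A $$ (k, a) * x k) = 0 \<and> (\<Sum>k<n. A $$ (k, a) * x' k) = 0"
        using y0 y0' F(1) by blast
    qed
    finally have eval0: "(\<Sum>F\<in>keys g. lookup g F * alt_form x x' F) = 0"
      by (simp add: ext_pair_def)
    define p where "p a = {a, j}" for a
    have p_inj: "inj_on p {i..h}"
      using j(1) by (auto intro!: inj_onI simp: p_def doubleton_eq_iff)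
    have out: "alt_form x x' F = 0" if F: "F \<in> keys g" "F \<notin> p ` {i..h}" for F
    proof -
      have finF: "finite F" using g_sub[OF F(1)] finite_subset by blast
      have "\<exists>b\<in>F. b > j"
      proof (rule ccontr)
        assume "\<not> (\<exists>b\<in>F. b > j)"
        then have le: "\<And>b. b \<in> keys (sqfree F) \<Longrightarrow> b \<le> j"
          using keys_sqfree[OF finF] by auto
        have "F \<noteq> F0" using F(2) j F0(1) by (auto simp: p_def)
        moreover have "sqfree F0 = single i 1 + single j 1"
          using F0 by (simp add: sqfree_def)
        ultimately have rl: "revlex_less (sqfree F) (single i 1 + single j 1)"
          using F0_lead[OF F(1)] by (simp add: ext_less_def)
        have dF: "mon_deg (sqfree F) = 2" using mon_deg_sqfree[OF finF] card2[OF F(1)] by simp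
        obtain a where a: "i \<le> a" "a \<le> j" "sqfree F = single a 1 + single j 1"
          by (rule revlex_below_pair[OF less_imp_le[OF F0(2)] dF rl le])
        from arg_cong[OF a(3), of keys] have Fa: "F = {a, j}"
          by (auto simp: keys_sqfree[OF finF] keys_add_mon)
        then have "a \<noteq> j" using card2[OF F(1)] by auto
        then show False using F(2) a(1,2) j(1) Fa by (auto simp: p_def)
      qed
      then obtain b where b: "b \<in> F" "b > j" by blast
      then have "x b = 0" "x' b = 0" using j(1) by (auto simp: x_def x'_def)
      obtain a c where ac: "F = {a, c}" "a < c"
        using card2[OF F(1)] by (metis card_2_iff insert_commute linorder_neqE_nat)
      then show ?thesis using b \<open>x b = 0\<close> \<open>x' b = 0\<close> by (auto simp: alt_form_pair)
    qed
    \<comment> \<open>Since \<open>x\<close> vanishes and \<open>x'\<close> equals 1 at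
      \<open>j\<close>, the minor is just a coordinate of \<open>z v\<close>, and the relation is
      linear at once.\<close>
    have val: "alt_form x x' {a, j} = z v a" if "a \<in> {i..h}" for a
      using that j(1) by (simp add: alt_form_pair x_def x'_def)
    have "(\<Sum>F\<in>keys g. lookup g F * alt_form x x' F) =
        (\<Sum>F\<in>p ` {i..h}. lookup g F * alt_form x x' F)"
      by (rule sum.mono_neutral_cong) (auto simp: in_keys_iff[symmetric] out dest: not_in_keys_iff_lookup_eq_zero[THEN iffD1])
    also have "\<dots> = (\<Sum>a\<in>{i..h}. \<beta> a * z v a)"
      unfolding sum.reindex[OF p_inj] by (intro sum.cong refl) (simp add: p_def \<beta>_def val)
    finally have "(\<Sum>a\<in>{i..h}. \<beta> a * z v a) = 0" using eval0 by simp
    moreover have "(\<Sum>k\<in>{Suc h - s..h}. \<alpha> k * z v k) = (\<Sum>a\<in>{i..h}. \<beta> a * z v a)"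
      using ci by (intro sum.mono_neutral_cong_right) (auto simp: \<alpha>_def)
    ultimately show ?thesis by simp
  qed
  then have "\<forall>k\<in>{Suc h - s..h}. \<alpha> k = 0" by (intro spec[OF indep, THEN mp] ballI)
  then have "\<alpha> i = 0" using ci j(2) by simp
  then have "lookup g F0 = 0" by (simp add: \<alpha>_def \<beta>_def F0(1))
  then show False using F0_key by (simp add: in_keys_iff)
qed

end

section \<open>The generic initial ideals\<close>

text \<open>A common description of monomial ideals in both algebras: such an ideal is determined by
  the set of monomials that it contains.\<close>

definition mon_span :: "'m set \<Rightarrow> ('m \<Rightarrow>\<^sub>0 'k::field) set" where
  "mon_span X = {p. keys p \<subseteq> X}"

lemma monomial_mem_mon_span: "(single m 1 :: 'm \<Rightarrow>\<^sub>0 'k::field) \<in> mon_span X \<longleftrightarrow> m \<in> X"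
  by (simp add: mon_span_def)

lemma monomial_ideal_eq_mon_span:
  "monomial_ideal V G = mon_span {m. keys m \<subseteq> V \<and> (\<exists>g\<in>G. \<exists>k. m = g + k)}"
  by (auto simp: monomial_ideal_def polys_def mon_span_def)

lemma ext_monomial_ideal_eq_mon_span:
  "ext_monomial_ideal n G = mon_span {F. F \<subseteq> {..<n} \<and> (\<exists>g\<in>G. g \<subseteq> F)}"
  by (auto simp: ext_monomial_ideal_def mon_span_def)

lemma sqfree_dvd_iff:
  assumes "finite F" shows "(\<exists>k. m = sqfree F + k) \<longleftrightarrow> F \<subseteq> keys m"
  unfolding monomial_dvd_iff using assms
  by (auto simp: lookup_sqfree in_keys_iff Suc_le_eq subset_eq)

lemma Idl_sqfree:
  assumes "\<And>F. F \<in> \<F> \<Longrightarrow> F \<subseteq> {..<n}"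
  shows "Idl\<^bsub>poly_ring {..<n}\<^esub> {monomial (sqfree F) | F. F \<in> \<F>} =
    (mon_span {m. keys m \<subseteq> {..<n} \<and> (\<exists>F\<in>\<F>. F \<subseteq> keys m)} :: (nat, 'k::field) mpoly set)"
proof -
  have fin: "finite F" if "F \<in> \<F>" for F using assms[OF that] finite_subset by blast
  have "{monomial (sqfree F) | F. F \<in> \<F>} = (monomial ` sqfree ` \<F> :: (nat, 'k) mpoly set)" by blast
  moreover have "Idl\<^bsub>poly_ring {..<n}\<^esub> (monomial ` sqfree ` \<F>) = (monomial_ideal {..<n} (sqfree ` \<F>) :: (nat, 'k) mpoly set)"
  proof (rule Idl_monomials)
    fix g assume "g \<in> sqfree ` \<F>"
    then obtain F where F: "F \<in> \<F>" "g = sqfree F" by blast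
    then show "keys g \<subseteq> {..<n}" using assms[OF F(1)] keys_sqfree[OF fin[OF F(1)]] by simp
  qed
  moreover have "(\<exists>g\<in>sqfree ` \<F>. \<exists>k. m = g + k) \<longleftrightarrow> (\<exists>F\<in>\<F>. F \<subseteq> keys m)" for m
    using fin sqfree_dvd_iff by auto
  ultimately show ?thesis by (simp add: monomial_ideal_eq_mon_span)
qed

lemma nonface_superset_iff:
  assumes "simplicial_complex n \<Gamma>" "H \<subseteq> {..<n}"
  shows "(\<exists>F\<in>{F. F \<subseteq> {..<n} \<and> F \<notin> \<Gamma>}. F \<subseteq> H) \<longleftrightarrow> H \<notin> \<Gamma>"
  using assms by (auto simp: simplicial_complex_def)

lemma stanley_reisner_eq:
  assumes "simplicial_complex n \<Gamma>"
  shows "stanley_reisner n \<Gamma> = mon_span {m. keys m \<subseteq> {..<n} \<and> keys m \<notin> \<Gamma>}"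
proof -
  have "stanley_reisner n \<Gamma> = mon_span {m. keys m \<subseteq> {..<n} \<and>
      (\<exists>F\<in>{F. F \<subseteq> {..<n} \<and> F \<notin> \<Gamma>}. F \<subseteq> keys m)}"
    unfolding stanley_reisner_def using Idl_sqfree[of "{F. F \<subseteq> {..<n} \<and> F \<notin> \<Gamma>}" n] by simp
  also have "{m. keys m \<subseteq> {..<n} \<and> (\<exists>F\<in>{F. F \<subseteq> {..<n} \<and> F \<notin> \<Gamma>}. F \<subseteq> keys m)} =
      {m :: nat mon. keys m \<subseteq> {..<n} \<and> keys m \<notin> \<Gamma>}"
    using nonface_superset_iff[OF assms] by blast
  finally show ?thesis .
qed

lemma ext_face_ideal_eq:
  assumes "simplicial_complex n \<Gamma>"
  shows "ext_face_ideal n \<Gamma> = (mon_span {F. F \<subseteq> {..<n} \<and> F \<notin> \<Gamma>} :: 'k::field ext set)"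
proof -
  have eq: "{ext_monomial F | F. F \<subseteq> {..<n} \<and> F \<notin> \<Gamma>} = (ext_monomial ` {F. F \<subseteq> {..<n} \<and> F \<notin> \<Gamma>} :: 'k ext set)"
    by blast
  have "ext_face_ideal n \<Gamma> = (ext_monomial_ideal n {F. F \<subseteq> {..<n} \<and> F \<notin> \<Gamma>} :: 'k ext set)"
    unfolding ext_face_ideal_def eq by (rule Idl_ext_monomials) simp
  also have "\<dots> = mon_span {H. H \<subseteq> {..<n} \<and> (\<exists>F\<in>{F. F \<subseteq> {..<n} \<and> F \<notin> \<Gamma>}. F \<subseteq> H)}"
    by (rule ext_monomial_ideal_eq_mon_span)
  also have "{H. H \<subseteq> {..<n} \<and> (\<exists>F\<in>{F. F \<subseteq> {..<n} \<and> F \<notin> \<Gamma>}. F \<subseteq> H)} = {F. F \<subseteq> {..<n} \<and> F \<notin> \<Gamma>}"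
    using nonface_superset_iff[OF assms] by blast
  finally show ?thesis .
qed

text \<open>The squarefree monomials in a Stanley-Reisner ideal are exactly its nonfaces, so the
  complex is determined by the ideal and the description is unique.\<close>

lemma symmetric_shift_eqI:
  assumes "simplicial_complex n \<Gamma>"
    and "sigma_ideal n (gin n (stanley_reisner n \<Delta>)) = (stanley_reisner n \<Gamma> :: (nat, 'k::field) mpoly set)"
  shows "symmetric_shift TYPE('k) n \<Delta> = \<Gamma>"
  unfolding symmetric_shift_def assms(2)
proof (rule the_equality)
  fix \<Gamma>' assume h: "simplicial_complex n \<Gamma>' \<and> stanley_reisner n \<Gamma>' = (stanley_reisner n \<Gamma> :: (nat, 'k) mpoly set)"
  have mem: "F \<in> \<Theta> \<longleftrightarrow> F \<subseteq> {..<n} \<and> (monomial (sqfree F) :: (nat, 'k) mpoly) \<notin> stanley_reisner n \<Theta>"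
    if "simplicial_complex n \<Theta>" for F \<Theta>
  proof (cases "F \<subseteq> {..<n}")
    case True
    then have "finite F" using finite_subset by blast
    then show ?thesis using True
      by (simp add: stanley_reisner_eq[OF that] monomial_mem_mon_span keys_sqfree)
  qed (use that in \<open>auto simp: simplicial_complex_def\<close>)
  have "F \<in> \<Gamma>' \<longleftrightarrow> F \<in> \<Gamma>" for F
    using mem[of \<Gamma>' F] mem[of \<Gamma> F] h assms(1) by simp
  then show "\<Gamma>' = \<Gamma>" by blast
qed (use assms(1) in simp)

lemma exterior_shift_eqI:
  assumes "simplicial_complex n \<Gamma>"
    and "ext_gin n (ext_face_ideal n \<Delta>) = (ext_face_ideal n \<Gamma> :: 'k::field ext set)"
  shows "exterior_shift TYPE('k) n \<Delta> = \<Gamma>"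
  unfolding exterior_shift_def assms(2)
proof (rule the_equality)
  fix \<Gamma>' assume h: "simplicial_complex n \<Gamma>' \<and> ext_face_ideal n \<Gamma>' = (ext_face_ideal n \<Gamma> :: 'k ext set)"
  have mem: "F \<in> \<Theta> \<longleftrightarrow> F \<subseteq> {..<n} \<and> (ext_monomial F :: 'k ext) \<notin> ext_face_ideal n \<Theta>"
    if "simplicial_complex n \<Theta>" for F \<Theta>
    using that by (auto simp: ext_face_ideal_eq[OF that] monomial_mem_mon_span simplicial_complex_def)
  have "F \<in> \<Gamma>' \<longleftrightarrow> F \<in> \<Gamma>" for F
    using mem[of \<Gamma>' F] mem[of \<Gamma> F] h assms(1) by simp
  then show "\<Gamma>' = \<Gamma>" by blast
qed (use assms(1) in simp)

section \<open>The operation sigma in degree two\<close>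

lemma mon_indices_pair:
  assumes "i \<le> j" shows "mon_indices (single i 1 + single j 1) = [i, j]"
proof (cases "i = j")
  case True
  have "single j 1 + single j 1 = single j (2 :: nat)"
    by (simp only: single_add[symmetric] one_add_one)
  then show ?thesis using True by (simp add: mon_indices_def numeral_2_eq_2)
next
  case False
  then have "i < j" using assms by simp
  have "keys (single i 1 + single j 1 :: nat mon) = {i, j}"
    by (auto simp: keys_add_mon)
  moreover have "sorted_list_of_set {i, j} = [i, j]"
    using sorted_list_of_set_insert_min[of "{j}" i] \<open>i < j\<close> by simp
  ultimately show ?thesis
    using False by (simp add: mon_indices_def lookup_add lookup_single when_def)
qed

lemma sigma_pair:
  assumes "i \<le> j" shows "sigma (single i 1 + single j 1) = sqfree {i, Suc j}"
  using assms unfolding sigma_def mon_indices_pair[OF assms] sqfree_def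
  by (simp add: numeral_2_eq_2 lessThan_Suc add.commute)

section \<open>Leading monomials and shifts of the clique complex\<close>

context elimination_order
begin

lemma cliques_complex: "simplicial_complex n cliques"
  by (auto simp: simplicial_complex_def clique_complex_def)

lemma shifted_complex: "simplicial_complex n shifted"
  unfolding simplicial_complex_def shifted_def by blast

lemma sym_gens_sub: "sym_gens \<subseteq> sym_mons" and sym_gens_deg: "g \<in> sym_gens \<Longrightarrow> mon_deg g = 2"
proof -
  show "sym_gens \<subseteq> sym_mons"
  proof
    fix g assume g: "g \<in> sym_gens"
    then have "keys g \<subseteq> {..<n}" by (auto simp: sym_gens_def keys_add_mon)
    then show "g \<in> sym_mons" using g by (auto simp: sym_mons_def intro!: bexI[of _ g] exI[of _ 0])
  qed
  show "g \<in> sym_gens \<Longrightarrow> mon_deg g = 2" by (auto simp: sym_gens_def)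
qed

lemma count_complement:
  assumes "finite U" "X \<subseteq> U" "Y \<subseteq> U" "card (U - X) = card (U - Y)"
  shows "card X = card Y"
proof -
  have "card X = card U - card (U - X)" "card Y = card U - card (U - Y)"
    using assms(1-3) by (simp_all add: card_Diff_subset finite_subset card_mono)
  then show ?thesis using assms(4) by simp
qed

text \<open>The comparison is made on complements within all monomials of bounded degree, where both
  pivot counts give the same sum over the degree sequence.\<close>

lemma card_sym_slice:
  "finite {m \<in> nonface_mons. mon_deg m \<le> Suc d}" "finite {m \<in> sym_mons. mon_deg m \<le> Suc d}"
  "card {m \<in> nonface_mons. mon_deg m \<le> Suc d} = card {m \<in> sym_mons. mon_deg m \<le> Suc d}"
proof -
  let ?U = "mons_le {..<n} (Suc d)"
  have fin: "finite ?U" using card_mons_le[of "{..<n}" "Suc d"] by simp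
  have sub: "{m \<in> nonface_mons. mon_deg m \<le> Suc d} \<subseteq> ?U" "{m \<in> sym_mons. mon_deg m \<le> Suc d} \<subseteq> ?U"
    by (auto simp: mons_le_def nonface_mons_def sym_mons_def)
  then show "finite {m \<in> nonface_mons. mon_deg m \<le> Suc d}" "finite {m \<in> sym_mons. mon_deg m \<le> Suc d}"
    using fin finite_subset by blast+
  have "?U - {m \<in> nonface_mons. mon_deg m \<le> Suc d} = {m. keys m \<in> cliques \<and> mon_deg m \<le> Suc d}"
    by (auto simp: mons_le_def nonface_mons_def clique_complex_def)
  moreover have "?U - {m \<in> sym_mons. mon_deg m \<le> Suc d} =
      {m. keys m \<subseteq> {..<n} \<and> m \<notin> sym_mons \<and> mon_deg m \<le> Suc d}"
    by (auto simp: mons_le_def)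
  ultimately have "card (?U - {m \<in> nonface_mons. mon_deg m \<le> Suc d}) = card (?U - {m \<in> sym_mons. mon_deg m \<le> Suc d})"
    by (simp only: card_not_sym_mons card_clique_mons_le)
  then show "card {m \<in> nonface_mons. mon_deg m \<le> Suc d} = card {m \<in> sym_mons. mon_deg m \<le> Suc d}"
    by (rule count_complement[OF fin sub])
qed

lemma card_ext_slice:
  defines "Y \<equiv> {F. F \<subseteq> {..<n} \<and> F \<notin> shifted}"
  shows "finite {F \<in> nonfaces. card F \<le> Suc d}" "finite {F \<in> Y. card F \<le> Suc d}"
    "card {F \<in> nonfaces. card F \<le> Suc d} = card {F \<in> Y. card F \<le> Suc d}"
proof -
  let ?U = "{F. F \<subseteq> {..<n} \<and> card F \<le> Suc d}"
  have fin: "finite ?U" by simp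
  have sub: "{F \<in> nonfaces. card F \<le> Suc d} \<subseteq> ?U" "{F \<in> Y. card F \<le> Suc d} \<subseteq> ?U"
    by (auto simp: nonfaces_def Y_def)
  then show "finite {F \<in> nonfaces. card F \<le> Suc d}" "finite {F \<in> Y. card F \<le> Suc d}"
    using fin finite_subset by blast+
  have "?U - {F \<in> nonfaces. card F \<le> Suc d} = {F \<in> cliques. card F \<le> Suc d}"
    by (auto simp: nonfaces_def clique_complex_def)
  moreover have "?U - {F \<in> Y. card F \<le> Suc d} = {F \<in> shifted. card F \<le> Suc d}"
    by (auto simp: Y_def shifted_def)
  ultimately have "card (?U - {F \<in> nonfaces. card F \<le> Suc d}) = card (?U - {F \<in> Y. card F \<le> Suc d})"
    by (simp only: card_shifted_le card_cliques_le)
  then show "card {F \<in> nonfaces. card F \<le> Suc d} = card {F \<in> Y. card F \<le> Suc d}"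
    by (rule count_complement[OF fin sub])
qed

lemma nonface_mons_up: "m \<in> nonface_mons \<Longrightarrow> keys k \<subseteq> {..<n} \<Longrightarrow> k + m \<in> nonface_mons"
  using cliques_subset[of "keys k \<union> keys m" "keys m"]
  by (auto simp: nonface_mons_def keys_add_mon)

lemma leading_set_sym:
  fixes A :: "'k::field_char_0 mat"
  assumes A: "A \<in> GL n" and adapted: "\<And>j. j < n \<Longrightarrow> adapted n cliques A j (tail (n - Suc j))"
  shows "{leading revlex_less (poly_act n A f) | f. keys f \<subseteq> nonface_mons \<and> f \<noteq> 0} = sym_mons"
    and "\<And>f. keys f \<subseteq> nonface_mons \<Longrightarrow> poly_act n A f = 0 \<Longrightarrow> f = 0"
proof -
  interpret R: term_order revlex_less UNIV by (rule revlex_term_order)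
  have Ac: "A \<in> carrier_mat n n" using A by (simp add: GL_iff_det)
  obtain B where "B \<in> GL n" and BA: "B * A = 1\<^sub>m n" and AB: "A * B = 1\<^sub>m n" by (rule GL_inverse[OF A])
  then have Bc: "B \<in> carrier_mat n n" by (simp add: GL_iff_det)
  have inP: "f \<in> polys {..<n}" if "keys f \<subseteq> nonface_mons" for f :: "(nat, 'k) mpoly"
    using that by (auto simp: polys_def nonface_mons_def)
  \<comment> \<open>The inverse matrix undoes the action; it yields injectivity and carries degree
    bounds from the image back to the argument.\<close>
  have inv1: "poly_act n B (poly_act n A p) = p" if "p \<in> polys {..<n}" for p
    by (simp add: poly_act_comp[OF that Ac Bc] BA poly_act_one[OF that])
  have inv2: "poly_act n A (poly_act n B p) = p" if "p \<in> polys {..<n}" for p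
    by (simp add: poly_act_comp[OF that Bc Ac] AB poly_act_one[OF that])
  show inj: "f = 0" if "keys f \<subseteq> nonface_mons" "poly_act n A f = 0" for f
    using inv1[OF inP[OF that(1)]] that(2) by (simp add: poly_act_0)
  show "{leading revlex_less (poly_act n A f) | f. keys f \<subseteq> nonface_mons \<and> f \<noteq> 0} = sym_mons"
  proof (rule R.leading_set_eqI[where dg = mon_deg])
    fix f :: "(nat, 'k) mpoly" and d assume f: "keys f \<subseteq> nonface_mons"
    show "(\<forall>m\<in>keys (poly_act n A f). mon_deg m \<le> d) \<longleftrightarrow> (\<forall>m\<in>keys f. mon_deg m \<le> d)"
    proof
      assume h: "\<forall>m\<in>keys (poly_act n A f). mon_deg m \<le> d"
      show "\<forall>m\<in>keys f. mon_deg m \<le> d"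
      proof
        fix m assume "m \<in> keys f"
        then have "m \<in> keys (poly_act n B (poly_act n A f))" by (simp add: inv1[OF inP[OF f]])
        from mon_deg_keys_poly_act[OF this] show "mon_deg m \<le> d" using h by auto
      qed
    next
      assume h: "\<forall>m\<in>keys f. mon_deg m \<le> d"
      show "\<forall>m\<in>keys (poly_act n A f). mon_deg m \<le> d"
      proof
        fix m assume "m \<in> keys (poly_act n A f)"
        from mon_deg_keys_poly_act[OF this] show "mon_deg m \<le> d" using h by auto
      qed
    qed
  next
    fix m assume m: "m \<in> {leading revlex_less (poly_act n A f) | f. keys f \<subseteq> nonface_mons \<and> f \<noteq> 0}"
      and md: "mon_deg m \<le> 2"
    then obtain f where f: "m = leading revlex_less (poly_act n A f)" "keys f \<subseteq> nonface_mons" "f \<noteq> 0"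
      by blast
    have nz: "poly_act n A f \<noteq> 0" using inj f(2,3) by blast
    have "mon_deg m' \<le> 2" if "m' \<in> keys f" for m'
    proof -
      have "m' \<in> keys (poly_act n B (poly_act n A f))" using that by (simp add: inv1[OF inP[OF f(2)]])
      from mon_deg_keys_poly_act[OF this] obtain m0 where
        m0: "m0 \<in> keys (poly_act n A f)" "mon_deg m' = mon_deg m0" by blast
      have "m0 = m \<or> revlex_less m0 m" using R.leading(2)[OF subset_UNIV nz m0(1)] f(1) by auto
      then show ?thesis using md m0(2) by (auto simp: revlex_less_def)
    qed
    then show "m \<in> sym_mons"
      unfolding f(1) by (intro sym_upper[OF adapted f(2,3) _ nz])
  next
    let ?L = "{leading revlex_less (poly_act n A f) | f. keys f \<subseteq> nonface_mons \<and> f \<noteq> 0}"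
    assume low: "{x \<in> sym_mons. mon_deg x \<le> 2} \<subseteq> ?L"
    show "sym_mons \<subseteq> ?L"
    proof
      fix m assume "m \<in> sym_mons"
      then obtain g k where gk: "g \<in> sym_gens" "m = g + k" "keys m \<subseteq> {..<n}"
        unfolding sym_mons_def by blast
      have "g \<in> ?L" using low sym_gens_sub sym_gens_deg[OF gk(1)] gk(1) by auto
      then obtain f where f: "g = leading revlex_less (poly_act n A f)" "keys f \<subseteq> nonface_mons" "f \<noteq> 0"
        by blast
      have nz: "poly_act n A f \<noteq> 0" using inj f(2,3) by blast
      have kn: "(monomial k :: (nat, 'k) mpoly) \<in> polys {..<n}"
        using gk(2,3) by (simp add: polys_def keys_add_mon)
      \<comment> \<open>Pulling the monomial back along \<open>B\<close> makes the image of
        \<open>f'\<close> equal to the monomial times the image of \<open>f\<close>, while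
        \<open>f'\<close> stays in the original ideal. Thus leading monomials are closed under
        multiplication.\<close>
      define f' where "f' = poly_act n B (monomial k) * f"
      have "poly_act n A f' = monomial k * poly_act n A f"
        unfolding f'_def poly_act_mult inv2[OF kn] ..
      then have lead: "leading revlex_less (poly_act n A f') = m"
        using leading_monomial_mult[OF nz, of k] f(1) gk(2) by (simp add: add.commute)
      have "monomial k * poly_act n A f \<noteq> 0"
        using lookup_monomial_mult[of k "poly_act n A f" g] R.leading(1)[OF subset_UNIV nz] f(1)
        by (auto simp: in_keys_iff)
      then have "f' \<noteq> 0"
        using \<open>poly_act n A f' = _\<close> by (auto simp: poly_act_0)
      moreover have "keys f' \<subseteq> nonface_mons"
      proof
        fix m' assume "m' \<in> keys f'"
        then obtain a b where ab: "m' = a + b" "a \<in> keys (poly_act n B (monomial k))" "b \<in> keys f"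
          unfolding f'_def using keys_mult by blast
        have "keys a \<subseteq> {..<n}"
          using poly_act_polys[of n B "monomial k"] ab(2) by (auto simp: polys_def)
        then show "m' \<in> nonface_mons" using nonface_mons_up ab(1,3) f(2) by auto
      qed
      ultimately show "m \<in> ?L" using lead by blast
    qed
  qed (use inj in \<open>auto simp: poly_act_add poly_act_scale card_sym_slice revlex_less_def\<close>)
qed

lemma leading_set_ext:
  fixes A :: "'k::field_char_0 mat"
  assumes A: "A \<in> GL n" and adapted: "\<And>j. j < n \<Longrightarrow> adapted n cliques A j (tail (n - Suc j))"
  shows "{leading ext_less (ext_act n A f) | f. keys f \<subseteq> nonfaces \<and> f \<noteq> 0} =
      {F. F \<subseteq> {..<n} \<and> F \<notin> shifted}"
    and "\<And>f. keys f \<subseteq> nonfaces \<Longrightarrow> ext_act n A f = 0 \<Longrightarrow> f = 0"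
proof -
  interpret R: term_order ext_less "{F. finite F}" by (rule ext_term_order)
  have Ac: "A \<in> carrier_mat n n" using A by (simp add: GL_iff_det)
  obtain B where "B \<in> GL n" and BA: "B * A = 1\<^sub>m n" and AB: "A * B = 1\<^sub>m n" by (rule GL_inverse[OF A])
  then have Bc: "B \<in> carrier_mat n n" by (simp add: GL_iff_det)
  have inC: "f \<in> carrier (ext_ring n)" if "keys f \<subseteq> nonfaces" for f :: "'k ext"
    using that by (auto simp: ext_carrier_iff nonfaces_def)
  have fin: "finite F" if "a \<in> carrier (ext_ring n)" "F \<in> keys a" for a :: "'k ext" and F
    using that finite_subset[OF _ finite_lessThan] by (auto simp: ext_carrier_iff)
  have inv1: "ext_act n B (ext_act n A p) = p" if "p \<in> carrier (ext_ring n)" for p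
    by (simp add: ext_act_comp[OF that Ac Bc] BA ext_act_one[OF that])
  have inv2: "ext_act n A (ext_act n B p) = p" if "p \<in> carrier (ext_ring n)" for p
    by (simp add: ext_act_comp[OF that Bc Ac] AB ext_act_one[OF that])
  have keysM: "keys (ext_act n A f) \<subseteq> {F. finite F}" for f
    using fin[OF ext_act_closed] by blast
  show inj: "f = 0" if "keys f \<subseteq> nonfaces" "ext_act n A f = 0" for f
    using inv1[OF inC[OF that(1)]] that(2) by simp
  have card_back: "\<exists>F'\<in>keys (ext_act n A f). card F = card F'"
    if f: "keys f \<subseteq> nonfaces" "F \<in> keys f" for f F
  proof -
    have "F \<in> keys (ext_act n B (ext_act n A f))" using f(2) by (simp add: inv1[OF inC[OF f(1)]])
    then show ?thesis by (rule card_keys_ext_act[rotated]) (rule fin[OF ext_act_closed])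
  qed
  show "{leading ext_less (ext_act n A f) | f. keys f \<subseteq> nonfaces \<and> f \<noteq> 0} =
      {F. F \<subseteq> {..<n} \<and> F \<notin> shifted}"
  proof (rule R.leading_set_eqI[where dg = card])
    fix f :: "'k ext" and d assume f: "keys f \<subseteq> nonfaces"
    show "(\<forall>m\<in>keys (ext_act n A f). card m \<le> d) \<longleftrightarrow> (\<forall>m\<in>keys f. card m \<le> d)"
    proof
      assume h: "\<forall>m\<in>keys (ext_act n A f). card m \<le> d"
      then show "\<forall>m\<in>keys f. card m \<le> d" using card_back[OF f] by fastforce
    next
      assume h: "\<forall>m\<in>keys f. card m \<le> d"
      then show "\<forall>m\<in>keys (ext_act n A f). card m \<le> d"
        using card_keys_ext_act[of f _ n A] fin[OF inC[OF f]] by fastforce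
    qed
  next
    fix F G assume "ext_less F G"
    then have le: "mon_deg (sqfree F) \<le> mon_deg (sqfree G)" by (auto simp: ext_less_def revlex_less_def)
    show "card F \<le> card G"
    proof (cases "finite F \<and> finite G")
      case True
      then show ?thesis using le by (simp add: mon_deg_sqfree)
    next
      case False
      then have "card F = 0 \<or> infinite G" by auto
      then show ?thesis
      proof
        assume "infinite G"
        then have "mon_deg (sqfree F) = 0" using le by (simp add: sqfree_def)
        then show ?thesis by (cases "finite F") (simp_all add: mon_deg_sqfree)
      qed simp
    qed
  next
    fix F assume m: "F \<in> {leading ext_less (ext_act n A f) | f. keys f \<subseteq> nonfaces \<and> f \<noteq> 0}"
      and md: "card F \<le> 2"
    then obtain f where f: "F = leading ext_less (ext_act n A f)" "keys f \<subseteq> nonfaces" "f \<noteq> 0"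
      by blast
    have nz: "ext_act n A f \<noteq> 0" using inj f(2,3) by blast
    have "card F' \<le> 2" if F': "F' \<in> keys f" for F'
    proof -
      obtain F0 where F0: "F0 \<in> keys (ext_act n A f)" "card F' = card F0"
        using card_back[OF f(2) F'] by blast
      have "F0 = F \<or> ext_less F0 F" using R.leading(2)[OF keysM nz F0(1)] f(1) by auto
      moreover have "finite F" "finite F0"
        using R.leading(1)[OF keysM nz] keysM f(1) F0(1) by auto
      ultimately show ?thesis using md F0(2) by (auto simp: ext_less_def revlex_less_def mon_deg_sqfree)
    qed
    then show "F \<in> {F. F \<subseteq> {..<n} \<and> F \<notin> shifted}"
      unfolding f(1) mem_Collect_eq by (intro ext_upper[OF adapted f(2,3) _ nz])
  next
    let ?L = "{leading ext_less (ext_act n A f) | f. keys f \<subseteq> nonfaces \<and> f \<noteq> 0}"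
    assume low: "{x \<in> {F. F \<subseteq> {..<n} \<and> F \<notin> shifted}. card x \<le> 2} \<subseteq> ?L"
    show "{F. F \<subseteq> {..<n} \<and> F \<notin> shifted} \<subseteq> ?L"
    proof
      fix F assume "F \<in> {F. F \<subseteq> {..<n} \<and> F \<notin> shifted}"
      then have F: "F \<subseteq> {..<n}" "F \<notin> shifted" by simp_all
      then obtain g where g: "g \<in> ext_gens" "g \<subseteq> F" using shifted_iff by blast
      have "card g \<le> 2" using g(1) by (auto simp: ext_gens_def)
      moreover have "g \<subseteq> {..<n}" using g(2) F(1) by simp
      moreover from this have "g \<notin> shifted" using g(1) shifted_iff[of g] by blast
      ultimately have "g \<in> ?L" using low by blast
      then obtain f where f: "g = leading ext_less (ext_act n A f)" "keys f \<subseteq> nonfaces" "f \<noteq> 0"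
        by blast
      have nz: "ext_act n A f \<noteq> 0" using inj f(2,3) by blast
      define H where "H = F - g"
      have H: "finite H" "H \<inter> g = {}" "H \<union> g = F" "H \<subseteq> {..<n}"
        using F(1) g(2) finite_subset[OF _ finite_lessThan, of "F - g" n] by (auto simp: H_def)
      have Hc: "(ext_monomial H :: 'k ext) \<in> carrier (ext_ring n)" using H(4) by (simp add: ext_carrier_iff)
      \<comment> \<open>As in the symmetric case, the missing factor \<open>e_H\<close> is pulled
        back along the inverse matrix; \<open>H\<close> is disjoint from \<open>g\<close>, so the
        leading term survives the wedge.\<close>
      define f' where "f' = wedge (ext_act n B (ext_monomial H)) f"
      have act: "ext_act n A f' = wedge (ext_monomial H) (ext_act n A f)"
        unfolding f'_def ext_act_wedge[OF ext_act_closed inC[OF f(2)]] inv2[OF Hc] ..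
      have "H \<inter> leading ext_less (ext_act n A f) = {}" using H(2) f(1) by simp
      note lw = leading_wedge_monomial[OF ext_act_closed nz H(1) this]
      have "leading ext_less (ext_act n A f') = F"
        unfolding act lw(2) using f(1) H(3) by simp
      moreover have "f' \<noteq> 0" using lw(1) act by auto
      moreover have "keys f' \<subseteq> nonfaces"
      proof
        fix F' assume "F' \<in> keys f'"
        from keys_wedge[OF this[unfolded f'_def]] obtain F1 F2 where
          F12: "F1 \<in> keys (ext_act n B (ext_monomial H))" "F2 \<in> keys f" "F' = F1 \<union> F2"
          by blast
        have "F1 \<subseteq> {..<n}" using ext_act_closed[of n B "ext_monomial H"] F12(1) by (simp add: ext_carrier_iff)
        moreover have "F2 \<subseteq> {..<n}" "F2 \<notin> cliques" using f(2) F12(2) by (auto simp: nonfaces_def)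
        ultimately show "F' \<in> nonfaces"
          using cliques_subset[of F' F2] F12(3) by (auto simp: nonfaces_def)
      qed
      ultimately show "F \<in> ?L" by blast
    qed
  qed (use inj keysM in \<open>auto simp: ext_act_add ext_act_scale card_ext_slice\<close>)
qed

text \<open>Once \<open>\<phi> A \<noteq> 0\<close>, the set of leading monomials no longer depends
  on \<open>A\<close>, and it is already closed under multiples.\<close>

lemma gin_cliques: "gin n (stanley_reisner n cliques) = (mon_span sym_mons :: (nat, 'k::field_char_0) mpoly set)"
proof -
  obtain \<phi> where \<phi>: "nonzero_polyfun n \<phi>"
    "\<And>A j. \<phi> A \<noteq> 0 \<Longrightarrow> j < n \<Longrightarrow> adapted n cliques (A :: 'k mat) j (tail (n - Suc j))"
    using generic_adapted[where 'k = 'k] by blast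
  show ?thesis
    unfolding gin_def
  proof (rule generic_value_eqI[OF \<phi>(1)])
    fix A :: "'k mat" assume A: "A \<in> GL n" "\<phi> A \<noteq> 0"
    note L = leading_set_sym[OF A(1) \<phi>(2)[OF A(2)]]
    let ?I = "poly_act n A ` stanley_reisner n cliques :: (nat, 'k) mpoly set"
    have "{monomial (leading revlex_less f) | f. f \<in> ?I \<and> f \<noteq> 0} =
        (monomial ` {leading revlex_less (poly_act n A f) | f. keys f \<subseteq> nonface_mons \<and> f \<noteq> 0} :: (nat, 'k) mpoly set)"
      unfolding stanley_reisner_eq[OF cliques_complex] mon_span_def nonface_mons_def[symmetric]
      using L(2) poly_act_0[of n A] by blast
    then have "initial_ideal n ?I = Idl\<^bsub>poly_ring {..<n}\<^esub> (monomial ` sym_mons)"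
      by (simp only: initial_ideal_def L(1))
    also have "\<dots> = monomial_ideal {..<n} sym_mons"
      by (rule Idl_monomials) (simp add: sym_mons_def)
    also have "\<dots> = mon_span sym_mons"
    proof -
      have up: "(\<exists>g\<in>sym_mons. \<exists>k. m = g + k) \<longleftrightarrow> m \<in> sym_mons" if "keys m \<subseteq> {..<n}" for m
      proof
        assume "\<exists>g\<in>sym_mons. \<exists>k. m = g + k"
        then obtain g0 k k' where "g0 \<in> sym_gens" "m = g0 + k + k'" unfolding sym_mons_def by blast
        then show "m \<in> sym_mons" using that unfolding sym_mons_def by (auto simp: add.assoc)
      next
        assume "m \<in> sym_mons"
        then show "\<exists>g\<in>sym_mons. \<exists>k. m = g + k" by (intro bexI[of _ m] exI[of _ 0]) simp_all
      qed
      have "{m. keys m \<subseteq> {..<n} \<and> (\<exists>g\<in>sym_mons. \<exists>k. m = g + k)} =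
          {m. keys m \<subseteq> {..<n} \<and> m \<in> sym_mons}"
        using up by blast
      also have "\<dots> = sym_mons" by (auto simp: sym_mons_def)
      finally have "{m. keys m \<subseteq> {..<n} \<and> (\<exists>g\<in>sym_mons. \<exists>k. m = g + k)} = sym_mons" .
      then show ?thesis by (simp only: monomial_ideal_eq_mon_span)
    qed
    finally show "initial_ideal n ?I = mon_span sym_mons" .
  qed
qed

text \<open>The leading monomials are literally the defining generators of the face ideal of
  \<open>shifted\<close>, so no further ideal computation is needed.\<close>

lemma ext_gin_cliques:
  "ext_gin n (ext_face_ideal n cliques) = (ext_face_ideal n shifted :: 'k::field_char_0 ext set)"
proof -
  obtain \<phi> where \<phi>: "nonzero_polyfun n \<phi>"
    "\<And>A j. \<phi> A \<noteq> 0 \<Longrightarrow> j < n \<Longrightarrow> adapted n cliques (A :: 'k mat) j (tail (n - Suc j))"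
    using generic_adapted[where 'k = 'k] by blast
  show ?thesis
    unfolding ext_gin_def
  proof (rule generic_value_eqI[OF \<phi>(1)])
    fix A :: "'k mat" assume A: "A \<in> GL n" "\<phi> A \<noteq> 0"
    note L = leading_set_ext[OF A(1) \<phi>(2)[OF A(2)]]
    let ?I = "ext_act n A ` ext_face_ideal n cliques :: 'k ext set"
    have "{ext_monomial (leading ext_less f) | f. f \<in> ?I \<and> f \<noteq> 0} =
        (ext_monomial ` {leading ext_less (ext_act n A f) | f. keys f \<subseteq> nonfaces \<and> f \<noteq> 0} :: 'k ext set)"
      unfolding ext_face_ideal_eq[OF cliques_complex] mon_span_def nonfaces_def[symmetric]
      using L(2) ext_act_0[of n A] by blast
    also have "\<dots> = ext_monomial ` {F. F \<subseteq> {..<n} \<and> F \<notin> shifted}"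
      by (simp only: L(1))
    also have "\<dots> = {ext_monomial F | F. F \<subseteq> {..<n} \<and> F \<notin> shifted}"
      by blast
    finally show "ext_initial_ideal n ?I = ext_face_ideal n shifted"
      by (simp only: ext_initial_ideal_def ext_face_ideal_def)
  qed
qed

text \<open>All members of \<open>sym_gens\<close> have degree 2, so none properly divides
  another.\<close>

lemma min_gens_sym_mons: "min_gens (mon_span sym_mons :: (nat, 'k::field) mpoly set) = sym_gens"
proof (intro equalityI subsetI)
  fix m assume m: "m \<in> min_gens (mon_span sym_mons :: (nat, 'k) mpoly set)"
  then have "m \<in> sym_mons" by (simp add: min_gens_def monomial_mem_mon_span)
  then obtain g k where g: "g \<in> sym_gens" "m = g + k" unfolding sym_mons_def by blast
  moreover have "g \<in> sym_mons" using g(1) sym_gens_sub by blast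
  ultimately have "g = m" using m unfolding min_gens_def monomial_mem_mon_span
    by (auto simp: lookup_add)
  then show "m \<in> sym_gens" using g(1) by simp
next
  fix g assume g: "g \<in> sym_gens"
  have "m' = g" if m': "m' \<in> sym_mons" "\<forall>i. lookup m' i \<le> lookup g i" for m'
  proof -
    obtain k where k: "g = m' + k" using m'(2) monomial_dvd_iff[of g m'] by blast
    obtain g' k' where g': "g' \<in> sym_gens" "m' = g' + k'" using m'(1) unfolding sym_mons_def by blast
    have "mon_deg k = 0"
      using arg_cong[OF k, of mon_deg] arg_cong[OF g'(2), of mon_deg] sym_gens_deg[OF g] sym_gens_deg[OF g'(1)] by simp
    then show ?thesis using k by (simp add: mon_deg_eq_0_iff)
  qed
  moreover have "g \<in> sym_mons" using g sym_gens_sub by blast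
  ultimately show "g \<in> min_gens (mon_span sym_mons :: (nat, 'k) mpoly set)"
    unfolding min_gens_def monomial_mem_mon_span by blast
qed

lemma sigma_gin_cliques:
  "sigma_ideal n (gin n (stanley_reisner n cliques)) = (stanley_reisner n shifted :: (nat, 'k::field_char_0) mpoly set)"
proof -
  have "{monomial (sigma u) | u. u \<in> sym_gens} = ({monomial (sqfree F) | F. F \<in> ext_gens} :: (nat, 'k) mpoly set)"
  proof (intro equalityI subsetI)
    fix p :: "(nat, 'k) mpoly" assume "p \<in> {monomial (sigma u) | u. u \<in> sym_gens}"
    then obtain i j where ij: "i \<le> j" "j < n" "low i j"
      "p = monomial (sigma (single i 1 + single j 1))"
      unfolding sym_gens_def by blast
    \<comment> \<open>This keeps the shifted index \<open>Suc j\<close> below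
      \<open>n\<close>.\<close>
    have "j \<noteq> n - 1" using not_low_last[of j i] ij(2,3) by blast
    then have "{i, Suc j} \<in> ext_gens"
      unfolding ext_gens_def using ij(1-3) by (intro CollectI exI[of _ i] exI[of _ "Suc j"]) auto
    then show "p \<in> {monomial (sqfree F) | F. F \<in> ext_gens}"
      unfolding ij(4) sigma_pair[OF ij(1)] by blast
  next
    fix p :: "(nat, 'k) mpoly" assume "p \<in> {monomial (sqfree F) | F. F \<in> ext_gens}"
    then obtain i j where ij: "i < j" "j < n" "low i (j - 1)" "p = monomial (sqfree {i, j})"
      unfolding ext_gens_def by blast
    then obtain l where l: "j = Suc l" "i \<le> l" by (cases j) auto
    have "single i 1 + single l 1 \<in> sym_gens"
      unfolding sym_gens_def using ij(2,3) l by (intro CollectI exI[of _ i] exI[of _ l]) simp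
    moreover have "p = monomial (sigma (single i 1 + single l 1))"
      unfolding ij(4) l(1) sigma_pair[OF l(2)] ..
    ultimately show "p \<in> {monomial (sigma u) | u. u \<in> sym_gens}" by blast
  qed
  then have "sigma_ideal n (gin n (stanley_reisner n cliques)) =
      (Idl\<^bsub>poly_ring {..<n}\<^esub> {monomial (sqfree F) | F. F \<in> ext_gens} :: (nat, 'k) mpoly set)"
    by (simp only: sigma_ideal_def gin_cliques min_gens_sym_mons)
  also have "\<dots> = mon_span {m. keys m \<subseteq> {..<n} \<and> (\<exists>F\<in>ext_gens. F \<subseteq> keys m)}"
    by (rule Idl_sqfree) (auto simp: ext_gens_def)
  also have "{m. keys m \<subseteq> {..<n} \<and> (\<exists>F\<in>ext_gens. F \<subseteq> keys m)} =
      {m :: nat mon. keys m \<subseteq> {..<n} \<and> keys m \<notin> shifted}"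
    using shifted_iff by blast
  also have "mon_span \<dots> = (stanley_reisner n shifted :: (nat, 'k) mpoly set)"
    by (rule stanley_reisner_eq[OF shifted_complex, symmetric])
  finally show ?thesis .
qed

end

theorem theorem4p14:
  fixes n :: nat and E :: "nat set set"
  assumes "simple_graph n E"
    and "chordal E"
  shows "exterior_shift TYPE('k::field_char_0) n (clique_complex n E) =
    symmetric_shift TYPE('k) n (clique_complex n E)"
proof -
  have loops: "{v} \<notin> E" for v
    using assms(1) by (auto simp: simple_graph_def)
  obtain pos :: "nat \<Rightarrow> nat" where pos: "inj_on pos {..<n}"
    "\<forall>v\<in>{..<n}. \<forall>a\<in>{..<n}. \<forall>b\<in>{..<n}. pos a < pos v \<longrightarrow> pos b < pos v \<longrightarrow>
      {a, v} \<in> E \<longrightarrow> {b, v} \<in> E \<longrightarrow> a \<noteq> b \<longrightarrow> {a, b} \<in> E"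
    using chordal_perfect_elimination[OF assms(2) loops finite_lessThan] by blast
  interpret elimination_order n E pos
    by unfold_locales (use assms(1) pos in auto)
  have "exterior_shift TYPE('k) n cliques = shifted"
    by (rule exterior_shift_eqI[OF shifted_complex ext_gin_cliques])
  moreover have "symmetric_shift TYPE('k) n cliques = shifted"
    by (rule symmetric_shift_eqI[OF shifted_complex sigma_gin_cliques])
  ultimately show ?thesis by simp
qed

end
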